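(* Let $\mathcal V$ be a descent category and $k$ a positive integer. (i) If $X$ is a $k$-category, then the simplicial space $\mathcal{G}(X)$ with $\mathcal G(X)_n=\mathrm{Map}(\boldsymbol\Delta^n,X)$ is a $k$-groupoid. (ii) If $f:X\to Y$ is a quasi-fibration of $k$-categories, then $\mathcal G(f):\mathcal G(X)\to\mathcal G(Y)$ is a fibration of $k$-groupoids. (iii) If $f:X\to Y$ is a hypercover of $k$-categories, then $\mathcal G(f)$ is a hypercover of $k$-groupoids.
   Context: A descent category is a small category $\mathcal V$ with a subcategory of morphisms called covers such that: $\mathcal V$ has finite limits; pullbacks of covers are covers; if $f$ and $g\circ f$ are covers then $g$ is a cover. A simplicial space is a simplicial object in $\mathcal V$. For a simplicial space $X$ and a simplicial set $T$, $\mathrm{Map}(T,X)$ denotes the limit representing simplicial maps $T\to X$ (a finite limit for finite $T$; for the $(k+1)$-coskeletal simplicial spaces considered here, e.g. $k$-categories, it equals $\mathrm{Map}(\mathrm{sk}_{k+1}T,X)$). For $f:X\to Y$ and $S\subset T$, $\mathrm{Map}(S\hookrightarrow T,f)=\mathrm{Map}(S,X)\times_{\mathrm{Map}(S,Y)}\mathrm{Map}(T,Y)$. $\Lambda^n_i=\bigcup_{j\neq i}\partial_j\Delta^n$ is the horn. The thick simplex $\boldsymbol\Delta^n$ is the nerve of the groupoid with objects $\{0,\dots,n\}$ and exactly one morphism between any two objects; its $m$-simplices are all functions $\{0,\dots,m\}\to\{0,\dots,n\}$, and $\Delta^n\subset\boldsymbol\Delta^n$ consists of the monotone ones. A $k$-category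 is a simplicial space $X$ such that $X_n\to\mathrm{Map}(\Lambda^n_i,X)$ is a cover for $0<i<n$, and an isomorphism for $n>k$, and $\mathrm{Map}(\boldsymbol\Delta^1,X)\to X_0$ (restriction to a vertex) is a cover. A $k$-groupoid is a simplicial space with $X_n\to\mathrm{Map}(\Lambda^n_i,X)$ a cover for all $n>0$, $0\le i\le n$, an isomorphism for $n>k$. A morphism $f:X\to Y$ is a quasi-fibration (of $k$-categories) if $X_n\to\mathrm{Map}(\Lambda^n_i\hookrightarrow\Delta^n,f)$ is a cover for $0<i<n$ and $\mathrm{Map}(\boldsymbol\Delta^1,X)\to X_0\times_{Y_0}\mathrm{Map}(\boldsymbol\Delta^1,Y)$ (induced by a vertex $\Delta^0\hookrightarrow\boldsymbol\Delta^1$) is a cover; a fibration if $X_n\to\mathrm{Map}(\Lambda^n_i\hookrightarrow\Delta^n,f)$ is a cover for all $n>0$, $0\le i\le n$; a hypercover if $X_n\to\mathrm{Map}(\partial\Delta^n\hookrightarrow\Delta^n,f)$ is a cover for all $n\ge0$. *)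

theory Defs
  imports Main
begin

record ('o, 'a) cat =
  obj  :: "'o set"
  arr  :: "'a set"
  cdom :: "'a \<Rightarrow> 'o"
  ccod :: "'a \<Rightarrow> 'o"
  cmp  :: "'a \<Rightarrow> 'a \<Rightarrow> 'a"   (* cmp C g f = g o f *)
  idt  :: "'o \<Rightarrow> 'a"

definition hom :: "('o,'a) cat \<Rightarrow> 'o \<Rightarrow> 'o \<Rightarrow> 'a set" where
  "hom C x y = {f \<in> arr C. cdom C f = x \<and> ccod C f = y}"

definition is_category :: "('o,'a) cat \<Rightarrow> bool" where
  "is_category C \<longleftrightarrow>
     (\<forall>f\<in>arr C. cdom C f \<in> obj C \<and> ccod C f \<in> obj C) \<and>
     (\<forall>x\<in>obj C. idt C x \<in> hom C x x) \<and>
     (\<forall>f\<in>arr C. \<forall>g\<in>arr C. ccod C f = cdom C g \<longrightarrow>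
         cmp C g f \<in> hom C (cdom C f) (ccod C g)) \<and>
     (\<forall>f\<in>arr C. cmp C f (idt C (cdom C f)) = f \<and> cmp C (idt C (ccod C f)) f = f) \<and>
     (\<forall>f\<in>arr C. \<forall>g\<in>arr C. \<forall>h\<in>arr C. ccod C f = cdom C g \<longrightarrow> ccod C g = cdom C h \<longrightarrow>
         cmp C h (cmp C g f) = cmp C (cmp C h g) f)"

definition is_iso :: "('o,'a) cat \<Rightarrow> 'a \<Rightarrow> bool" where
  "is_iso C f \<longleftrightarrow> f \<in> arr C \<and>
     (\<exists>g\<in>hom C (ccod C f) (cdom C f).
        cmp C g f = idt C (cdom C f) \<and> cmp C f g = idt C (ccod C f))"

definition is_diagram ::
  "('o,'a) cat \<Rightarrow> nat set \<Rightarrow> nat set \<Rightarrow> (nat \<Rightarrow> nat) \<Rightarrow> (nat \<Rightarrow> nat) \<Rightarrow>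
   (nat \<Rightarrow> 'o) \<Rightarrow> (nat \<Rightarrow> 'a) \<Rightarrow> bool" where
  "is_diagram C J E s t D0 D1 \<longleftrightarrow>
     (\<forall>j\<in>J. D0 j \<in> obj C) \<and>
     (\<forall>e\<in>E. s e \<in> J \<and> t e \<in> J \<and> D1 e \<in> hom C (D0 (s e)) (D0 (t e)))"

definition is_graph_cone ::
  "('o,'a) cat \<Rightarrow> nat set \<Rightarrow> nat set \<Rightarrow> (nat \<Rightarrow> nat) \<Rightarrow> (nat \<Rightarrow> nat) \<Rightarrow>
   (nat \<Rightarrow> 'o) \<Rightarrow> (nat \<Rightarrow> 'a) \<Rightarrow> 'o \<Rightarrow> (nat \<Rightarrow> 'a) \<Rightarrow> bool" where
  "is_graph_cone C J E s t D0 D1 L p \<longleftrightarrow> L \<in> obj C \<and>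
     (\<forall>j\<in>J. p j \<in> hom C L (D0 j)) \<and>
     (\<forall>e\<in>E. cmp C (D1 e) (p (s e)) = p (t e))"

definition is_graph_limit ::
  "('o,'a) cat \<Rightarrow> nat set \<Rightarrow> nat set \<Rightarrow> (nat \<Rightarrow> nat) \<Rightarrow> (nat \<Rightarrow> nat) \<Rightarrow>
   (nat \<Rightarrow> 'o) \<Rightarrow> (nat \<Rightarrow> 'a) \<Rightarrow> 'o \<Rightarrow> (nat \<Rightarrow> 'a) \<Rightarrow> bool" where
  "is_graph_limit C J E s t D0 D1 L p \<longleftrightarrow> is_graph_cone C J E s t D0 D1 L p \<and>
     (\<forall>L' p'. is_graph_cone C J E s t D0 D1 L' p' \<longrightarrow>
        (\<exists>!u. u \<in> hom C L' L \<and> (\<forall>j\<in>J. cmp C (p j) u = p' j)))"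

definition has_finite_limits :: "('o,'a) cat \<Rightarrow> bool" where
  "has_finite_limits C \<longleftrightarrow>
     (\<forall>J E s t D0 D1. finite J \<and> finite E \<and> is_diagram C J E s t D0 D1 \<longrightarrow>
        (\<exists>L p. is_graph_limit C J E s t D0 D1 L p))"

definition is_pullback :: "('o,'a) cat \<Rightarrow> 'a \<Rightarrow> 'a \<Rightarrow> 'a \<Rightarrow> 'a \<Rightarrow> bool" where
  "is_pullback C f g p q \<longleftrightarrow>
     f \<in> arr C \<and> g \<in> arr C \<and> p \<in> arr C \<and> q \<in> arr C \<and>
     ccod C f = ccod C g \<and> ccod C p = cdom C f \<and> ccod C q = cdom C g \<and>
     cdom C p = cdom C q \<and> cmp C f p = cmp C g q \<and>
     (\<forall>p' q'. p' \<in> arr C \<and> q' \<in> arr C \<and> ccod C p' = cdom C f \<and> ccod C q' = cdom C g \<and>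
        cdom C p' = cdom C q' \<and> cmp C f p' = cmp C g q' \<longrightarrow>
        (\<exists>!u. u \<in> hom C (cdom C p') (cdom C p) \<and> cmp C p u = p' \<and> cmp C q u = q'))"

definition descent_category :: "('o,'a) cat \<Rightarrow> 'a set \<Rightarrow> bool" where
  "descent_category C Cov \<longleftrightarrow>
     is_category C \<and> has_finite_limits C \<and>
     \<comment> \<open>covers form a (wide) subcategory\<close>
     Cov \<subseteq> arr C \<and> (\<forall>x\<in>obj C. idt C x \<in> Cov) \<and>
     (\<forall>f\<in>Cov. \<forall>g\<in>Cov. ccod C f = cdom C g \<longrightarrow> cmp C g f \<in> Cov) \<and>
     \<comment> \<open>pullbacks of covers are covers (q is the pullback of f along g)\<close>
     (\<forall>f g p q. is_pullback C f g p q \<and> f \<in> Cov \<longrightarrow> q \<in> Cov) \<and>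
     \<comment> \<open>if f and g o f are covers then g is a cover\<close>
     (\<forall>f g. f \<in> Cov \<and> g \<in> arr C \<and> ccod C f = cdom C g \<and> cmp C g f \<in> Cov \<longrightarrow> g \<in> Cov)"

text \<open>A map [m] -> [n] is encoded as the list of its values (length m+1, entries \<le> n);
  composition  theta o phi  is  map ((!) theta) phi.\<close>

definition all_maps :: "nat \<Rightarrow> nat \<Rightarrow> nat list set" where
  "all_maps m n = {\<theta>. length \<theta> = Suc m \<and> (\<forall>i\<in>set \<theta>. i \<le> n)}"

definition mono_maps :: "nat \<Rightarrow> nat \<Rightarrow> nat list set" where
  "mono_maps m n = {\<theta> \<in> all_maps m n. sorted \<theta>}"

definition ocomp :: "nat list \<Rightarrow> nat list \<Rightarrow> nat list" where
  "ocomp \<theta> \<phi> = map ((!) \<theta>) \<phi>"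

text \<open>Sub-simplicial sets of the thick simplex, given by their sets of m-simplices.\<close>

definition thick_simplex :: "nat \<Rightarrow> nat \<Rightarrow> nat list set" where
  "thick_simplex n m = all_maps m n"

definition std_simplex :: "nat \<Rightarrow> nat \<Rightarrow> nat list set" where
  "std_simplex n m = mono_maps m n"

definition bdry_simplex :: "nat \<Rightarrow> nat \<Rightarrow> nat list set" where
  "bdry_simplex n m = {\<sigma> \<in> mono_maps m n. set \<sigma> \<noteq> {0..n}}"

definition horn :: "nat \<Rightarrow> nat \<Rightarrow> nat \<Rightarrow> nat list set" where
  "horn n i m = {\<sigma> \<in> mono_maps m n. \<exists>j\<le>n. j \<noteq> i \<and> j \<notin> set \<sigma>}"

definition vertex0 :: "nat \<Rightarrow> nat list set" where
  \<comment> \<open>the vertex 0, a copy of Delta^0 inside the thick simplex\<close>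
  "vertex0 m = {replicate (Suc m) 0}"

definition simplicial_obj ::
  "('o,'a) cat \<Rightarrow> (nat \<Rightarrow> 'o) \<Rightarrow> (nat \<Rightarrow> nat \<Rightarrow> nat list \<Rightarrow> 'a) \<Rightarrow> bool" where
  "simplicial_obj C Xo Xa \<longleftrightarrow>
     (\<forall>n. Xo n \<in> obj C) \<and>
     (\<forall>n m \<theta>. \<theta> \<in> mono_maps m n \<longrightarrow> Xa n m \<theta> \<in> hom C (Xo n) (Xo m)) \<and>
     (\<forall>n. Xa n n [0..<Suc n] = idt C (Xo n)) \<and>
     (\<forall>n m l \<theta> \<phi>. \<theta> \<in> mono_maps m n \<longrightarrow> \<phi> \<in> mono_maps l m \<longrightarrow>
        Xa n l (ocomp \<theta> \<phi>) = cmp C (Xa m l \<phi>) (Xa n m \<theta>))"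

definition simplicial_map ::
  "('o,'a) cat \<Rightarrow> (nat \<Rightarrow> 'o) \<Rightarrow> (nat \<Rightarrow> nat \<Rightarrow> nat list \<Rightarrow> 'a) \<Rightarrow>
   (nat \<Rightarrow> 'o) \<Rightarrow> (nat \<Rightarrow> nat \<Rightarrow> nat list \<Rightarrow> 'a) \<Rightarrow> (nat \<Rightarrow> 'a) \<Rightarrow> bool" where
  "simplicial_map C Xo Xa Yo Ya f \<longleftrightarrow>
     simplicial_obj C Xo Xa \<and> simplicial_obj C Yo Ya \<and>
     (\<forall>n. f n \<in> hom C (Xo n) (Yo n)) \<and>
     (\<forall>n m \<theta>. \<theta> \<in> mono_maps m n \<longrightarrow> cmp C (Ya n m \<theta>) (f n) = cmp C (f m) (Xa n m \<theta>))"

text \<open>A cone from L over the simplices of T (a sub-simplicial set of a thick simplex)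
  into X is exactly a simplicial map T -> Hom(L, X); Map(T,X) is the universal one.\<close>

definition ss_cone ::
  "('o,'a) cat \<Rightarrow> (nat \<Rightarrow> 'o) \<Rightarrow> (nat \<Rightarrow> nat \<Rightarrow> nat list \<Rightarrow> 'a) \<Rightarrow> (nat \<Rightarrow> nat list set) \<Rightarrow>
   'o \<Rightarrow> (nat \<Rightarrow> nat list \<Rightarrow> 'a) \<Rightarrow> bool" where
  "ss_cone C Xo Xa T L p \<longleftrightarrow> L \<in> obj C \<and>
     (\<forall>m. \<forall>\<sigma>\<in>T m. p m \<sigma> \<in> hom C L (Xo m)) \<and>
     (\<forall>m l \<sigma> \<theta>. \<sigma> \<in> T m \<longrightarrow> \<theta> \<in> mono_maps l m \<longrightarrow>
        cmp C (Xa m l \<theta>) (p m \<sigma>) = p l (ocomp \<sigma> \<theta>))"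

definition is_Map ::
  "('o,'a) cat \<Rightarrow> (nat \<Rightarrow> 'o) \<Rightarrow> (nat \<Rightarrow> nat \<Rightarrow> nat list \<Rightarrow> 'a) \<Rightarrow> (nat \<Rightarrow> nat list set) \<Rightarrow>
   'o \<Rightarrow> (nat \<Rightarrow> nat list \<Rightarrow> 'a) \<Rightarrow> bool" where
  "is_Map C Xo Xa T L p \<longleftrightarrow> ss_cone C Xo Xa T L p \<and>
     (\<forall>L' p'. ss_cone C Xo Xa T L' p' \<longrightarrow>
        (\<exists>!u. u \<in> hom C L' L \<and> (\<forall>m. \<forall>\<sigma>\<in>T m. cmp C (p m \<sigma>) u = p' m \<sigma>)))"

text \<open>Map(S -> T, f) = Map(S,X) x_{Map(S,Y)} Map(T,Y): universal pair of a cone over S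
  into X and a cone over T into Y that agree after applying f on S.\<close>

definition rel_cone ::
  "('o,'a) cat \<Rightarrow> (nat \<Rightarrow> 'o) \<Rightarrow> (nat \<Rightarrow> nat \<Rightarrow> nat list \<Rightarrow> 'a) \<Rightarrow>
   (nat \<Rightarrow> 'o) \<Rightarrow> (nat \<Rightarrow> nat \<Rightarrow> nat list \<Rightarrow> 'a) \<Rightarrow> (nat \<Rightarrow> 'a) \<Rightarrow>
   (nat \<Rightarrow> nat list set) \<Rightarrow> (nat \<Rightarrow> nat list set) \<Rightarrow>
   'o \<Rightarrow> (nat \<Rightarrow> nat list \<Rightarrow> 'a) \<Rightarrow> (nat \<Rightarrow> nat list \<Rightarrow> 'a) \<Rightarrow> bool" where
  "rel_cone C Xo Xa Yo Ya f S T L pX pY \<longleftrightarrow>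
     ss_cone C Xo Xa S L pX \<and> ss_cone C Yo Ya T L pY \<and>
     (\<forall>m. \<forall>\<sigma>\<in>S m. cmp C (f m) (pX m \<sigma>) = pY m \<sigma>)"

definition is_relMap ::
  "('o,'a) cat \<Rightarrow> (nat \<Rightarrow> 'o) \<Rightarrow> (nat \<Rightarrow> nat \<Rightarrow> nat list \<Rightarrow> 'a) \<Rightarrow>
   (nat \<Rightarrow> 'o) \<Rightarrow> (nat \<Rightarrow> nat \<Rightarrow> nat list \<Rightarrow> 'a) \<Rightarrow> (nat \<Rightarrow> 'a) \<Rightarrow>
   (nat \<Rightarrow> nat list set) \<Rightarrow> (nat \<Rightarrow> nat list set) \<Rightarrow>
   'o \<Rightarrow> (nat \<Rightarrow> nat list \<Rightarrow> 'a) \<Rightarrow> (nat \<Rightarrow> nat list \<Rightarrow> 'a) \<Rightarrow> bool" where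
  "is_relMap C Xo Xa Yo Ya f S T L pX pY \<longleftrightarrow> rel_cone C Xo Xa Yo Ya f S T L pX pY \<and>
     (\<forall>L' pX' pY'. rel_cone C Xo Xa Yo Ya f S T L' pX' pY' \<longrightarrow>
        (\<exists>!u. u \<in> hom C L' L \<and> (\<forall>m. \<forall>\<sigma>\<in>S m. cmp C (pX m \<sigma>) u = pX' m \<sigma>) \<and>
              (\<forall>m. \<forall>\<tau>\<in>T m. cmp C (pY m \<tau>) u = pY' m \<tau>)))"

text \<open>The canonical map X_n -> Map(T, X) for T a sub-simplicial set of Delta^n
  (the cone sigma |-> X(sigma)) is a cover / an isomorphism.\<close>

definition restr_cover ::
  "('o,'a) cat \<Rightarrow> 'a set \<Rightarrow> (nat \<Rightarrow> 'o) \<Rightarrow> (nat \<Rightarrow> nat \<Rightarrow> nat list \<Rightarrow> 'a) \<Rightarrow>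
   nat \<Rightarrow> (nat \<Rightarrow> nat list set) \<Rightarrow> bool" where
  "restr_cover C Cov Xo Xa n T \<longleftrightarrow>
     (\<exists>L p u. is_Map C Xo Xa T L p \<and> u \<in> hom C (Xo n) L \<and>
        (\<forall>m. \<forall>\<sigma>\<in>T m. cmp C (p m \<sigma>) u = Xa n m \<sigma>) \<and> u \<in> Cov)"

definition restr_iso ::
  "('o,'a) cat \<Rightarrow> (nat \<Rightarrow> 'o) \<Rightarrow> (nat \<Rightarrow> nat \<Rightarrow> nat list \<Rightarrow> 'a) \<Rightarrow>
   nat \<Rightarrow> (nat \<Rightarrow> nat list set) \<Rightarrow> bool" where
  "restr_iso C Xo Xa n T \<longleftrightarrow>
     (\<exists>L p u. is_Map C Xo Xa T L p \<and> u \<in> hom C (Xo n) L \<and>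
        (\<forall>m. \<forall>\<sigma>\<in>T m. cmp C (p m \<sigma>) u = Xa n m \<sigma>) \<and> is_iso C u)"

text \<open>Given an object A with a cone a over T into X, the canonical map
  A -> Map(S -> T, f) (induced by a restricted to S, and f o a) is a cover.\<close>

definition rel_cover ::
  "('o,'a) cat \<Rightarrow> 'a set \<Rightarrow> (nat \<Rightarrow> 'o) \<Rightarrow> (nat \<Rightarrow> nat \<Rightarrow> nat list \<Rightarrow> 'a) \<Rightarrow>
   (nat \<Rightarrow> 'o) \<Rightarrow> (nat \<Rightarrow> nat \<Rightarrow> nat list \<Rightarrow> 'a) \<Rightarrow> (nat \<Rightarrow> 'a) \<Rightarrow>
   (nat \<Rightarrow> nat list set) \<Rightarrow> (nat \<Rightarrow> nat list set) \<Rightarrow>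
   'o \<Rightarrow> (nat \<Rightarrow> nat list \<Rightarrow> 'a) \<Rightarrow> bool" where
  "rel_cover C Cov Xo Xa Yo Ya f S T A a \<longleftrightarrow>
     (\<exists>L pX pY u. is_relMap C Xo Xa Yo Ya f S T L pX pY \<and> u \<in> hom C A L \<and>
        (\<forall>m. \<forall>\<sigma>\<in>S m. cmp C (pX m \<sigma>) u = a m \<sigma>) \<and>
        (\<forall>m. \<forall>\<tau>\<in>T m. cmp C (pY m \<tau>) u = cmp C (f m) (a m \<tau>)) \<and>
        u \<in> Cov)"

definition k_category ::
  "('o,'a) cat \<Rightarrow> 'a set \<Rightarrow> nat \<Rightarrow> (nat \<Rightarrow> 'o) \<Rightarrow> (nat \<Rightarrow> nat \<Rightarrow> nat list \<Rightarrow> 'a) \<Rightarrow> bool" where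
  "k_category C Cov k Xo Xa \<longleftrightarrow> simplicial_obj C Xo Xa \<and>
     (\<forall>n i. 0 < i \<and> i < n \<longrightarrow> restr_cover C Cov Xo Xa n (horn n i)) \<and>
     (\<forall>n i. 0 < i \<and> i < n \<and> k < n \<longrightarrow> restr_iso C Xo Xa n (horn n i)) \<and>
     \<comment> \<open>Map(thick Delta^1, X) -> X_0, restriction to the vertex 0, is a cover\<close>
     (\<exists>L p. is_Map C Xo Xa (thick_simplex 1) L p \<and> p 0 [0] \<in> Cov)"

definition k_groupoid ::
  "('o,'a) cat \<Rightarrow> 'a set \<Rightarrow> nat \<Rightarrow> (nat \<Rightarrow> 'o) \<Rightarrow> (nat \<Rightarrow> nat \<Rightarrow> nat list \<Rightarrow> 'a) \<Rightarrow> bool" where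
  "k_groupoid C Cov k Xo Xa \<longleftrightarrow> simplicial_obj C Xo Xa \<and>
     (\<forall>n i. 0 < n \<and> i \<le> n \<longrightarrow> restr_cover C Cov Xo Xa n (horn n i)) \<and>
     (\<forall>n i. 0 < n \<and> i \<le> n \<and> k < n \<longrightarrow> restr_iso C Xo Xa n (horn n i))"

definition quasi_fibration ::
  "('o,'a) cat \<Rightarrow> 'a set \<Rightarrow> (nat \<Rightarrow> 'o) \<Rightarrow> (nat \<Rightarrow> nat \<Rightarrow> nat list \<Rightarrow> 'a) \<Rightarrow>
   (nat \<Rightarrow> 'o) \<Rightarrow> (nat \<Rightarrow> nat \<Rightarrow> nat list \<Rightarrow> 'a) \<Rightarrow> (nat \<Rightarrow> 'a) \<Rightarrow> bool" where
  "quasi_fibration C Cov Xo Xa Yo Ya f \<longleftrightarrow> simplicial_map C Xo Xa Yo Ya f \<and>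
     (\<forall>n i. 0 < i \<and> i < n \<longrightarrow>
        rel_cover C Cov Xo Xa Yo Ya f (horn n i) (std_simplex n) (Xo n) (\<lambda>m \<sigma>. Xa n m \<sigma>)) \<and>
     \<comment> \<open>Map(thick Delta^1, X) -> X_0 x_{Y_0} Map(thick Delta^1, Y)\<close>
     (\<exists>L p. is_Map C Xo Xa (thick_simplex 1) L p \<and>
        rel_cover C Cov Xo Xa Yo Ya f vertex0 (thick_simplex 1) L p)"

definition fibration ::
  "('o,'a) cat \<Rightarrow> 'a set \<Rightarrow> (nat \<Rightarrow> 'o) \<Rightarrow> (nat \<Rightarrow> nat \<Rightarrow> nat list \<Rightarrow> 'a) \<Rightarrow>
   (nat \<Rightarrow> 'o) \<Rightarrow> (nat \<Rightarrow> nat \<Rightarrow> nat list \<Rightarrow> 'a) \<Rightarrow> (nat \<Rightarrow> 'a) \<Rightarrow> bool" where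
  "fibration C Cov Xo Xa Yo Ya f \<longleftrightarrow> simplicial_map C Xo Xa Yo Ya f \<and>
     (\<forall>n i. 0 < n \<and> i \<le> n \<longrightarrow>
        rel_cover C Cov Xo Xa Yo Ya f (horn n i) (std_simplex n) (Xo n) (\<lambda>m \<sigma>. Xa n m \<sigma>))"

definition hypercover ::
  "('o,'a) cat \<Rightarrow> 'a set \<Rightarrow> (nat \<Rightarrow> 'o) \<Rightarrow> (nat \<Rightarrow> nat \<Rightarrow> nat list \<Rightarrow> 'a) \<Rightarrow>
   (nat \<Rightarrow> 'o) \<Rightarrow> (nat \<Rightarrow> nat \<Rightarrow> nat list \<Rightarrow> 'a) \<Rightarrow> (nat \<Rightarrow> 'a) \<Rightarrow> bool" where
  "hypercover C Cov Xo Xa Yo Ya f \<longleftrightarrow> simplicial_map C Xo Xa Yo Ya f \<and>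
     (\<forall>n. rel_cover C Cov Xo Xa Yo Ya f (bdry_simplex n) (std_simplex n) (Xo n) (\<lambda>m \<sigma>. Xa n m \<sigma>))"

text \<open>(Go, Ga) is G(X), witnessed by limit cones pG n : Go n -> X over the thick
  n-simplex, with G(theta) : G_n -> G_m induced by precomposition with
  thick Delta^m -> thick Delta^n,  sigma |-> theta o sigma.\<close>

definition is_G ::
  "('o,'a) cat \<Rightarrow> (nat \<Rightarrow> 'o) \<Rightarrow> (nat \<Rightarrow> nat \<Rightarrow> nat list \<Rightarrow> 'a) \<Rightarrow>
   (nat \<Rightarrow> 'o) \<Rightarrow> (nat \<Rightarrow> nat \<Rightarrow> nat list \<Rightarrow> 'a) \<Rightarrow> (nat \<Rightarrow> nat \<Rightarrow> nat list \<Rightarrow> 'a) \<Rightarrow> bool" where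
  "is_G C Xo Xa Go Ga pG \<longleftrightarrow> simplicial_obj C Go Ga \<and>
     (\<forall>n. is_Map C Xo Xa (thick_simplex n) (Go n) (pG n)) \<and>
     (\<forall>n m \<theta> l \<sigma>. \<theta> \<in> mono_maps m n \<longrightarrow> \<sigma> \<in> thick_simplex m l \<longrightarrow>
        cmp C (pG m l \<sigma>) (Ga n m \<theta>) = pG n l (ocomp \<theta> \<sigma>))"

definition is_Gmap ::
  "('o,'a) cat \<Rightarrow> (nat \<Rightarrow> 'a) \<Rightarrow> (nat \<Rightarrow> 'o) \<Rightarrow> (nat \<Rightarrow> nat \<Rightarrow> nat list \<Rightarrow> 'a) \<Rightarrow>
   (nat \<Rightarrow> 'o) \<Rightarrow> (nat \<Rightarrow> nat \<Rightarrow> nat list \<Rightarrow> 'a) \<Rightarrow> (nat \<Rightarrow> 'a) \<Rightarrow> bool" where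
  "is_Gmap C f GXo pGX GYo pGY Gf \<longleftrightarrow>
     (\<forall>n. Gf n \<in> hom C (GXo n) (GYo n) \<and>
        (\<forall>l. \<forall>\<sigma>\<in>thick_simplex n l. cmp C (pGY n l \<sigma>) (Gf n) = cmp C (f l) (pGX n l \<sigma>)))"

end

theory Submission
  imports Defs
begin

text \<open>
  The \<open>m\<close>-simplices of the thick simplex on a vertex set \<open>V\<close> are the words of length \<open>m + 1\<close>
  in the alphabet \<open>V\<close>, and the nondegenerate ones are the words without equal neighbours. Maps
  from a union of faces of \<open>\<Delta>\<^sup>n\<close> to \<open>G(X)\<close> are maps from the corresponding union of
  thick faces to \<open>X\<close>, so everything reduces to the inclusion of the thick horn, or the thick
  boundary, into the thick simplex.

  Let \<open>|V| \<ge> 3\<close> and let \<open>i\<close> be the vertex of the horn. A nondegenerate word \<open>w\<close> outside the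
  thick horn contains all letters other than \<open>i\<close>. Look at the first place where a second letter
  \<open>y \<noteq> i\<close> appears after copies of \<open>x\<close> and \<open>i\<close>: there \<open>w\<close> reads either \<open>x i y\<close> (closed) or
  \<open>x y\<close> (open). Deleting this \<open>i\<close> pairs the closed words with the open ones, and the thick simplex
  arises from the thick horn by filling, for each closed word, the inner horn opposite to its open
  partner. The closed words are attached by increasing length and, for a given length, by decreasing
  number of letters \<open>i\<close>. Each step is a pullback of an inner horn map, hence a cover, and an
  isomorphism in dimensions above \<open>k\<close>; this makes the infinite filtration harmless. For \<open>|V| = 2\<close>
  the claim is the condition on the thick 1-simplex. In the boundary case all nondegenerate words
  that use every letter are attached along their boundaries, which is an isomorphism from dimension
  \<open>k + 2\<close> on.

  The absolute statements are the relative ones over the terminal simplicial object, and covers and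
  isomorphisms are treated simultaneously as classes of arrows stable under pullback.
\<close>

section \<open>Categories with stable classes of arrows\<close>

text \<open>The category has only finite limits, while \<open>Map\<close> of a thick simplex is a
  limit over infinitely many words, so its existence has to be proved along with its properties. For
  this reason the central notion \<open>extends\<close> takes a mapping object over a smaller
  complex and delivers one over the larger complex together with the restriction map: the filtration
  constructs the limit and at the same time shows that the restriction lies in the class. An
  infinite tower of covers need not have a limit in the category, nor a composite that is a cover.
  Hence all but finitely many steps must be isomorphisms, which is why words are filtered by length,
  with finitely many cells in each stage. A closed word outside the horn uses every letter of
  \<open>V\<close>, so no cell of dimension below \<open>card V - 1\<close> is ever attached. If the
  horn of G(X) has dimension n > k, every step is therefore an isomorphism, and the same filtration,
  read for the class of isomorphisms, gives the unique horn fillers in G(X).\<close>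

lemma in_hom_iff: "f \<in> hom C x y \<longleftrightarrow> f \<in> arr C \<and> cdom C f = x \<and> ccod C f = y"
  by (simp add: hom_def)

lemma hom_arr: "f \<in> hom C x y \<Longrightarrow> f \<in> arr C"
  and hom_dom: "f \<in> hom C x y \<Longrightarrow> cdom C f = x"
  and hom_cod: "f \<in> hom C x y \<Longrightarrow> ccod C f = y"
  by (simp_all add: hom_def)

locale small_category =
  fixes C :: "('o,'a) cat"
  assumes is_category: "is_category C"
begin

abbreviation comp (infixr "\<cdot>" 70) where "g \<cdot> f \<equiv> cmp C g f"

lemma comp_arr [simp]:
  assumes "f \<in> arr C" "g \<in> arr C" "ccod C f = cdom C g"
  shows "g \<cdot> f \<in> arr C" "cdom C (g \<cdot> f) = cdom C f" "ccod C (g \<cdot> f) = ccod C g"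
  using is_category assms unfolding is_category_def hom_def by blast+

lemma comp_hom: "f \<in> hom C x y \<Longrightarrow> g \<in> hom C y z \<Longrightarrow> g \<cdot> f \<in> hom C x z"
  by (simp add: in_hom_iff)

lemma arr_obj: "f \<in> arr C \<Longrightarrow> cdom C f \<in> obj C" "f \<in> arr C \<Longrightarrow> ccod C f \<in> obj C"
  using is_category unfolding is_category_def by blast+

lemma hom_obj: "f \<in> hom C x y \<Longrightarrow> x \<in> obj C" "f \<in> hom C x y \<Longrightarrow> y \<in> obj C"
  using arr_obj by (auto simp: in_hom_iff)

lemma idt_hom: "x \<in> obj C \<Longrightarrow> idt C x \<in> hom C x x"
  using is_category unfolding is_category_def by blast

lemma idt_arr [simp]:
  "x \<in> obj C \<Longrightarrow> idt C x \<in> arr C" "x \<in> obj C \<Longrightarrow> cdom C (idt C x) = x"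
  "x \<in> obj C \<Longrightarrow> ccod C (idt C x) = x"
  using idt_hom by (auto simp: in_hom_iff)

lemma comp_idt [simp]: "f \<in> arr C \<Longrightarrow> cdom C f = x \<Longrightarrow> f \<cdot> idt C x = f"
  and idt_comp [simp]: "f \<in> arr C \<Longrightarrow> ccod C f = y \<Longrightarrow> idt C y \<cdot> f = f"
  using is_category unfolding is_category_def by blast+

lemma comp_assoc [simp]:
  assumes "f \<in> arr C" "g \<in> arr C" "h \<in> arr C" "ccod C f = cdom C g" "ccod C g = cdom C h"
  shows "(h \<cdot> g) \<cdot> f = h \<cdot> (g \<cdot> f)"
  using is_category assms unfolding is_category_def by metis

lemma comp_assoc_hom:
  "f \<in> hom C x y \<Longrightarrow> g \<in> hom C y z \<Longrightarrow> h \<in> hom C z w \<Longrightarrow> (h \<cdot> g) \<cdot> f = h \<cdot> (g \<cdot> f)"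
  by (simp add: in_hom_iff)

lemma comp_cancel:
  assumes "v \<cdot> u = idt C x" "u \<in> hom C x y" "v \<in> hom C y x" "w \<in> hom C z x"
  shows "v \<cdot> (u \<cdot> w) = w"
  using comp_assoc_hom[OF assms(4,2,3)] assms by (simp only: idt_comp in_hom_iff)

lemma is_iso_obtain:
  assumes "is_iso C u" "u \<in> hom C x y"
  obtains v where "v \<in> hom C y x" "is_iso C v" "v \<cdot> u = idt C x" "u \<cdot> v = idt C y"
proof -
  obtain v where v: "v \<in> hom C y x" "v \<cdot> u = idt C x" "u \<cdot> v = idt C y"
    using assms unfolding is_iso_def by (auto simp: hom_dom hom_cod)
  then have "is_iso C v"
    using assms(2) unfolding is_iso_def by (auto simp: hom_arr hom_dom hom_cod)
  with v that show thesis by blast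
qed

lemma is_isoI:
  "u \<in> hom C x y \<Longrightarrow> v \<in> hom C y x \<Longrightarrow> v \<cdot> u = idt C x \<Longrightarrow> u \<cdot> v = idt C y \<Longrightarrow> is_iso C u"
  unfolding is_iso_def by (auto simp: hom_arr hom_dom hom_cod)

lemma is_iso_idt: "x \<in> obj C \<Longrightarrow> is_iso C (idt C x)"
  by (rule is_isoI[of _ x x "idt C x"]) (auto simp: in_hom_iff)

lemma is_iso_comp:
  assumes "is_iso C f" "f \<in> hom C x y" "is_iso C g" "g \<in> hom C y z"
  shows "is_iso C (g \<cdot> f)"
proof -
  obtain f' where f': "f' \<in> hom C y x" "f' \<cdot> f = idt C x" "f \<cdot> f' = idt C y"
    using is_iso_obtain[OF assms(1,2)] by metis
  obtain g' where g': "g' \<in> hom C z y" "g' \<cdot> g = idt C y" "g \<cdot> g' = idt C z"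
    using is_iso_obtain[OF assms(3,4)] by metis
  have gf: "g \<cdot> f \<in> hom C x z" "f' \<cdot> g' \<in> hom C z x"
    using assms f'(1) g'(1) comp_hom by blast+
  have "(f' \<cdot> g') \<cdot> (g \<cdot> f) = f' \<cdot> (g' \<cdot> (g \<cdot> f))"
    by (rule comp_assoc_hom[OF gf(1) g'(1) f'(1)])
  also have "\<dots> = idt C x"
    using comp_cancel[OF g'(2) assms(4) g'(1) assms(2)] f'(2) by simp
  finally have 1: "(f' \<cdot> g') \<cdot> (g \<cdot> f) = idt C x" .
  have "(g \<cdot> f) \<cdot> (f' \<cdot> g') = g \<cdot> (f \<cdot> (f' \<cdot> g'))"
    by (rule comp_assoc_hom[OF gf(2) assms(2,4)])
  also have "\<dots> = idt C z"
    using comp_cancel[OF f'(3) f'(1) assms(2) g'(1)] g'(3) by simp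
  finally show ?thesis using gf 1 by (intro is_isoI)
qed

text \<open>The inverse of \<open>q\<close> is the map into the pullback with components
  \<open>v \<cdot> g\<close> and the identity, where \<open>v\<close> inverts \<open>f\<close>. It
  is two-sided because \<open>p\<close> is determined by \<open>q\<close>.\<close>

lemma is_iso_pullback:
  assumes pb: "is_pullback C f g p q" and "is_iso C f"
  shows "is_iso C q"
proof -
  define x y P z where xy: "x = cdom C f" "y = ccod C f" "P = cdom C p" "z = cdom C g"
  have h: "f \<in> hom C x y" "g \<in> hom C z y" "p \<in> hom C P x" "q \<in> hom C P z" "f \<cdot> p = g \<cdot> q"
    using pb unfolding is_pullback_def xy in_hom_iff by presburger+
  have univ: "\<exists>!u. u \<in> hom C w P \<and> p \<cdot> u = p' \<and> q \<cdot> u = q'"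
    if "p' \<in> hom C w x" "q' \<in> hom C w z" "f \<cdot> p' = g \<cdot> q'" for p' q' w
  proof -
    have "p' \<in> arr C" "q' \<in> arr C" "ccod C p' = cdom C f" "ccod C q' = cdom C g"
      "cdom C p' = cdom C q'" "cdom C p' = w"
      using that by (simp_all add: in_hom_iff xy)
    then show ?thesis using pb that(3) unfolding is_pullback_def xy by blast
  qed
  obtain v where v: "v \<in> hom C y x" "v \<cdot> f = idt C x" "f \<cdot> v = idt C y"
    using is_iso_obtain[OF assms(2) h(1)] by metis
  have ob: "z \<in> obj C" "P \<in> obj C" using h hom_obj by blast+
  have "f \<cdot> (v \<cdot> g) = g \<cdot> idt C z"
    using comp_cancel[OF v(3,1) h(1,2)] h(2) by (simp add: in_hom_iff)
  then obtain s where s: "s \<in> hom C z P" "q \<cdot> s = idt C z"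
    using univ[of "v \<cdot> g" z "idt C z"] comp_hom[OF h(2) v(1)] idt_hom[OF ob(1)]
    by (auto simp: in_hom_iff)
  have pv: "p \<cdot> w = v \<cdot> (g \<cdot> (q \<cdot> w))" if w: "w \<in> hom C a P" for w a
  proof -
    have "p \<cdot> w = v \<cdot> (f \<cdot> (p \<cdot> w))"
      using comp_cancel[OF v(2) h(1) v(1) comp_hom[OF w h(3)]] by simp
    also have "f \<cdot> (p \<cdot> w) = g \<cdot> (q \<cdot> w)"
      using comp_assoc_hom[OF w h(3,1)] comp_assoc_hom[OF w h(4,2)] h(5) by simp
    finally show ?thesis .
  qed
  have qq: "q \<cdot> (s \<cdot> q) = q"
    by (rule comp_cancel[OF s(2,1) h(4) h(4)])
  have id: "p \<cdot> idt C P = p" "q \<cdot> idt C P = q" using h(3,4) by (simp_all add: in_hom_iff)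
  have "p \<cdot> (s \<cdot> q) = p"
    using pv[OF comp_hom[OF h(4) s(1)]] pv[OF idt_hom[OF ob(2)]] unfolding qq id by (rule trans[OF _ sym])
  with id qq have "s \<cdot> q = idt C P"
    using univ[OF h(3,4,5)] comp_hom[OF h(4) s(1)] idt_hom[OF ob(2)] by blast
  then show ?thesis using h(4) s by (intro is_isoI)
qed

end

text \<open>Isomorphisms are included because limits are determined only up to isomorphism, so every
  comparison of two representing objects composes with one.\<close>

definition stable_class :: "('o,'a) cat \<Rightarrow> 'a set \<Rightarrow> bool" where
  "stable_class C K \<longleftrightarrow> K \<subseteq> arr C \<and> {f. is_iso C f} \<subseteq> K \<and>
     (\<forall>f\<in>K. \<forall>g\<in>K. ccod C f = cdom C g \<longrightarrow> cmp C g f \<in> K) \<and>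
     (\<forall>f g p q. is_pullback C f g p q \<and> f \<in> K \<longrightarrow> q \<in> K)"

lemma stable_classD:
  assumes "stable_class C K"
  shows "f \<in> K \<Longrightarrow> f \<in> arr C" "is_iso C f \<Longrightarrow> f \<in> K"
    "f \<in> K \<Longrightarrow> g \<in> K \<Longrightarrow> ccod C f = cdom C g \<Longrightarrow> cmp C g f \<in> K"
    "is_pullback C f g p q \<Longrightarrow> f \<in> K \<Longrightarrow> q \<in> K"
  using assms unfolding stable_class_def by auto

lemma (in small_category) stable_class_isos: "stable_class C {f. is_iso C f}"
  unfolding stable_class_def
proof (intro conjI allI impI ballI)
  fix f g assume "f \<in> {f. is_iso C f}" "g \<in> {f. is_iso C f}" "ccod C f = cdom C g"
  then show "g \<cdot> f \<in> {f. is_iso C f}"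
    using is_iso_comp[of f "cdom C f" "ccod C f" g "ccod C g"]
    by (simp add: in_hom_iff is_iso_def[of C f] is_iso_def[of C g])
next
  fix f g p q assume "is_pullback C f g p q \<and> f \<in> {f. is_iso C f}"
  then show "q \<in> {f. is_iso C f}" using is_iso_pullback by blast
qed (auto simp: is_iso_def)

lemma descent_categoryD:
  assumes "descent_category C Cov"
  shows "is_category C" "has_finite_limits C" "Cov \<subseteq> arr C" "x \<in> obj C \<Longrightarrow> idt C x \<in> Cov"
    "f \<in> Cov \<Longrightarrow> g \<in> Cov \<Longrightarrow> ccod C f = cdom C g \<Longrightarrow> cmp C g f \<in> Cov"
    "is_pullback C f g p q \<Longrightarrow> f \<in> Cov \<Longrightarrow> q \<in> Cov"
  using assms unfolding descent_category_def by blast+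

lemma descent_category_stable:
  assumes "descent_category C Cov"
  shows "stable_class C Cov"
proof -
  interpret small_category C using descent_categoryD(1)[OF assms] by unfold_locales
  have "u \<in> Cov" if u: "is_iso C u" for u
  proof -
    define x y where xy: "x = cdom C u" "y = ccod C u"
    have h: "u \<in> hom C x y" using u unfolding is_iso_def xy in_hom_iff by auto
    obtain v where v: "v \<in> hom C y x" "v \<cdot> u = idt C x" "u \<cdot> v = idt C y"
      using is_iso_obtain[OF u h] by metis
    have ob: "y \<in> obj C" using h hom_obj by blast
    \<comment> \<open>An isomorphism into \<open>y\<close> is a possible projection in the pullback
      of the identity of \<open>y\<close> along itself, and identities are covers.\<close>
    have "is_pullback C (idt C y) (idt C y) u u"
      unfolding is_pullback_def
    proof (intro conjI allI impI)
      fix p' q' assume a: "p' \<in> arr C \<and> q' \<in> arr C \<and> ccod C p' = cdom C (idt C y) \<and>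
        ccod C q' = cdom C (idt C y) \<and> cdom C p' = cdom C q' \<and> idt C y \<cdot> p' = idt C y \<cdot> q'"
      have q': "p' \<in> hom C (cdom C p') y" "ccod C q' = y" "q' \<in> arr C"
        using a ob by (simp_all add: in_hom_iff)
      have pq: "p' = q'" "p' \<in> hom C (cdom C p') y"
        using a q' idt_comp by (metis in_hom_iff, blast)
      show "\<exists>!w. w \<in> hom C (cdom C p') (cdom C u) \<and> u \<cdot> w = p' \<and> u \<cdot> w = q'"
      proof (rule ex1I[of _ "v \<cdot> p'"])
        show "v \<cdot> p' \<in> hom C (cdom C p') (cdom C u) \<and> u \<cdot> (v \<cdot> p') = p' \<and> u \<cdot> (v \<cdot> p') = q'"
          using comp_cancel[OF v(3,1) h pq(2)] h pq comp_hom[OF pq(2) v(1)] by (simp add: in_hom_iff)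
      next
        fix w assume w: "w \<in> hom C (cdom C p') (cdom C u) \<and> u \<cdot> w = p' \<and> u \<cdot> w = q'"
        then show "w = v \<cdot> p'" using comp_cancel[OF v(2) h v(1)] h by (auto simp: in_hom_iff)
      qed
    qed (use h ob in \<open>simp_all add: in_hom_iff\<close>)
    then show "u \<in> Cov" using descent_categoryD(4)[OF assms ob] by (rule descent_categoryD(6)[OF assms])
  qed
  then show ?thesis using descent_categoryD(3,5,6)[OF assms] unfolding stable_class_def by blast
qed

section \<open>Pullbacks and the terminal object\<close>

locale finite_limit_category = small_category +
  assumes finite_limits: "has_finite_limits C"
begin

lemma pullback_exists:
  assumes f: "f \<in> hom C x z" and g: "g \<in> hom C y z"
  obtains p q P where "is_pullback C f g p q" "p \<in> hom C P x" "q \<in> hom C P y"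
proof -
  define D0 where "D0 j = (if j = 0 then x else if j = 1 then y else z)" for j :: nat
  define D1 where "D1 e = (if e = 0 then f else g)" for e :: nat
  define t where "t e = (2::nat)" for e :: nat
  have D: "is_diagram C {0,1,2} {0,1} id t D0 D1"
    using f g hom_obj unfolding is_diagram_def D0_def D1_def t_def by auto
  then obtain P p where lim: "is_graph_limit C {0,1,2} {0,1} id t D0 D1 P p"
    using finite_limits unfolding has_finite_limits_def by (meson finite.emptyI finite.insertI)
  then have cone: "is_graph_cone C {0,1,2} {0,1} id t D0 D1 P p"
    unfolding is_graph_limit_def by blast
  have h: "p 0 \<in> hom C P x" "p 1 \<in> hom C P y" "f \<cdot> p 0 = p 2" "g \<cdot> p 1 = p 2"
    using cone unfolding is_graph_cone_def D0_def D1_def t_def by auto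
  have "is_pullback C f g (p 0) (p 1)"
    unfolding is_pullback_def
  proof (intro conjI allI impI)
    fix p' q' assume a: "p' \<in> arr C \<and> q' \<in> arr C \<and> ccod C p' = cdom C f \<and>
        ccod C q' = cdom C g \<and> cdom C p' = cdom C q' \<and> f \<cdot> p' = g \<cdot> q'"
    \<comment> \<open>The third component, at the common target of \<open>f\<close> and
      \<open>g\<close>, is forced by the first.\<close>
    define c where "c j = (if j = 0 then p' else if j = 1 then q' else f \<cdot> p')" for j :: nat
    have "is_graph_cone C {0,1,2} {0,1} id t D0 D1 (cdom C p') c"
      using a f g arr_obj unfolding is_graph_cone_def D0_def D1_def t_def c_def
      by (auto simp: in_hom_iff)
    then have ex1: "\<exists>!u. u \<in> hom C (cdom C p') P \<and> (\<forall>j\<in>{0,1,2}. p j \<cdot> u = c j)"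
      using lim unfolding is_graph_limit_def by blast
    have eq: "(\<forall>j\<in>{0,1,2}. p j \<cdot> u = c j) \<longleftrightarrow> p 0 \<cdot> u = p' \<and> p 1 \<cdot> u = q'"
      if u: "u \<in> hom C (cdom C p') P" for u
    proof -
      have "p 2 \<cdot> u = f \<cdot> (p 0 \<cdot> u)" using u h f by (simp add: in_hom_iff flip: h(3))
      then show ?thesis by (auto simp: c_def)
    qed
    have "cdom C (p 0) = P" using h by (simp add: in_hom_iff)
    then show "\<exists>!u. u \<in> hom C (cdom C p') (cdom C (p 0)) \<and> p 0 \<cdot> u = p' \<and> p 1 \<cdot> u = q'"
      using ex1 eq by metis
  qed (use f g h in \<open>auto simp: in_hom_iff\<close>)
  then show thesis using that h by blast
qed

lemma pullback_lift:
  assumes "is_pullback C f g p q" "p \<in> hom C P x" "q \<in> hom C P y"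
    and "f \<in> hom C x z" "g \<in> hom C y z"
    and "a \<in> hom C w x" "b \<in> hom C w y" "f \<cdot> a = g \<cdot> b"
  obtains u where "u \<in> hom C w P" "p \<cdot> u = a" "q \<cdot> u = b"
  using assms unfolding is_pullback_def in_hom_iff by metis

lemma pullback_cancel:
  assumes "is_pullback C f g p q" "p \<in> hom C P x" "q \<in> hom C P y"
    and "u \<in> hom C w P" "v \<in> hom C w P" "p \<cdot> u = p \<cdot> v" "q \<cdot> u = q \<cdot> v"
  shows "u = v"
proof -
  have "f \<cdot> (p \<cdot> v) = g \<cdot> (q \<cdot> v)"
  proof -
    have h: "f \<in> arr C" "g \<in> arr C" "ccod C p = cdom C f" "ccod C q = cdom C g" "f \<cdot> p = g \<cdot> q"
      using assms(1) unfolding is_pullback_def by auto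
    have "f \<cdot> (p \<cdot> v) = (f \<cdot> p) \<cdot> v" "g \<cdot> (q \<cdot> v) = (g \<cdot> q) \<cdot> v"
      using assms(2-5) h(1-4) by (simp_all add: in_hom_iff)
    then show ?thesis using h(5) by simp
  qed
  then have "\<exists>!c. c \<in> hom C (cdom C (p \<cdot> v)) (cdom C p) \<and> p \<cdot> c = p \<cdot> v \<and> q \<cdot> c = q \<cdot> v"
    using assms unfolding is_pullback_def in_hom_iff by (metis comp_arr)
  then show ?thesis using assms unfolding in_hom_iff by (metis comp_arr(2))
qed

lemma pullback_commutes: "is_pullback C f g p q \<Longrightarrow> f \<cdot> p = g \<cdot> q"
  by (simp add: is_pullback_def)

lemma terminal_exists:
  obtains t bang where "t \<in> obj C" "\<And>x. x \<in> obj C \<Longrightarrow> bang x \<in> hom C x t"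
    "\<And>x u v. u \<in> hom C x t \<Longrightarrow> v \<in> hom C x t \<Longrightarrow> u = v"
proof -
  have "is_diagram C {} {} id id undefined undefined" by (simp add: is_diagram_def)
  then obtain t p where "is_graph_limit C {} {} id id undefined undefined t p"
    using finite_limits unfolding has_finite_limits_def by blast
  then have t: "t \<in> obj C" "\<And>x. x \<in> obj C \<Longrightarrow> \<exists>!u. u \<in> hom C x t"
    unfolding is_graph_limit_def is_graph_cone_def by auto
  have "(THE u. u \<in> hom C x t) \<in> hom C x t" if "x \<in> obj C" for x
    using t(2)[OF that] by (rule theI')
  then show thesis using that[of t "\<lambda>x. THE u. u \<in> hom C x t"] t hom_obj by blast
qed

end

lemma descent_category_finite_limits:
  assumes "descent_category C Cov"
  shows "finite_limit_category C"
  using descent_categoryD(1,2)[OF assms] by unfold_locales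

section \<open>Cones over subcomplexes of a thick simplex\<close>

lemma all_mapsD: "\<theta> \<in> all_maps m n \<Longrightarrow> length \<theta> = Suc m" "\<theta> \<in> all_maps m n \<Longrightarrow> i \<in> set \<theta> \<Longrightarrow> i < Suc n"
  by (auto simp: all_maps_def)

lemma mono_all: "\<theta> \<in> mono_maps m n \<Longrightarrow> \<theta> \<in> all_maps m n"
  by (simp add: mono_maps_def)

lemma mono_mapsD:
  assumes "\<theta> \<in> mono_maps m n"
  shows "length \<theta> = Suc m" "i \<in> set \<theta> \<Longrightarrow> i < Suc n" "sorted \<theta>"
  using assms by (auto simp: mono_maps_def all_maps_def)

lemma length_ocomp [simp]: "length (ocomp \<theta> \<phi>) = length \<phi>"
  by (simp add: ocomp_def)

lemma nth_ocomp [simp]: "i < length \<phi> \<Longrightarrow> ocomp \<theta> \<phi> ! i = \<theta> ! (\<phi> ! i)"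
  by (simp add: ocomp_def)

lemma set_ocomp: "set (ocomp \<theta> \<phi>) = (!) \<theta> ` set \<phi>"
  by (simp add: ocomp_def)

lemma set_ocomp_subset:
  "length \<sigma> = Suc m \<Longrightarrow> \<theta> \<in> all_maps l m \<Longrightarrow> set (ocomp \<sigma> \<theta>) \<subseteq> set \<sigma>"
  using all_mapsD by (fastforce simp: set_ocomp)

lemma ocomp_assoc:
  assumes "\<theta> \<in> all_maps m n" "\<phi> \<in> all_maps l m"
  shows "ocomp (ocomp \<sigma> \<theta>) \<phi> = ocomp \<sigma> (ocomp \<theta> \<phi>)"
  using all_mapsD[OF assms(1)] all_mapsD[OF assms(2)]
  by (auto intro!: nth_equalityI simp: ocomp_def)

lemma ocomp_all: "\<theta> \<in> all_maps m n \<Longrightarrow> \<phi> \<in> all_maps l m \<Longrightarrow> ocomp \<theta> \<phi> \<in> all_maps l n"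
  using set_ocomp_subset[of \<theta> m \<phi> l] by (fastforce simp: all_maps_def)

lemma ocomp_mono:
  assumes "\<theta> \<in> mono_maps m n" "\<phi> \<in> mono_maps l m"
  shows "ocomp \<theta> \<phi> \<in> mono_maps l n"
proof -
  have "sorted (ocomp \<theta> \<phi>)"
    using mono_mapsD[OF assms(1)] mono_mapsD[OF assms(2)]
    by (auto simp: sorted_iff_nth_mono)
  then show ?thesis using assms ocomp_all by (auto simp: mono_maps_def)
qed

lemma id_mono: "[0..<Suc m] \<in> mono_maps m m"
  by (auto simp: mono_maps_def all_maps_def simp del: upt_Suc)

lemma ocomp_id: "length \<sigma> = Suc m \<Longrightarrow> ocomp \<sigma> [0..<Suc m] = \<sigma>"
  using map_nth[of \<sigma>] by (simp add: ocomp_def del: upt_Suc)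

lemma id_ocomp: "\<theta> \<in> all_maps l m \<Longrightarrow> ocomp [0..<Suc m] \<theta> = \<theta>"
  using all_mapsD[of \<theta> l m] by (auto intro!: nth_equalityI simp del: upt_Suc)

text \<open>No vertex set is fixed: the letters are arbitrary natural numbers, so these are the
  subcomplexes of the thick simplex on all of them. Operators act on positions, by
  \<open>ocomp\<close> from the right.\<close>

definition subcomplex :: "(nat \<Rightarrow> nat list set) \<Rightarrow> bool" where
  "subcomplex S \<longleftrightarrow> (\<forall>m. \<forall>\<sigma>\<in>S m. length \<sigma> = Suc m \<and> (\<forall>l. \<forall>\<theta>\<in>mono_maps l m. ocomp \<sigma> \<theta> \<in> S l))"

lemma subcomplexD:
  assumes "subcomplex S" "\<sigma> \<in> S m"
  shows "length \<sigma> = Suc m" "\<theta> \<in> mono_maps l m \<Longrightarrow> ocomp \<sigma> \<theta> \<in> S l"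
  using assms by (auto simp: subcomplex_def)

text \<open>Cones are total functions with arbitrary values off the complex, so they can be compared
  only on it.\<close>

definition cone_agree :: "(nat \<Rightarrow> nat list set) \<Rightarrow> (nat \<Rightarrow> nat list \<Rightarrow> 'a) \<Rightarrow> (nat \<Rightarrow> nat list \<Rightarrow> 'a) \<Rightarrow> bool" where
  "cone_agree S p q \<longleftrightarrow> (\<forall>m. \<forall>\<sigma>\<in>S m. p m \<sigma> = q m \<sigma>)"

lemma cone_agreeD: "cone_agree S p q \<Longrightarrow> \<sigma> \<in> S m \<Longrightarrow> p m \<sigma> = q m \<sigma>"
  by (simp add: cone_agree_def)

lemma ss_coneD:
  assumes "ss_cone C Xo Xa T L p"
  shows "L \<in> obj C" "\<sigma> \<in> T m \<Longrightarrow> p m \<sigma> \<in> hom C L (Xo m)"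
    "\<sigma> \<in> T m \<Longrightarrow> \<theta> \<in> mono_maps l m \<Longrightarrow> cmp C (Xa m l \<theta>) (p m \<sigma>) = p l (ocomp \<sigma> \<theta>)"
  using assms unfolding ss_cone_def by blast+

lemma ss_cone_subset: "ss_cone C Xo Xa T L p \<Longrightarrow> (\<And>m. S m \<subseteq> T m) \<Longrightarrow> ss_cone C Xo Xa S L p"
  unfolding ss_cone_def by blast

lemma ss_cone_cong:
  assumes "subcomplex T" "cone_agree T p q"
  shows "ss_cone C Xo Xa T L p \<longleftrightarrow> ss_cone C Xo Xa T L q"
proof -
  have "ss_cone C Xo Xa T L q" if p: "ss_cone C Xo Xa T L p" and pq: "cone_agree T p q" for p q
    unfolding ss_cone_def
    using ss_coneD[OF p] cone_agreeD[OF pq] subcomplexD(2)[OF assms(1)] by simp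
  moreover have "cone_agree T q p" using assms(2) by (simp add: cone_agree_def)
  ultimately show ?thesis using assms(2) by blast
qed

lemma (in small_category) ss_cone_precomp:
  assumes "simplicial_obj C Xo Xa" "ss_cone C Xo Xa T L p" "u \<in> hom C L' L"
  shows "ss_cone C Xo Xa T L' (\<lambda>m \<sigma>. p m \<sigma> \<cdot> u)"
  unfolding ss_cone_def
proof (intro conjI allI ballI impI)
  show "L' \<in> obj C" using assms(3) hom_obj by blast
  show "p m \<sigma> \<cdot> u \<in> hom C L' (Xo m)" if "\<sigma> \<in> T m" for m \<sigma>
    using comp_hom[OF assms(3) ss_coneD(2)[OF assms(2) that]] .
  show "Xa m l \<theta> \<cdot> p m \<sigma> \<cdot> u = p l (ocomp \<sigma> \<theta>) \<cdot> u"
    if "\<sigma> \<in> T m" "\<theta> \<in> mono_maps l m" for m l \<sigma> \<theta>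
  proof -
    have "Xa m l \<theta> \<in> hom C (Xo m) (Xo l)" using assms(1) that by (simp add: simplicial_obj_def)
    from comp_assoc_hom[OF assms(3) ss_coneD(2)[OF assms(2) that(1)] this]
    show ?thesis using ss_coneD(3)[OF assms(2) that] by simp
  qed
qed

lemma rel_coneD:
  assumes "rel_cone C Xo Xa Yo Ya f S T L p q"
  shows "ss_cone C Xo Xa S L p" "ss_cone C Yo Ya T L q"
    "\<sigma> \<in> S m \<Longrightarrow> cmp C (f m) (p m \<sigma>) = q m \<sigma>"
  using assms unfolding rel_cone_def by auto

lemma rel_cone_cong:
  assumes "subcomplex S" "subcomplex T" "\<And>m. S m \<subseteq> T m" "cone_agree S p p'" "cone_agree T q q'"
  shows "rel_cone C Xo Xa Yo Ya f S T L p q \<longleftrightarrow> rel_cone C Xo Xa Yo Ya f S T L p' q'"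
proof -
  have "(\<forall>m. \<forall>\<sigma>\<in>S m. cmp C (f m) (p m \<sigma>) = q m \<sigma>) \<longleftrightarrow> (\<forall>m. \<forall>\<sigma>\<in>S m. cmp C (f m) (p' m \<sigma>) = q' m \<sigma>)"
    using assms(3) cone_agreeD[OF assms(4)] cone_agreeD[OF assms(5)] by (simp add: subset_iff)
  then show ?thesis
    unfolding rel_cone_def ss_cone_cong[OF assms(1,4)] ss_cone_cong[OF assms(2,5)] by simp
qed

locale simplicial_object = finite_limit_category C
  for C :: "('o,'a) cat" and Xo :: "nat \<Rightarrow> 'o" and Xa :: "nat \<Rightarrow> nat \<Rightarrow> nat list \<Rightarrow> 'a" +
  assumes simplicial: "simplicial_obj C Xo Xa"
begin

lemma Xo_obj: "Xo n \<in> obj C"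
  using simplicial by (simp add: simplicial_obj_def)

lemma Xa_hom: "\<theta> \<in> mono_maps m n \<Longrightarrow> Xa n m \<theta> \<in> hom C (Xo n) (Xo m)"
  using simplicial by (simp add: simplicial_obj_def)

lemma Xa_idt: "Xa n n [0..<Suc n] = idt C (Xo n)"
  using simplicial unfolding simplicial_obj_def by blast

lemma Xa_comp:
  "\<theta> \<in> mono_maps m n \<Longrightarrow> \<phi> \<in> mono_maps l m \<Longrightarrow> Xa m l \<phi> \<cdot> Xa n m \<theta> = Xa n l (ocomp \<theta> \<phi>)"
  using simplicial unfolding simplicial_obj_def by metis

lemma is_MapI:
  assumes "ss_cone C Xo Xa T L p"
    and "\<And>L' p'. ss_cone C Xo Xa T L' p' \<Longrightarrow> \<exists>u. u \<in> hom C L' L \<and> cone_agree T (\<lambda>m \<sigma>. p m \<sigma> \<cdot> u) p'"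
    and "\<And>L' u v. u \<in> hom C L' L \<Longrightarrow> v \<in> hom C L' L \<Longrightarrow>
      cone_agree T (\<lambda>m \<sigma>. p m \<sigma> \<cdot> u) (\<lambda>m \<sigma>. p m \<sigma> \<cdot> v) \<Longrightarrow> u = v"
  shows "is_Map C Xo Xa T L p"
  unfolding is_Map_def
proof (intro conjI allI impI)
  fix L' p' assume "ss_cone C Xo Xa T L' p'"
  then show "\<exists>!u. u \<in> hom C L' L \<and> (\<forall>m. \<forall>\<sigma>\<in>T m. p m \<sigma> \<cdot> u = p' m \<sigma>)"
    using assms(2)[of L' p'] assms(3) unfolding cone_agree_def by metis
qed (fact assms(1))

lemma Map_cone: "is_Map C Xo Xa T L p \<Longrightarrow> ss_cone C Xo Xa T L p"
  by (simp add: is_Map_def)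

lemma Map_lift:
  assumes "is_Map C Xo Xa T L p" "ss_cone C Xo Xa T L' p'"
  obtains u where "u \<in> hom C L' L" "\<And>m \<sigma>. \<sigma> \<in> T m \<Longrightarrow> p m \<sigma> \<cdot> u = p' m \<sigma>"
  using assms unfolding is_Map_def by blast

lemma Map_eqI:
  assumes "is_Map C Xo Xa T L p" "u \<in> hom C L' L" "v \<in> hom C L' L"
    and "\<And>m \<sigma>. \<sigma> \<in> T m \<Longrightarrow> p m \<sigma> \<cdot> u = p m \<sigma> \<cdot> v"
  shows "u = v"
proof -
  have "ss_cone C Xo Xa T L' (\<lambda>m \<sigma>. p m \<sigma> \<cdot> v)"
    by (rule ss_cone_precomp[OF simplicial Map_cone[OF assms(1)] assms(3)])
  then have "\<exists>!w. w \<in> hom C L' L \<and> (\<forall>m. \<forall>\<sigma>\<in>T m. p m \<sigma> \<cdot> w = p m \<sigma> \<cdot> v)"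
    using assms(1) unfolding is_Map_def by blast
  then show ?thesis using assms(2-4) by blast
qed

lemma Map_transport:
  assumes M: "is_Map C Xo Xa T L p" and v: "v \<in> hom C L' L" "is_iso C v"
    and sub: "subcomplex T" and p': "\<And>m \<sigma>. \<sigma> \<in> T m \<Longrightarrow> p m \<sigma> \<cdot> v = p' m \<sigma>"
  shows "is_Map C Xo Xa T L' p'"
proof -
  obtain w where w: "w \<in> hom C L L'" "w \<cdot> v = idt C L'" "v \<cdot> w = idt C L"
    using is_iso_obtain[OF v(2,1)] by metis
  have p'u: "p' m \<sigma> \<cdot> u = p m \<sigma> \<cdot> (v \<cdot> u)" if "\<sigma> \<in> T m" "u \<in> hom C L'' L'" for m \<sigma> u L''
    using comp_assoc_hom[OF that(2) v(1) ss_coneD(2)[OF Map_cone[OF M] that(1)]] p'[OF that(1)] by simp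
  show ?thesis
  proof (rule is_MapI)
    have "cone_agree T (\<lambda>m \<sigma>. p m \<sigma> \<cdot> v) p'" using p' by (simp add: cone_agree_def)
    from ss_cone_cong[OF sub this] show "ss_cone C Xo Xa T L' p'"
      using ss_cone_precomp[OF simplicial Map_cone[OF M] v(1)] by (rule iffD1)
  next
    fix L'' p'' assume "ss_cone C Xo Xa T L'' p''"
    from Map_lift[OF M this] obtain u where u: "u \<in> hom C L'' L" "\<And>m \<sigma>. \<sigma> \<in> T m \<Longrightarrow> p m \<sigma> \<cdot> u = p'' m \<sigma>"
      by blast
    have "w \<cdot> u \<in> hom C L'' L'" using comp_hom[OF u(1) w(1)] .
    moreover have "v \<cdot> (w \<cdot> u) = u" by (rule comp_cancel[OF w(3,1) v(1) u(1)])
    ultimately have "cone_agree T (\<lambda>m \<sigma>. p' m \<sigma> \<cdot> (w \<cdot> u)) p''"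
      using u(2) p'u by (simp add: cone_agree_def)
    then show "\<exists>u. u \<in> hom C L'' L' \<and> cone_agree T (\<lambda>m \<sigma>. p' m \<sigma> \<cdot> u) p''"
      using \<open>w \<cdot> u \<in> hom C L'' L'\<close> by blast
  next
    fix L'' u u' assume u: "u \<in> hom C L'' L'" "u' \<in> hom C L'' L'"
      and "cone_agree T (\<lambda>m \<sigma>. p' m \<sigma> \<cdot> u) (\<lambda>m \<sigma>. p' m \<sigma> \<cdot> u')"
    then have "v \<cdot> u = v \<cdot> u'"
      using p'u by (intro Map_eqI[OF M comp_hom[OF u(1) v(1)] comp_hom[OF u(2) v(1)]]) (simp add: cone_agree_def)
    then show "u = u'" using comp_cancel[OF w(2) v(1) w(1)] u by metis
  qed
qed

end

section \<open>Relative mapping objects of a simplicial map\<close>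

locale simplicial_morphism = X: simplicial_object C Xo Xa + Y: simplicial_object C Yo Ya
  for C :: "('o,'a) cat" and Xo Xa Yo Ya +
  fixes f :: "nat \<Rightarrow> 'a"
  assumes f_hom: "f n \<in> hom C (Xo n) (Yo n)"
    and f_natural: "\<theta> \<in> mono_maps m n \<Longrightarrow> cmp C (Ya n m \<theta>) (f n) = cmp C (f m) (Xa n m \<theta>)"
begin

abbreviation rcone where "rcone \<equiv> rel_cone C Xo Xa Yo Ya f"
abbreviation rmap where "rmap \<equiv> is_relMap C Xo Xa Yo Ya f"

lemma simplicial_map: "simplicial_map C Xo Xa Yo Ya f"
  unfolding simplicial_map_def using X.simplicial Y.simplicial f_hom f_natural by blast

lemma rcone_precomp:
  assumes "rcone S T L p q" "u \<in> hom C L' L"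
  shows "rcone S T L' (\<lambda>m \<sigma>. p m \<sigma> \<cdot> u) (\<lambda>m \<sigma>. q m \<sigma> \<cdot> u)"
  unfolding rel_cone_def
proof (intro conjI allI ballI)
  show "f m \<cdot> p m \<sigma> \<cdot> u = q m \<sigma> \<cdot> u" if "\<sigma> \<in> S m" for m \<sigma>
    using X.comp_assoc_hom[OF assms(2) ss_coneD(2)[OF rel_coneD(1)[OF assms(1)] that] f_hom]
      rel_coneD(3)[OF assms(1) that] by simp
qed (rule X.ss_cone_precomp[OF X.simplicial rel_coneD(1)[OF assms(1)] assms(2)]
    X.ss_cone_precomp[OF Y.simplicial rel_coneD(2)[OF assms(1)] assms(2)])+

lemma rmap_cone: "rmap S T L p q \<Longrightarrow> rcone S T L p q"
  by (simp add: is_relMap_def)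

lemma rmap_hom:
  assumes "rmap S T L p q"
  shows "\<sigma> \<in> S m \<Longrightarrow> p m \<sigma> \<in> hom C L (Xo m)" "\<sigma> \<in> T m \<Longrightarrow> q m \<sigma> \<in> hom C L (Yo m)"
  using assms unfolding is_relMap_def rel_cone_def ss_cone_def by blast+

lemma rmap_lift:
  assumes "rmap S T L p q" "rcone S T L' p' q'"
  obtains u where "u \<in> hom C L' L" "\<And>m \<sigma>. \<sigma> \<in> S m \<Longrightarrow> p m \<sigma> \<cdot> u = p' m \<sigma>"
    "\<And>m \<sigma>. \<sigma> \<in> T m \<Longrightarrow> q m \<sigma> \<cdot> u = q' m \<sigma>"
  using assms unfolding is_relMap_def by blast

lemma rmap_eqI:
  assumes "rmap S T L p q" "u \<in> hom C L' L" "v \<in> hom C L' L"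
    and "\<And>m \<sigma>. \<sigma> \<in> S m \<Longrightarrow> p m \<sigma> \<cdot> u = p m \<sigma> \<cdot> v"
    and "\<And>m \<sigma>. \<sigma> \<in> T m \<Longrightarrow> q m \<sigma> \<cdot> u = q m \<sigma> \<cdot> v"
  shows "u = v"
proof -
  have "rcone S T L' (\<lambda>m \<sigma>. p m \<sigma> \<cdot> v) (\<lambda>m \<sigma>. q m \<sigma> \<cdot> v)"
    by (rule rcone_precomp[OF rmap_cone[OF assms(1)] assms(3)])
  then have "\<exists>!w. w \<in> hom C L' L \<and> (\<forall>m. \<forall>\<sigma>\<in>S m. p m \<sigma> \<cdot> w = p m \<sigma> \<cdot> v) \<and> (\<forall>m. \<forall>\<sigma>\<in>T m. q m \<sigma> \<cdot> w = q m \<sigma> \<cdot> v)"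
    using assms(1) unfolding is_relMap_def by blast
  then show ?thesis using assms(2-5) by blast
qed

lemma rmapI:
  assumes "rcone S T L p q"
    and "\<And>L' p' q'. rcone S T L' p' q' \<Longrightarrow> \<exists>u. u \<in> hom C L' L \<and>
      (\<forall>m. \<forall>\<sigma>\<in>S m. p m \<sigma> \<cdot> u = p' m \<sigma>) \<and> (\<forall>m. \<forall>\<sigma>\<in>T m. q m \<sigma> \<cdot> u = q' m \<sigma>)"
    and "\<And>L' u v. u \<in> hom C L' L \<Longrightarrow> v \<in> hom C L' L \<Longrightarrow>
      (\<forall>m. \<forall>\<sigma>\<in>S m. p m \<sigma> \<cdot> u = p m \<sigma> \<cdot> v) \<Longrightarrow> (\<forall>m. \<forall>\<sigma>\<in>T m. q m \<sigma> \<cdot> u = q m \<sigma> \<cdot> v) \<Longrightarrow> u = v"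
  shows "rmap S T L p q"
  unfolding is_relMap_def
proof (intro conjI allI impI)
  fix L' p' q' assume "rcone S T L' p' q'"
  from assms(2)[OF this] obtain u where u: "u \<in> hom C L' L"
    "\<forall>m. \<forall>\<sigma>\<in>S m. p m \<sigma> \<cdot> u = p' m \<sigma>" "\<forall>m. \<forall>\<sigma>\<in>T m. q m \<sigma> \<cdot> u = q' m \<sigma>" by blast
  show "\<exists>!u. u \<in> hom C L' L \<and> (\<forall>m. \<forall>\<sigma>\<in>S m. p m \<sigma> \<cdot> u = p' m \<sigma>) \<and> (\<forall>m. \<forall>\<tau>\<in>T m. q m \<tau> \<cdot> u = q' m \<tau>)"
  proof (rule ex1I[of _ u])
    fix v assume "v \<in> hom C L' L \<and> (\<forall>m. \<forall>\<sigma>\<in>S m. p m \<sigma> \<cdot> v = p' m \<sigma>) \<and> (\<forall>m. \<forall>\<tau>\<in>T m. q m \<tau> \<cdot> v = q' m \<tau>)"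
    then show "v = u" using u by (intro assms(3)[of v L' u]) simp_all
  qed (use u in blast)
qed (fact assms(1))

lemma rmap_transport:
  assumes M: "rmap S T L p q" and v: "v \<in> hom C L' L" "is_iso C v"
    and sub: "subcomplex S" "subcomplex T" "\<And>m. S m \<subseteq> T m"
    and p': "\<And>m \<sigma>. \<sigma> \<in> S m \<Longrightarrow> p m \<sigma> \<cdot> v = p' m \<sigma>"
    and q': "\<And>m \<sigma>. \<sigma> \<in> T m \<Longrightarrow> q m \<sigma> \<cdot> v = q' m \<sigma>"
  shows "rmap S T L' p' q'"
proof -
  obtain w where w: "w \<in> hom C L L'" "w \<cdot> v = idt C L'" "v \<cdot> w = idt C L"
    using X.is_iso_obtain[OF v(2,1)] by metis
  have p'u: "p' m \<sigma> \<cdot> u = p m \<sigma> \<cdot> (v \<cdot> u)" if "\<sigma> \<in> S m" "u \<in> hom C L'' L'" for m \<sigma> u L''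
    using X.comp_assoc_hom[OF that(2) v(1) rmap_hom(1)[OF M that(1)]] p'[OF that(1)] by simp
  have q'u: "q' m \<sigma> \<cdot> u = q m \<sigma> \<cdot> (v \<cdot> u)" if "\<sigma> \<in> T m" "u \<in> hom C L'' L'" for m \<sigma> u L''
    using X.comp_assoc_hom[OF that(2) v(1) rmap_hom(2)[OF M that(1)]] q'[OF that(1)] by simp
  show ?thesis
  proof (rule rmapI)
    have "cone_agree S (\<lambda>m \<sigma>. p m \<sigma> \<cdot> v) p'" "cone_agree T (\<lambda>m \<sigma>. q m \<sigma> \<cdot> v) q'"
      using p' q' by (simp_all add: cone_agree_def)
    from rel_cone_cong[OF sub this]
    show "rcone S T L' p' q'"
      using rcone_precomp[OF rmap_cone[OF M] v(1)] by (rule iffD1)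
  next
    fix L'' p'' q'' assume "rcone S T L'' p'' q''"
    from rmap_lift[OF M this] obtain u where u: "u \<in> hom C L'' L"
      "\<And>m \<sigma>. \<sigma> \<in> S m \<Longrightarrow> p m \<sigma> \<cdot> u = p'' m \<sigma>" "\<And>m \<sigma>. \<sigma> \<in> T m \<Longrightarrow> q m \<sigma> \<cdot> u = q'' m \<sigma>"
      by blast
    have wu: "w \<cdot> u \<in> hom C L'' L'" using X.comp_hom[OF u(1) w(1)] .
    have "v \<cdot> (w \<cdot> u) = u" by (rule X.comp_cancel[OF w(3,1) v(1) u(1)])
    then show "\<exists>u. u \<in> hom C L'' L' \<and> (\<forall>m. \<forall>\<sigma>\<in>S m. p' m \<sigma> \<cdot> u = p'' m \<sigma>) \<and> (\<forall>m. \<forall>\<sigma>\<in>T m. q' m \<sigma> \<cdot> u = q'' m \<sigma>)"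
      using wu u p'u[OF _ wu] q'u[OF _ wu] by (intro exI[of _ "w \<cdot> u"]) simp
  next
    fix L'' u u' assume u: "u \<in> hom C L'' L'" "u' \<in> hom C L'' L'"
      and "\<forall>m. \<forall>\<sigma>\<in>S m. p' m \<sigma> \<cdot> u = p' m \<sigma> \<cdot> u'" "\<forall>m. \<forall>\<sigma>\<in>T m. q' m \<sigma> \<cdot> u = q' m \<sigma> \<cdot> u'"
    then have "v \<cdot> u = v \<cdot> u'"
      using p'u[OF _ u(1)] p'u[OF _ u(2)] q'u[OF _ u(1)] q'u[OF _ u(2)]
      by (intro rmap_eqI[OF M X.comp_hom[OF u(1) v(1)] X.comp_hom[OF u(2) v(1)]]) simp_all
    then show "u = u'" using X.comp_cancel[OF w(2) v(1) w(1)] u by metis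
  qed
qed

lemma rmap_unique:
  assumes M: "rmap S T L p q" and M': "rmap S T L' p' q'"
  obtains v where "v \<in> hom C L' L" "is_iso C v"
    "\<And>m \<sigma>. \<sigma> \<in> S m \<Longrightarrow> p m \<sigma> \<cdot> v = p' m \<sigma>" "\<And>m \<sigma>. \<sigma> \<in> T m \<Longrightarrow> q m \<sigma> \<cdot> v = q' m \<sigma>"
proof -
  obtain v where v: "v \<in> hom C L' L" "\<And>m \<sigma>. \<sigma> \<in> S m \<Longrightarrow> p m \<sigma> \<cdot> v = p' m \<sigma>" "\<And>m \<sigma>. \<sigma> \<in> T m \<Longrightarrow> q m \<sigma> \<cdot> v = q' m \<sigma>"
    using rmap_lift[OF M rmap_cone[OF M']] by blast
  obtain w where w: "w \<in> hom C L L'" "\<And>m \<sigma>. \<sigma> \<in> S m \<Longrightarrow> p' m \<sigma> \<cdot> w = p m \<sigma>" "\<And>m \<sigma>. \<sigma> \<in> T m \<Longrightarrow> q' m \<sigma> \<cdot> w = q m \<sigma>"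
    using rmap_lift[OF M' rmap_cone[OF M]] by blast
  have ob: "L \<in> obj C" "L' \<in> obj C" using v(1) X.hom_obj by blast+
  have "v \<cdot> w = idt C L"
  proof (rule rmap_eqI[OF M X.comp_hom[OF w(1) v(1)] X.idt_hom[OF ob(1)]])
    show "p m \<sigma> \<cdot> v \<cdot> w = p m \<sigma> \<cdot> idt C L" if "\<sigma> \<in> S m" for m \<sigma>
      using X.comp_assoc_hom[OF w(1) v(1) rmap_hom(1)[OF M that]] v(2)[OF that] w(2)[OF that]
        rmap_hom(1)[OF M that] by (simp add: hom_arr hom_dom)
    show "q m \<sigma> \<cdot> v \<cdot> w = q m \<sigma> \<cdot> idt C L" if "\<sigma> \<in> T m" for m \<sigma>
      using X.comp_assoc_hom[OF w(1) v(1) rmap_hom(2)[OF M that]] v(3)[OF that] w(3)[OF that]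
        rmap_hom(2)[OF M that] by (simp add: hom_arr hom_dom)
  qed
  moreover have "w \<cdot> v = idt C L'"
  proof (rule rmap_eqI[OF M' X.comp_hom[OF v(1) w(1)] X.idt_hom[OF ob(2)]])
    show "p' m \<sigma> \<cdot> w \<cdot> v = p' m \<sigma> \<cdot> idt C L'" if "\<sigma> \<in> S m" for m \<sigma>
      using X.comp_assoc_hom[OF v(1) w(1) rmap_hom(1)[OF M' that]] v(2)[OF that] w(2)[OF that]
        rmap_hom(1)[OF M' that] by (simp add: hom_arr hom_dom)
    show "q' m \<sigma> \<cdot> w \<cdot> v = q' m \<sigma> \<cdot> idt C L'" if "\<sigma> \<in> T m" for m \<sigma>
      using X.comp_assoc_hom[OF v(1) w(1) rmap_hom(2)[OF M' that]] v(3)[OF that] w(3)[OF that]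
        rmap_hom(2)[OF M' that] by (simp add: hom_arr hom_dom)
  qed
  ultimately have "is_iso C v" using v(1) w(1) by (intro X.is_isoI)
  with v that show thesis by blast
qed

end

section \<open>Attaching simplices\<close>

text \<open>The image of the map from the standard simplex that classifies \<open>\<sigma>\<close>;
  the first argument is the dimension of \<open>\<sigma>\<close>.\<close>

definition generated :: "nat \<Rightarrow> nat list \<Rightarrow> nat \<Rightarrow> nat list set" where
  "generated m \<sigma> l = ocomp \<sigma> ` mono_maps l m"

lemma subcomplex_generated: "subcomplex (generated m \<sigma>)"
  unfolding subcomplex_def generated_def
  using mono_mapsD(1) ocomp_mono ocomp_assoc[OF mono_all mono_all] by fastforce

lemma subcomplex_Un: "subcomplex S \<Longrightarrow> subcomplex T \<Longrightarrow> subcomplex (\<lambda>l. S l \<union> T l)"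
  unfolding subcomplex_def by blast

lemma subcomplex_UN: "(\<And>i. i \<in> I \<Longrightarrow> subcomplex (S i)) \<Longrightarrow> subcomplex (\<lambda>l. \<Union>i\<in>I. S i l)"
  unfolding subcomplex_def by simp blast

lemma subcomplex_std: "subcomplex (std_simplex n)"
  unfolding subcomplex_def std_simplex_def using mono_mapsD(1) ocomp_mono by blast

lemma generated_subset: "subcomplex T \<Longrightarrow> \<sigma> \<in> T m \<Longrightarrow> generated m \<sigma> l \<subseteq> T l"
  unfolding generated_def using subcomplexD(2) by blast

text \<open>Composition of a cone with the classifying map of \<open>\<sigma>\<close>. Words in
  \<open>Q\<close> may be non-monotone because the thick simplex is pulled back in the same way when
  cones into G(X) are built.\<close>

lemma ss_cone_pull:
  assumes "ss_cone C Xo Xa S L p" "\<And>l \<theta>. \<theta> \<in> Q l \<Longrightarrow> ocomp \<sigma> \<theta> \<in> S l" "\<And>l. Q l \<subseteq> all_maps l m"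
  shows "ss_cone C Xo Xa Q L (\<lambda>l \<theta>. p l (ocomp \<sigma> \<theta>))"
  unfolding ss_cone_def
proof (intro conjI allI ballI impI)
  show "cmp C (Xa l k \<phi>) (p l (ocomp \<sigma> \<theta>)) = p k (ocomp \<sigma> (ocomp \<theta> \<phi>))"
    if "\<theta> \<in> Q l" "\<phi> \<in> mono_maps k l" for l k \<theta> \<phi>
    using ss_coneD(3)[OF assms(1,2), of \<theta> l \<phi> k] that ocomp_assoc[of \<theta> l m \<phi> k \<sigma>] assms(3)[of l] mono_all
    by (simp add: subset_iff)
qed (use ss_coneD(1,2)[OF assms(1)] assms(2) in blast)+

context simplicial_morphism
begin

text \<open>The restriction of relative mapping objects from \<open>S'\<close> to \<open>S\<close>,
  with \<open>T\<close> and the cone into Y fixed, belongs to \<open>K\<close>. That the object over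
  \<open>S'\<close> exists is part of the assertion, which is how the infinite limits come into
  being.\<close>

definition extends :: "'a set \<Rightarrow> (nat \<Rightarrow> nat list set) \<Rightarrow> (nat \<Rightarrow> nat list set) \<Rightarrow> (nat \<Rightarrow> nat list set) \<Rightarrow> bool" where
  "extends K T S S' \<longleftrightarrow> (\<forall>L p q. rmap S T L p q \<longrightarrow>
     (\<exists>L' p' q' u. rmap S' T L' p' q' \<and> u \<in> K \<and> u \<in> hom C L' L \<and>
        (\<forall>m. \<forall>\<sigma>\<in>S m. p m \<sigma> \<cdot> u = p' m \<sigma>) \<and> (\<forall>m. \<forall>\<tau>\<in>T m. q m \<tau> \<cdot> u = q' m \<tau>)))"

lemma extendsE:
  assumes "extends K T S S'" "rmap S T L p q"
  obtains L' p' q' u where "rmap S' T L' p' q'" "u \<in> K" "u \<in> hom C L' L"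
    "\<And>m \<sigma>. \<sigma> \<in> S m \<Longrightarrow> p m \<sigma> \<cdot> u = p' m \<sigma>" "\<And>m \<tau>. \<tau> \<in> T m \<Longrightarrow> q m \<tau> \<cdot> u = q' m \<tau>"
proof -
  from assms have "\<exists>L' p' q' u. rmap S' T L' p' q' \<and> u \<in> K \<and> u \<in> hom C L' L \<and>
        (\<forall>m. \<forall>\<sigma>\<in>S m. p m \<sigma> \<cdot> u = p' m \<sigma>) \<and> (\<forall>m. \<forall>\<tau>\<in>T m. q m \<tau> \<cdot> u = q' m \<tau>)"
    unfolding extends_def by blast
  then show thesis using that by (elim exE conjE) simp
qed

lemma extends_refl:
  assumes "stable_class C K"
  shows "extends K T S S"
  unfolding extends_def
proof (intro allI impI)
  fix L p q assume M: "rmap S T L p q"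
  have L: "L \<in> obj C" using ss_coneD(1)[OF rel_coneD(1)[OF rmap_cone[OF M]]] .
  have "idt C L \<in> K" using stable_classD(2)[OF assms X.is_iso_idt[OF L]] .
  then show "\<exists>L' p' q' u. rmap S T L' p' q' \<and> u \<in> K \<and> u \<in> hom C L' L \<and>
        (\<forall>m. \<forall>\<sigma>\<in>S m. p m \<sigma> \<cdot> u = p' m \<sigma>) \<and> (\<forall>m. \<forall>\<tau>\<in>T m. q m \<tau> \<cdot> u = q' m \<tau>)"
    using M X.idt_hom[OF L] rmap_hom[OF M]
    by (intro exI[of _ L] exI[of _ p] exI[of _ q] exI[of _ "idt C L"]) (auto simp: in_hom_iff)
qed

lemma extends_trans:
  assumes K: "stable_class C K" and "extends K T S S'" "extends K T S' S''" "\<And>m. S m \<subseteq> S' m"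
  shows "extends K T S S''"
  unfolding extends_def
proof (intro allI impI)
  fix L p q assume M: "rmap S T L p q"
  obtain L' p' q' u where 1: "rmap S' T L' p' q'" "u \<in> K" "u \<in> hom C L' L"
    "\<And>m \<sigma>. \<sigma> \<in> S m \<Longrightarrow> p m \<sigma> \<cdot> u = p' m \<sigma>" "\<And>m \<tau>. \<tau> \<in> T m \<Longrightarrow> q m \<tau> \<cdot> u = q' m \<tau>"
    using extendsE[OF assms(2) M] by metis
  obtain L'' p'' q'' v where 2: "rmap S'' T L'' p'' q''" "v \<in> K" "v \<in> hom C L'' L'"
    "\<And>m \<sigma>. \<sigma> \<in> S' m \<Longrightarrow> p' m \<sigma> \<cdot> v = p'' m \<sigma>" "\<And>m \<tau>. \<tau> \<in> T m \<Longrightarrow> q' m \<tau> \<cdot> v = q'' m \<tau>"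
    using extendsE[OF assms(3) 1(1)] by metis
  have "p m \<sigma> \<cdot> (u \<cdot> v) = p'' m \<sigma>" if "\<sigma> \<in> S m" for m \<sigma>
    using X.comp_assoc_hom[OF 2(3) 1(3) rmap_hom(1)[OF M that]] 1(4)[OF that] 2(4) that assms(4)
    by (metis subsetD)
  moreover have "q m \<tau> \<cdot> (u \<cdot> v) = q'' m \<tau>" if "\<tau> \<in> T m" for m \<tau>
    using X.comp_assoc_hom[OF 2(3) 1(3) rmap_hom(2)[OF M that]] 1(5)[OF that] 2(5)[OF that] by metis
  moreover have "u \<cdot> v \<in> K"
    using stable_classD(3)[OF K 2(2) 1(2)] 1(3) 2(3) by (simp add: hom_dom hom_cod)
  ultimately show "\<exists>L' p' q' u. rmap S'' T L' p' q' \<and> u \<in> K \<and> u \<in> hom C L' L \<and>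
        (\<forall>m. \<forall>\<sigma>\<in>S m. p m \<sigma> \<cdot> u = p' m \<sigma>) \<and> (\<forall>m. \<forall>\<tau>\<in>T m. q m \<tau> \<cdot> u = q' m \<tau>)"
    using 2(1) X.comp_hom[OF 2(3) 1(3)] by blast
qed

text \<open>Restriction to \<open>S\<close> of the maps out of \<open>S \<union> \<langle>\<sigma>\<rangle>\<close> is a pullback of the restriction of \<open>X\<^sub>m\<close>
  along \<open>Q \<hookrightarrow> \<Delta>\<^sup>m\<close>, because the three conditions on \<open>\<sigma>\<close> say that \<open>S \<union> \<langle>\<sigma>\<rangle>\<close> is the pushout
  of \<open>S\<close> and \<open>\<Delta>\<^sup>m\<close> over \<open>Q\<close>.\<close>

lemma extends_attach:
  assumes K: "stable_class C K" and sub: "subcomplex S" "subcomplex T" "\<And>l. S l \<subseteq> T l"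
    and \<sigma>: "\<sigma> \<in> T m" and Q: "\<And>l. Q l \<subseteq> mono_maps l m"
    and cov: "rel_cover C K Xo Xa Yo Ya f Q (std_simplex m) (Xo m) (Xa m)"
    and inS: "\<And>l \<theta>. \<theta> \<in> Q l \<Longrightarrow> ocomp \<sigma> \<theta> \<in> S l"
    and notS: "\<And>l \<theta>. \<theta> \<in> mono_maps l m \<Longrightarrow> \<theta> \<notin> Q l \<Longrightarrow> ocomp \<sigma> \<theta> \<notin> S l"
    and inj: "\<And>l \<theta> \<theta>'. \<theta> \<in> mono_maps l m \<Longrightarrow> \<theta> \<notin> Q l \<Longrightarrow> \<theta>' \<in> mono_maps l m \<Longrightarrow> \<theta>' \<notin> Q l \<Longrightarrow>
        ocomp \<sigma> \<theta> = ocomp \<sigma> \<theta>' \<Longrightarrow> \<theta> = \<theta>'"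
  shows "extends K T S (\<lambda>l. S l \<union> generated m \<sigma> l)"
  unfolding extends_def
proof (intro allI impI)
  let ?S' = "\<lambda>l. S l \<union> generated m \<sigma> l"
  fix L p q assume M: "rmap S T L p q"
  obtain LQ pX pY u where R: "rmap Q (std_simplex m) LQ pX pY" and u: "u \<in> hom C (Xo m) LQ" "u \<in> K"
    and uX: "\<And>l \<theta>. \<theta> \<in> Q l \<Longrightarrow> pX l \<theta> \<cdot> u = Xa m l \<theta>"
    and uY: "\<And>l \<theta>. \<theta> \<in> mono_maps l m \<Longrightarrow> pY l \<theta> \<cdot> u = f l \<cdot> Xa m l \<theta>"
    using cov unfolding rel_cover_def std_simplex_def by blast
  have \<sigma>T: "ocomp \<sigma> \<theta> \<in> T l" if "\<theta> \<in> mono_maps l m" for \<theta> l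
    using subcomplexD(2)[OF sub(2) \<sigma> that] .
  have len\<sigma>: "length \<sigma> = Suc m" using subcomplexD(1)[OF sub(2) \<sigma>] .
  have cones: "ss_cone C Xo Xa S L p" "ss_cone C Yo Ya T L q" "\<And>m \<sigma>. \<sigma> \<in> S m \<Longrightarrow> f m \<cdot> p m \<sigma> = q m \<sigma>"
    using rel_coneD[OF rmap_cone[OF M]] by blast+
  have "rcone Q (std_simplex m) L (\<lambda>l \<theta>. p l (ocomp \<sigma> \<theta>)) (\<lambda>l \<theta>. q l (ocomp \<sigma> \<theta>))"
    unfolding rel_cone_def
    using ss_cone_pull[OF cones(1) inS, of Q m] ss_cone_pull[OF cones(2), of "std_simplex m" \<sigma> m]
      \<sigma>T cones(3) inS Q mono_all by (simp add: std_simplex_def subset_iff)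
  then obtain v where v: "v \<in> hom C L LQ" "\<And>l \<theta>. \<theta> \<in> Q l \<Longrightarrow> pX l \<theta> \<cdot> v = p l (ocomp \<sigma> \<theta>)"
    "\<And>l \<theta>. \<theta> \<in> mono_maps l m \<Longrightarrow> pY l \<theta> \<cdot> v = q l (ocomp \<sigma> \<theta>)"
    using rmap_lift[OF R] unfolding std_simplex_def by blast
  obtain x w P where pb: "is_pullback C u v x w" "x \<in> hom C P (Xo m)" "w \<in> hom C P L"
    using X.pullback_exists[OF u(1) v(1)] by blast
  have wK: "w \<in> K" using stable_classD(4)[OF K pb(1) u(2)] .
  \<comment> \<open>A simplex of the new cell outside \<open>S\<close> comes from a unique
    \<open>\<theta>\<close>, by \<open>inS\<close> and \<open>inj\<close>. On simplices that come
    from \<open>Q\<close> the value is taken from \<open>S\<close>; \<open>p'gen\<close> checks that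
    it agrees with the value obtained from \<open>x\<close>.\<close>
  define p' where "p' l \<tau> = (if \<tau> \<in> S l then p l \<tau> \<cdot> w
    else Xa m l (THE \<theta>. \<theta> \<in> mono_maps l m \<and> \<tau> = ocomp \<sigma> \<theta>) \<cdot> x)" for l \<tau>
  define q' where "q' l \<tau> = q l \<tau> \<cdot> w" for l \<tau>
  have p'S: "p' l \<tau> = p l \<tau> \<cdot> w" if "\<tau> \<in> S l" for l \<tau> using that by (simp add: p'_def)
  have pXh: "pX l \<theta> \<in> hom C LQ (Xo l)" if "\<theta> \<in> Q l" for l \<theta> using rmap_hom(1)[OF R that] .
  have pYh: "pY l \<theta> \<in> hom C LQ (Yo l)" if "\<theta> \<in> mono_maps l m" for l \<theta>
    using rmap_hom(2)[OF R] that by (simp add: std_simplex_def)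
  have p'gen: "p' l (ocomp \<sigma> \<theta>) = Xa m l \<theta> \<cdot> x" if \<theta>: "\<theta> \<in> mono_maps l m" for l \<theta>
  proof (cases "\<theta> \<in> Q l")
    case True
    have "p' l (ocomp \<sigma> \<theta>) = (pX l \<theta> \<cdot> v) \<cdot> w" using p'S inS[OF True] v(2)[OF True] by simp
    also have "\<dots> = pX l \<theta> \<cdot> (u \<cdot> x)"
      using X.comp_assoc_hom[OF pb(3) v(1) pXh[OF True]] X.pullback_commutes[OF pb(1)] by simp
    also have "\<dots> = Xa m l \<theta> \<cdot> x"
      using X.comp_assoc_hom[OF pb(2) u(1) pXh[OF True]] uX[OF True] by simp
    finally show ?thesis .
  next
    case False
    have "\<theta>' = \<theta>" if "\<theta>' \<in> mono_maps l m" "ocomp \<sigma> \<theta> = ocomp \<sigma> \<theta>'" for \<theta>'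
      using inj[OF \<theta> False that(1)] that inS notS[OF \<theta> False] by metis
    then have "(THE \<theta>'. \<theta>' \<in> mono_maps l m \<and> ocomp \<sigma> \<theta> = ocomp \<sigma> \<theta>') = \<theta>"
      using \<theta> by (intro the_equality) blast+
    then show ?thesis using notS[OF \<theta> False] by (simp add: p'_def)
  qed
  have \<sigma>id: "ocomp \<sigma> [0..<Suc m] = \<sigma>" using ocomp_id[OF len\<sigma>] .
  have p'\<sigma>: "p' m \<sigma> = x"
    using p'gen[OF id_mono] pb(2) unfolding \<sigma>id X.Xa_idt by (simp only: in_hom_iff X.idt_comp)
  have S'E: thesis if "\<tau> \<in> ?S' l" "\<tau> \<in> S l \<Longrightarrow> thesis"
      "\<And>\<theta>. \<theta> \<in> mono_maps l m \<Longrightarrow> \<tau> = ocomp \<sigma> \<theta> \<Longrightarrow> thesis" for \<tau> l thesis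
    using that by (auto simp: generated_def)
  have conew: "rcone S T P (\<lambda>m \<sigma>. p m \<sigma> \<cdot> w) (\<lambda>m \<sigma>. q m \<sigma> \<cdot> w)"
    using rcone_precomp[OF rmap_cone[OF M] pb(3)] .
  have p'cone: "ss_cone C Xo Xa ?S' P p'"
    unfolding ss_cone_def
  proof (intro conjI allI ballI impI)
    show "P \<in> obj C" using pb(3) X.hom_obj by blast
    show "p' l \<tau> \<in> hom C P (Xo l)" if "\<tau> \<in> ?S' l" for l \<tau>
      using that
    proof (rule S'E)
      assume "\<tau> \<in> S l"
      then show ?thesis using p'S ss_coneD(2)[OF rel_coneD(1)[OF conew]] by simp
    next
      fix \<theta> assume "\<theta> \<in> mono_maps l m" "\<tau> = ocomp \<sigma> \<theta>"
      then show ?thesis using p'gen X.comp_hom[OF pb(2) X.Xa_hom] by simp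
    qed
    show "Xa l k \<phi> \<cdot> p' l \<tau> = p' k (ocomp \<tau> \<phi>)" if "\<tau> \<in> ?S' l" "\<phi> \<in> mono_maps k l" for l k \<tau> \<phi>
      using that(1)
    proof (rule S'E)
      assume \<tau>: "\<tau> \<in> S l"
      then show ?thesis using p'S ss_coneD(3)[OF rel_coneD(1)[OF conew] \<tau> that(2)]
          subcomplexD(2)[OF sub(1) \<tau> that(2)] by simp
    next
      fix \<theta> assume \<theta>: "\<theta> \<in> mono_maps l m" "\<tau> = ocomp \<sigma> \<theta>"
      have "Xa l k \<phi> \<cdot> Xa m l \<theta> \<cdot> x = Xa m k (ocomp \<theta> \<phi>) \<cdot> x"
        using X.comp_assoc_hom[OF pb(2) X.Xa_hom[OF \<theta>(1)] X.Xa_hom[OF that(2)]]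
          X.Xa_comp[OF \<theta>(1) that(2)] by simp
      then show ?thesis
        using p'gen[OF \<theta>(1)] p'gen[OF ocomp_mono[OF \<theta>(1) that(2)]] \<theta>(2)
          ocomp_assoc[OF mono_all[OF \<theta>(1)] mono_all[OF that(2)]] by simp
    qed
  qed
  have fx: "f l \<cdot> Xa m l \<theta> \<cdot> b = pY l \<theta> \<cdot> u \<cdot> b" if "\<theta> \<in> mono_maps l m" "b \<in> hom C L'' (Xo m)" for l \<theta> b L''
    using X.comp_assoc_hom[OF that(2) u(1) pYh[OF that(1)]] uY[OF that(1)]
      X.comp_assoc_hom[OF that(2) X.Xa_hom[OF that(1)] f_hom] by simp
  have "rmap ?S' T P p' q'"
  proof (rule rmapI)
    have "f l \<cdot> p' l \<tau> = q' l \<tau>" if "\<tau> \<in> ?S' l" for l \<tau>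
      using that
    proof (rule S'E)
      assume \<tau>: "\<tau> \<in> S l"
      then show ?thesis using p'S rel_coneD(3)[OF conew \<tau>] by (simp add: q'_def)
    next
      fix \<theta> assume \<theta>: "\<theta> \<in> mono_maps l m" "\<tau> = ocomp \<sigma> \<theta>"
      have "f l \<cdot> p' l \<tau> = pY l \<theta> \<cdot> v \<cdot> w"
        using fx[OF \<theta>(1) pb(2)] p'gen[OF \<theta>(1)] \<theta>(2) X.pullback_commutes[OF pb(1)] by simp
      also have "\<dots> = q' l \<tau>"
        using X.comp_assoc_hom[OF pb(3) v(1) pYh[OF \<theta>(1)]] v(3)[OF \<theta>(1)] \<theta>(2) by (simp add: q'_def)
      finally show ?thesis .
    qed
    then show "rcone ?S' T P p' q'"
      using p'cone rel_coneD(2)[OF conew] unfolding rel_cone_def q'_def by blast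
  next
    fix L'' p'' q'' assume N: "rcone ?S' T L'' p'' q''"
    have NX: "ss_cone C Xo Xa ?S' L'' p''" using rel_coneD(1)[OF N] .
    have "rcone S T L'' p'' q''"
      using N ss_cone_subset[OF NX, of S] unfolding rel_cone_def by blast
    from rmap_lift[OF M this] obtain a where a: "a \<in> hom C L'' L"
      "\<And>m \<sigma>. \<sigma> \<in> S m \<Longrightarrow> p m \<sigma> \<cdot> a = p'' m \<sigma>" "\<And>m \<sigma>. \<sigma> \<in> T m \<Longrightarrow> q m \<sigma> \<cdot> a = q'' m \<sigma>" by blast
    define b where "b = p'' m \<sigma>"
    have \<sigma>S': "\<sigma> \<in> ?S' m" using id_mono \<sigma>id unfolding generated_def by (metis UnI2 image_eqI)
    have b: "b \<in> hom C L'' (Xo m)" using ss_coneD(2)[OF NX \<sigma>S'] by (simp add: b_def)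
    have b\<theta>: "Xa m l \<theta> \<cdot> b = p'' l (ocomp \<sigma> \<theta>)" if "\<theta> \<in> mono_maps l m" for l \<theta>
      using ss_coneD(3)[OF NX \<sigma>S' that] by (simp add: b_def)
    \<comment> \<open>A cone over the union consists of its restriction \<open>a\<close> to
      \<open>S\<close> and its value \<open>b\<close> at \<open>\<sigma>\<close>. The two match: on
      \<open>Q\<close> both give the values of the cone at faces of \<open>\<sigma>\<close> in
      \<open>S\<close>, and on the Y side both give the values of \<open>q''\<close> on all of
      \<open>\<sigma>\<close>.\<close>
    have "u \<cdot> b = v \<cdot> a"
    proof (rule rmap_eqI[OF R X.comp_hom[OF b u(1)] X.comp_hom[OF a(1) v(1)]])
      fix l \<theta> assume \<theta>: "\<theta> \<in> Q l"
      have "pX l \<theta> \<cdot> u \<cdot> b = p'' l (ocomp \<sigma> \<theta>)"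
        using X.comp_assoc_hom[OF b u(1) pXh[OF \<theta>]] uX[OF \<theta>] b\<theta> \<theta> Q by (metis subsetD)
      also have "\<dots> = pX l \<theta> \<cdot> v \<cdot> a"
        using X.comp_assoc_hom[OF a(1) v(1) pXh[OF \<theta>]] v(2)[OF \<theta>] a(2)[OF inS[OF \<theta>]] by simp
      finally show "pX l \<theta> \<cdot> u \<cdot> b = pX l \<theta> \<cdot> v \<cdot> a" .
    next
      fix l \<theta> assume "\<theta> \<in> std_simplex m l"
      then have \<theta>: "\<theta> \<in> mono_maps l m" by (simp add: std_simplex_def)
      have "pY l \<theta> \<cdot> u \<cdot> b = f l \<cdot> p'' l (ocomp \<sigma> \<theta>)" using fx[OF \<theta> b] b\<theta>[OF \<theta>] by simp
      also have "\<dots> = q'' l (ocomp \<sigma> \<theta>)"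
        using rel_coneD(3)[OF N] \<theta> unfolding generated_def by blast
      also have "\<dots> = pY l \<theta> \<cdot> v \<cdot> a"
        using X.comp_assoc_hom[OF a(1) v(1) pYh[OF \<theta>]] v(3)[OF \<theta>] a(3)[OF \<sigma>T[OF \<theta>]] by simp
      finally show "pY l \<theta> \<cdot> u \<cdot> b = pY l \<theta> \<cdot> v \<cdot> a" .
    qed
    then obtain c where c: "c \<in> hom C L'' P" "x \<cdot> c = b" "w \<cdot> c = a"
      using X.pullback_lift[OF pb u(1) v(1) b a(1)] by blast
    have "p' l \<tau> \<cdot> c = p'' l \<tau>" if "\<tau> \<in> ?S' l" for l \<tau>
      using that
    proof (rule S'E)
      assume \<tau>: "\<tau> \<in> S l"
      then show ?thesis
        using p'S[OF \<tau>] a(2)[OF \<tau>] X.comp_assoc_hom[OF c(1) pb(3) rmap_hom(1)[OF M \<tau>]] c(3) by simp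
    next
      fix \<theta> assume \<theta>: "\<theta> \<in> mono_maps l m" "\<tau> = ocomp \<sigma> \<theta>"
      then show ?thesis
        using p'gen[OF \<theta>(1)] b\<theta>[OF \<theta>(1)] X.comp_assoc_hom[OF c(1) pb(2) X.Xa_hom[OF \<theta>(1)]] c(2) by simp
    qed
    moreover have "q' l \<tau> \<cdot> c = q'' l \<tau>" if "\<tau> \<in> T l" for l \<tau>
      using a(3)[OF that] X.comp_assoc_hom[OF c(1) pb(3) rmap_hom(2)[OF M that]] c(3)
      by (simp add: q'_def)
    ultimately show "\<exists>c. c \<in> hom C L'' P \<and> (\<forall>m. \<forall>\<sigma>'\<in>?S' m. p' m \<sigma>' \<cdot> c = p'' m \<sigma>') \<and>
        (\<forall>m. \<forall>\<sigma>\<in>T m. q' m \<sigma> \<cdot> c = q'' m \<sigma>)"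
      using c(1) by blast
  next
    fix L'' c d assume c: "c \<in> hom C L'' P" and d: "d \<in> hom C L'' P"
      and eq: "\<forall>m. \<forall>\<sigma>'\<in>?S' m. p' m \<sigma>' \<cdot> c = p' m \<sigma>' \<cdot> d" "\<forall>m. \<forall>\<sigma>\<in>T m. q' m \<sigma> \<cdot> c = q' m \<sigma> \<cdot> d"
    have "\<sigma> \<in> ?S' m" using id_mono \<sigma>id unfolding generated_def by (metis UnI2 image_eqI)
    then have "x \<cdot> c = x \<cdot> d" using eq(1) p'\<sigma> by metis
    moreover have "w \<cdot> c = w \<cdot> d"
    proof (rule rmap_eqI[OF M X.comp_hom[OF c pb(3)] X.comp_hom[OF d pb(3)]])
      show "p l \<tau> \<cdot> w \<cdot> c = p l \<tau> \<cdot> w \<cdot> d" if "\<tau> \<in> S l" for l \<tau>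
        using eq(1) that p'S[OF that] X.comp_assoc_hom[OF c pb(3) rmap_hom(1)[OF M that]]
          X.comp_assoc_hom[OF d pb(3) rmap_hom(1)[OF M that]] by (metis UnI1)
      show "q l \<tau> \<cdot> w \<cdot> c = q l \<tau> \<cdot> w \<cdot> d" if "\<tau> \<in> T l" for l \<tau>
        using eq(2) that X.comp_assoc_hom[OF c pb(3) rmap_hom(2)[OF M that]]
          X.comp_assoc_hom[OF d pb(3) rmap_hom(2)[OF M that]] unfolding q'_def by metis
    qed
    ultimately show "c = d" using X.pullback_cancel[OF pb c d] by blast
  qed
  then show "\<exists>L' p' q' u. rmap ?S' T L' p' q' \<and> u \<in> K \<and> u \<in> hom C L' L \<and>
        (\<forall>m. \<forall>\<sigma>\<in>S m. p m \<sigma> \<cdot> u = p' m \<sigma>) \<and> (\<forall>m. \<forall>\<tau>\<in>T m. q m \<tau> \<cdot> u = q' m \<tau>)"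
    using wK pb(3) p'S by (intro exI[of _ P] exI[of _ p'] exI[of _ q'] exI[of _ w]) (simp add: q'_def)
qed

end

abbreviation cell :: "nat list \<Rightarrow> nat \<Rightarrow> nat list set" where
  "cell \<tau> \<equiv> generated (length \<tau> - 1) \<tau>"

context simplicial_object
begin

text \<open>\<open>Map\<close> turns a union, which is a pushout over the intersection, into a
  pullback.\<close>

lemma Map_union:
  assumes sub: "subcomplex S1" "subcomplex S2"
    and M1: "is_Map C Xo Xa S1 L1 p1" and M2: "is_Map C Xo Xa S2 L2 p2"
    and M: "is_Map C Xo Xa (\<lambda>l. S1 l \<inter> S2 l) L p"
  shows "\<exists>P r. is_Map C Xo Xa (\<lambda>l. S1 l \<union> S2 l) P r"
proof -
  have c1: "ss_cone C Xo Xa S1 L1 p1" and c2: "ss_cone C Xo Xa S2 L2 p2"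
    using M1 M2 by (simp_all add: Map_cone)
  obtain a where a: "a \<in> hom C L1 L" "\<And>m \<sigma>. \<sigma> \<in> S1 m \<inter> S2 m \<Longrightarrow> p m \<sigma> \<cdot> a = p1 m \<sigma>"
    using Map_lift[OF M ss_cone_subset[OF c1, of "\<lambda>l. S1 l \<inter> S2 l"]] by blast
  obtain b where b: "b \<in> hom C L2 L" "\<And>m \<sigma>. \<sigma> \<in> S1 m \<inter> S2 m \<Longrightarrow> p m \<sigma> \<cdot> b = p2 m \<sigma>"
    using Map_lift[OF M ss_cone_subset[OF c2, of "\<lambda>l. S1 l \<inter> S2 l"]] by blast
  obtain x y P where pb: "is_pullback C a b x y" "x \<in> hom C P L1" "y \<in> hom C P L2"
    using pullback_exists[OF a(1) b(1)] by blast
  have ph: "p m \<sigma> \<in> hom C L (Xo m)" if "\<sigma> \<in> S1 m \<inter> S2 m" for m \<sigma>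
    using ss_coneD(2)[OF Map_cone[OF M] that] .
  have agree: "p1 m \<sigma> \<cdot> x = p2 m \<sigma> \<cdot> y" if s: "\<sigma> \<in> S1 m \<inter> S2 m" for m \<sigma>
    using comp_assoc_hom[OF pb(2) a(1) ph[OF s]] comp_assoc_hom[OF pb(3) b(1) ph[OF s]]
      a(2)[OF s] b(2)[OF s] pullback_commutes[OF pb(1)] by simp
  define r where "r m \<sigma> = (if \<sigma> \<in> S1 m then p1 m \<sigma> \<cdot> x else p2 m \<sigma> \<cdot> y)" for m \<sigma>
  have r1: "r m \<sigma> = p1 m \<sigma> \<cdot> x" if "\<sigma> \<in> S1 m" for m \<sigma> using that by (simp add: r_def)
  have r2: "r m \<sigma> = p2 m \<sigma> \<cdot> y" if "\<sigma> \<in> S2 m" for m \<sigma> using that agree by (simp add: r_def)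
  have cx: "ss_cone C Xo Xa S1 P (\<lambda>m \<sigma>. p1 m \<sigma> \<cdot> x)" "ss_cone C Xo Xa S2 P (\<lambda>m \<sigma>. p2 m \<sigma> \<cdot> y)"
    using ss_cone_precomp[OF simplicial c1 pb(2)] ss_cone_precomp[OF simplicial c2 pb(3)] .
  have rx: "r m \<sigma> \<cdot> u = p1 m \<sigma> \<cdot> x \<cdot> u" if "\<sigma> \<in> S1 m" "u \<in> hom C L' P" for m \<sigma> u L'
    using comp_assoc_hom[OF that(2) pb(2) ss_coneD(2)[OF c1 that(1)]] r1[OF that(1)] by simp
  have ry: "r m \<sigma> \<cdot> u = p2 m \<sigma> \<cdot> y \<cdot> u" if "\<sigma> \<in> S2 m" "u \<in> hom C L' P" for m \<sigma> u L'
    using comp_assoc_hom[OF that(2) pb(3) ss_coneD(2)[OF c2 that(1)]] r2[OF that(1)] by simp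
  have "is_Map C Xo Xa (\<lambda>l. S1 l \<union> S2 l) P r"
  proof (rule is_MapI)
    show "ss_cone C Xo Xa (\<lambda>l. S1 l \<union> S2 l) P r"
      unfolding ss_cone_def
    proof (intro conjI allI ballI impI)
      show "P \<in> obj C" using pb(2) hom_obj by blast
      show "r m \<sigma> \<in> hom C P (Xo m)" if "\<sigma> \<in> S1 m \<union> S2 m" for m \<sigma>
        using that r1 r2 ss_coneD(2)[OF cx(1)] ss_coneD(2)[OF cx(2)] by auto
      show "Xa m l \<theta> \<cdot> r m \<sigma> = r l (ocomp \<sigma> \<theta>)" if "\<sigma> \<in> S1 m \<union> S2 m" "\<theta> \<in> mono_maps l m" for m l \<sigma> \<theta>
        using that r1 r2 ss_coneD(3)[OF cx(1)] ss_coneD(3)[OF cx(2)]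
          subcomplexD(2)[OF sub(1)] subcomplexD(2)[OF sub(2)] by auto
    qed
  next
    fix L' p' assume c': "ss_cone C Xo Xa (\<lambda>l. S1 l \<union> S2 l) L' p'"
    obtain u1 where u1: "u1 \<in> hom C L' L1" "\<And>m \<sigma>. \<sigma> \<in> S1 m \<Longrightarrow> p1 m \<sigma> \<cdot> u1 = p' m \<sigma>"
      using Map_lift[OF M1 ss_cone_subset[OF c', of S1]] by blast
    obtain u2 where u2: "u2 \<in> hom C L' L2" "\<And>m \<sigma>. \<sigma> \<in> S2 m \<Longrightarrow> p2 m \<sigma> \<cdot> u2 = p' m \<sigma>"
      using Map_lift[OF M2 ss_cone_subset[OF c', of S2]] by blast
    have "a \<cdot> u1 = b \<cdot> u2"
    proof (rule Map_eqI[OF M comp_hom[OF u1(1) a(1)] comp_hom[OF u2(1) b(1)]])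
      show "p m \<sigma> \<cdot> a \<cdot> u1 = p m \<sigma> \<cdot> b \<cdot> u2" if s: "\<sigma> \<in> S1 m \<inter> S2 m" for m \<sigma>
        using comp_assoc_hom[OF u1(1) a(1) ph[OF s]] comp_assoc_hom[OF u2(1) b(1) ph[OF s]]
          a(2)[OF s] b(2)[OF s] u1(2) u2(2) s by simp
    qed
    then obtain c where c: "c \<in> hom C L' P" "x \<cdot> c = u1" "y \<cdot> c = u2"
      using pullback_lift[OF pb a(1) b(1) u1(1) u2(1)] by blast
    have "r m \<sigma> \<cdot> c = p' m \<sigma>" if "\<sigma> \<in> S1 m \<union> S2 m" for m \<sigma>
      using that rx[OF _ c(1)] ry[OF _ c(1)] c(2,3) u1(2) u2(2) by auto
    then show "\<exists>u. u \<in> hom C L' P \<and> cone_agree (\<lambda>l. S1 l \<union> S2 l) (\<lambda>m \<sigma>. r m \<sigma> \<cdot> u) p'"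
      using c(1) unfolding cone_agree_def by blast
  next
    fix L' u v assume u: "u \<in> hom C L' P" and v: "v \<in> hom C L' P"
      and "cone_agree (\<lambda>l. S1 l \<union> S2 l) (\<lambda>m \<sigma>. r m \<sigma> \<cdot> u) (\<lambda>m \<sigma>. r m \<sigma> \<cdot> v)"
    then have eq: "r m \<sigma> \<cdot> u = r m \<sigma> \<cdot> v" if "\<sigma> \<in> S1 m \<or> \<sigma> \<in> S2 m" for m \<sigma>
      using that by (simp add: cone_agree_def)
    have "x \<cdot> u = x \<cdot> v"
      using eq rx[OF _ u] rx[OF _ v]
      by (intro Map_eqI[OF M1 comp_hom[OF u pb(2)] comp_hom[OF v pb(2)]]) simp
    moreover have "y \<cdot> u = y \<cdot> v"
      using eq ry[OF _ u] ry[OF _ v]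
      by (intro Map_eqI[OF M2 comp_hom[OF u pb(3)] comp_hom[OF v pb(3)]]) simp
    ultimately show "u = v" using pullback_cancel[OF pb u v] by blast
  qed
  then show ?thesis by blast
qed

end

section \<open>Existence and filtrations of relative mapping objects\<close>

context simplicial_morphism
begin

lemma f_cone:
  assumes "ss_cone C Xo Xa S L p"
  shows "ss_cone C Yo Ya S L (\<lambda>m \<sigma>. f m \<cdot> p m \<sigma>)"
  unfolding ss_cone_def
proof (intro conjI allI ballI impI)
  show "L \<in> obj C" using ss_coneD(1)[OF assms] .
  show "f m \<cdot> p m \<sigma> \<in> hom C L (Yo m)" if "\<sigma> \<in> S m" for m \<sigma>
    using X.comp_hom[OF ss_coneD(2)[OF assms that] f_hom] .
  show "Ya m l \<theta> \<cdot> f m \<cdot> p m \<sigma> = f l \<cdot> p l (ocomp \<sigma> \<theta>)"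
    if s: "\<sigma> \<in> S m" and t: "\<theta> \<in> mono_maps l m" for m l \<sigma> \<theta>
    using X.comp_assoc_hom[OF ss_coneD(2)[OF assms s] f_hom Y.Xa_hom[OF t]]
      X.comp_assoc_hom[OF ss_coneD(2)[OF assms s] X.Xa_hom[OF t] f_hom] f_natural[OF t]
      ss_coneD(3)[OF assms s t] by simp
qed

text \<open>The fibre product of \<open>Map(S,X)\<close> and \<open>Map(T,Y)\<close> over
  \<open>Map(S,Y)\<close>, formed as an actual pullback; \<open>is_relMap\<close> itself only states
  the universal property of the pair of cones.\<close>

lemma rmap_exists:
  assumes ST: "\<And>m. S m \<subseteq> T m"
    and M1: "is_Map C Xo Xa S L1 p1" and M2: "is_Map C Yo Ya S L2 p2"
    and M3: "is_Map C Yo Ya T L3 p3"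
  shows "\<exists>L p q. rmap S T L p q"
proof -
  have c1: "ss_cone C Xo Xa S L1 p1" and c2: "ss_cone C Yo Ya S L2 p2" and c3: "ss_cone C Yo Ya T L3 p3"
    using M1 M2 M3 X.Map_cone Y.Map_cone by blast+
  obtain a where a: "a \<in> hom C L1 L2" "\<And>m \<sigma>. \<sigma> \<in> S m \<Longrightarrow> p2 m \<sigma> \<cdot> a = f m \<cdot> p1 m \<sigma>"
    using Y.Map_lift[OF M2 f_cone[OF c1]] by blast
  obtain b where b: "b \<in> hom C L3 L2" "\<And>m \<sigma>. \<sigma> \<in> S m \<Longrightarrow> p2 m \<sigma> \<cdot> b = p3 m \<sigma>"
    using Y.Map_lift[OF M2 ss_cone_subset[OF c3 ST]] by blast
  obtain x y P where pb: "is_pullback C a b x y" "x \<in> hom C P L1" "y \<in> hom C P L3"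
    using X.pullback_exists[OF a(1) b(1)] by blast
  have p2h: "p2 m \<sigma> \<in> hom C L2 (Yo m)" if "\<sigma> \<in> S m" for m \<sigma>
    using ss_coneD(2)[OF c2 that] .
  have px: "(p1 m \<sigma> \<cdot> x) \<cdot> u = p1 m \<sigma> \<cdot> x \<cdot> u" if "\<sigma> \<in> S m" "u \<in> hom C L' P" for m \<sigma> u L'
    using X.comp_assoc_hom[OF that(2) pb(2) ss_coneD(2)[OF c1 that(1)]] .
  have py: "(p3 m \<sigma> \<cdot> y) \<cdot> u = p3 m \<sigma> \<cdot> y \<cdot> u" if "\<sigma> \<in> T m" "u \<in> hom C L' P" for m \<sigma> u L'
    using X.comp_assoc_hom[OF that(2) pb(3) ss_coneD(2)[OF c3 that(1)]] .
  have "rmap S T P (\<lambda>m \<sigma>. p1 m \<sigma> \<cdot> x) (\<lambda>m \<sigma>. p3 m \<sigma> \<cdot> y)"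
  proof (rule rmapI)
    have "f m \<cdot> p1 m \<sigma> \<cdot> x = p3 m \<sigma> \<cdot> y" if s: "\<sigma> \<in> S m" for m \<sigma>
      using X.comp_assoc_hom[OF pb(2) ss_coneD(2)[OF c1 s] f_hom] a(2)[OF s] b(2)[OF s]
        X.comp_assoc_hom[OF pb(2) a(1) p2h[OF s]] X.comp_assoc_hom[OF pb(3) b(1) p2h[OF s]]
        X.pullback_commutes[OF pb(1)] by simp
    then show "rcone S T P (\<lambda>m \<sigma>. p1 m \<sigma> \<cdot> x) (\<lambda>m \<sigma>. p3 m \<sigma> \<cdot> y)"
      unfolding rel_cone_def
      using X.ss_cone_precomp[OF X.simplicial c1 pb(2)] X.ss_cone_precomp[OF Y.simplicial c3 pb(3)]
      by simp
  next
    fix L' p' q' assume N: "rcone S T L' p' q'"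
    obtain u1 where u1: "u1 \<in> hom C L' L1" "\<And>m \<sigma>. \<sigma> \<in> S m \<Longrightarrow> p1 m \<sigma> \<cdot> u1 = p' m \<sigma>"
      using X.Map_lift[OF M1 rel_coneD(1)[OF N]] by blast
    obtain u3 where u3: "u3 \<in> hom C L' L3" "\<And>m \<sigma>. \<sigma> \<in> T m \<Longrightarrow> p3 m \<sigma> \<cdot> u3 = q' m \<sigma>"
      using Y.Map_lift[OF M3 rel_coneD(2)[OF N]] by blast
    have "a \<cdot> u1 = b \<cdot> u3"
    proof (rule Y.Map_eqI[OF M2 X.comp_hom[OF u1(1) a(1)] X.comp_hom[OF u3(1) b(1)]])
      show "p2 m \<sigma> \<cdot> a \<cdot> u1 = p2 m \<sigma> \<cdot> b \<cdot> u3" if s: "\<sigma> \<in> S m" for m \<sigma>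
        using X.comp_assoc_hom[OF u1(1) a(1) p2h[OF s]] X.comp_assoc_hom[OF u3(1) b(1) p2h[OF s]]
          X.comp_assoc_hom[OF u1(1) ss_coneD(2)[OF c1 s] f_hom]
          a(2)[OF s] b(2)[OF s] u1(2)[OF s] u3(2) s ST rel_coneD(3)[OF N s] by (metis subsetD)
    qed
    then obtain c where c: "c \<in> hom C L' P" "x \<cdot> c = u1" "y \<cdot> c = u3"
      using X.pullback_lift[OF pb a(1) b(1) u1(1) u3(1)] by blast
    then show "\<exists>u. u \<in> hom C L' P \<and> (\<forall>m. \<forall>\<sigma>\<in>S m. (p1 m \<sigma> \<cdot> x) \<cdot> u = p' m \<sigma>) \<and>
        (\<forall>m. \<forall>\<sigma>\<in>T m. (p3 m \<sigma> \<cdot> y) \<cdot> u = q' m \<sigma>)"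
      using px[OF _ c(1)] py[OF _ c(1)] u1(2) u3(2) by (intro exI[of _ c]) simp
  next
    fix L' u v assume u: "u \<in> hom C L' P" and v: "v \<in> hom C L' P"
      and eq: "\<forall>m. \<forall>\<sigma>\<in>S m. (p1 m \<sigma> \<cdot> x) \<cdot> u = (p1 m \<sigma> \<cdot> x) \<cdot> v"
        "\<forall>m. \<forall>\<sigma>\<in>T m. (p3 m \<sigma> \<cdot> y) \<cdot> u = (p3 m \<sigma> \<cdot> y) \<cdot> v"
    have "x \<cdot> u = x \<cdot> v"
      using eq(1) px[OF _ u] px[OF _ v]
      by (intro X.Map_eqI[OF M1 X.comp_hom[OF u pb(2)] X.comp_hom[OF v pb(2)]]) simp
    moreover have "y \<cdot> u = y \<cdot> v"
      using eq(2) py[OF _ u] py[OF _ v]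
      by (intro Y.Map_eqI[OF M3 X.comp_hom[OF u pb(3)] X.comp_hom[OF v pb(3)]]) simp
    ultimately show "u = v" using X.pullback_cancel[OF pb u v] by blast
  qed
  then show ?thesis by blast
qed

text \<open>Cells are attached in order of the rank \<open>r\<close>, in any order within a rank.
  Hence the attaching part \<open>Q\<close> of a cell may use other cells only if their rank is
  strictly smaller, and the free part must avoid those of equal rank as well.\<close>

lemma extends_attach_finite:
  fixes r :: "nat list \<Rightarrow> nat"
  assumes K: "stable_class C K" and sub: "subcomplex S" "subcomplex T" "\<And>l. S l \<subseteq> T l"
    and "finite B"
    and BT: "\<And>\<tau>. \<tau> \<in> B \<Longrightarrow> \<tau> \<in> T (length \<tau> - 1)"
    and Q: "\<And>\<tau> l. \<tau> \<in> B \<Longrightarrow> Q \<tau> l \<subseteq> mono_maps l (length \<tau> - 1)"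
    and cov: "\<And>\<tau> m. \<tau> \<in> B \<Longrightarrow> m = length \<tau> - 1 \<Longrightarrow>
      rel_cover C K Xo Xa Yo Ya f (Q \<tau>) (std_simplex m) (Xo m) (Xa m)"
    and inS: "\<And>\<tau> l \<theta>. \<tau> \<in> B \<Longrightarrow> \<theta> \<in> Q \<tau> l \<Longrightarrow>
      ocomp \<tau> \<theta> \<in> S l \<or> (\<exists>\<tau>'\<in>B. r \<tau>' < r \<tau> \<and> ocomp \<tau> \<theta> \<in> cell \<tau>' l)"
    and notS: "\<And>\<tau> l \<theta>. \<tau> \<in> B \<Longrightarrow> \<theta> \<in> mono_maps l (length \<tau> - 1) \<Longrightarrow> \<theta> \<notin> Q \<tau> l \<Longrightarrow>
      ocomp \<tau> \<theta> \<notin> S l \<and> (\<forall>\<tau>'\<in>B. \<tau>' \<noteq> \<tau> \<longrightarrow> r \<tau>' \<le> r \<tau> \<longrightarrow> ocomp \<tau> \<theta> \<notin> cell \<tau>' l)"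
    and inj: "\<And>\<tau> l \<theta> \<theta>'. \<tau> \<in> B \<Longrightarrow> \<theta> \<in> mono_maps l (length \<tau> - 1) \<Longrightarrow> \<theta> \<notin> Q \<tau> l \<Longrightarrow>
      \<theta>' \<in> mono_maps l (length \<tau> - 1) \<Longrightarrow> \<theta>' \<notin> Q \<tau> l \<Longrightarrow> ocomp \<tau> \<theta> = ocomp \<tau> \<theta>' \<Longrightarrow> \<theta> = \<theta>'"
  shows "extends K T S (\<lambda>l. S l \<union> (\<Union>\<tau>\<in>B. cell \<tau> l))"
  using \<open>finite B\<close> BT Q cov inS notS inj
proof (induction B rule: finite_ranking_induct[where f = r])
  case empty
  then show ?case using extends_refl[OF K] by simp
next
  case (insert x B)
  let ?S = "\<lambda>l. S l \<union> (\<Union>\<tau>\<in>B. cell \<tau> l)"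
  show ?case
  proof (cases "x \<in> B")
    case True
    then have "insert x B = B" by blast
    then show ?thesis using insert by simp
  next
    case False
    have 1: "extends K T S ?S"
    proof (rule insert.IH)
      fix \<tau> l \<theta> assume "\<tau> \<in> B" "\<theta> \<in> Q \<tau> l"
      \<comment> \<open>The induction inserts an \<open>x\<close> of maximal rank, so a cell of rank
        smaller than that of \<open>\<tau>\<close> is never \<open>x\<close> itself.\<close>
      then show "ocomp \<tau> \<theta> \<in> S l \<or> (\<exists>\<tau>'\<in>B. r \<tau>' < r \<tau> \<and> ocomp \<tau> \<theta> \<in> cell \<tau>' l)"
        using insert.prems(4)[of \<tau> \<theta> l] insert.hyps(2)[of \<tau>] by auto
    next
      fix \<tau> l \<theta> assume "\<tau> \<in> B" "\<theta> \<in> mono_maps l (length \<tau> - 1)" "\<theta> \<notin> Q \<tau> l"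
      then show "ocomp \<tau> \<theta> \<notin> S l \<and> (\<forall>\<tau>'\<in>B. \<tau>' \<noteq> \<tau> \<longrightarrow> r \<tau>' \<le> r \<tau> \<longrightarrow> ocomp \<tau> \<theta> \<notin> cell \<tau>' l)"
        using insert.prems(5)[of \<tau> \<theta> l] by blast
    next
      show "\<theta> = \<theta>'" if "\<tau> \<in> B" "\<theta> \<in> mono_maps l (length \<tau> - 1)" "\<theta> \<notin> Q \<tau> l"
        "\<theta>' \<in> mono_maps l (length \<tau> - 1)" "\<theta>' \<notin> Q \<tau> l" "ocomp \<tau> \<theta> = ocomp \<tau> \<theta>'"
      for \<tau> l \<theta> \<theta>'
        using insert.prems(6)[of \<tau> \<theta> l \<theta>'] that by simp
    qed (simp_all only: insert.prems(1-3) insertI2)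
    have ST: "cell \<tau> l \<subseteq> T l" if "\<tau> \<in> insert x B" for \<tau> l
      using generated_subset[OF sub(2) insert.prems(1)[OF that]] .
    have 2: "extends K T ?S (\<lambda>l. ?S l \<union> cell x l)"
    proof (rule extends_attach[where Q = "Q x"])
      show "subcomplex ?S"
        by (intro subcomplex_Un subcomplex_UN sub subcomplex_generated)
      show "?S l \<subseteq> T l" for l using sub(3) ST by blast
      show "x \<in> T (length x - 1)" "Q x l \<subseteq> mono_maps l (length x - 1)" for l
        using insert.prems(1,2) by blast+
      show "rel_cover C K Xo Xa Yo Ya f (Q x) (std_simplex (length x - 1)) (Xo (length x - 1)) (Xa (length x - 1))"
        using insert.prems(3)[of x] by simp
      show "ocomp x \<theta> \<in> ?S l" if "\<theta> \<in> Q x l" for l \<theta>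
        using insert.prems(4)[of x \<theta> l] that by auto
      show "ocomp x \<theta> \<notin> ?S l" if "\<theta> \<in> mono_maps l (length x - 1)" "\<theta> \<notin> Q x l" for l \<theta>
        using insert.prems(5)[of x \<theta> l] that False insert.hyps(2) by auto
      show "\<theta> = \<theta>'" if "\<theta> \<in> mono_maps l (length x - 1)" "\<theta> \<notin> Q x l"
        "\<theta>' \<in> mono_maps l (length x - 1)" "\<theta>' \<notin> Q x l" "ocomp x \<theta> = ocomp x \<theta>'" for l \<theta> \<theta>'
        using insert.prems(6)[of x \<theta> l \<theta>'] that by blast
    qed (fact K sub)+
    have "(\<lambda>l. ?S l \<union> cell x l) = (\<lambda>l. S l \<union> (\<Union>\<tau>\<in>insert x B. cell \<tau> l))" by auto
    then show ?thesis using extends_trans[OF K 1 2] by auto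
  qed
qed

text \<open>Along an isomorphism the new mapping object can be carried back to the old object
  \<open>L\<close> without changing the cone into Y. This prepares the passage through infinite
  towers.\<close>

lemma extends_iso_same_object:
  assumes "extends {u. is_iso C u} T S S'" and M: "rmap S T L p q"
    and sub: "subcomplex S'" "subcomplex T" "\<And>m. S' m \<subseteq> T m" "\<And>m. S m \<subseteq> S' m"
  shows "\<exists>p'. rmap S' T L p' q \<and> cone_agree S p p'"
proof -
  obtain L' p' q' u where 1: "rmap S' T L' p' q'" "is_iso C u" "u \<in> hom C L' L"
    "\<And>m \<sigma>. \<sigma> \<in> S m \<Longrightarrow> p m \<sigma> \<cdot> u = p' m \<sigma>" "\<And>m \<tau>. \<tau> \<in> T m \<Longrightarrow> q m \<tau> \<cdot> u = q' m \<tau>"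
    using extendsE[OF assms(1) M] by (metis mem_Collect_eq)
  obtain w where w: "w \<in> hom C L L'" "is_iso C w" "w \<cdot> u = idt C L'" "u \<cdot> w = idt C L"
    using X.is_iso_obtain[OF 1(2,3)] .
  have "rmap S' T L (\<lambda>m \<sigma>. p' m \<sigma> \<cdot> w) q"
  proof (rule rmap_transport[OF 1(1) w(1,2) sub(1-3)])
    show "q' m \<sigma> \<cdot> w = q m \<sigma>" if s: "\<sigma> \<in> T m" for m \<sigma>
      using X.comp_assoc_hom[OF w(1) 1(3) rmap_hom(2)[OF M s]] 1(5)[OF s] w(4) rmap_hom(2)[OF M s]
      by (simp add: hom_arr hom_dom)
  qed simp
  moreover have "p m \<sigma> = p' m \<sigma> \<cdot> w" if s: "\<sigma> \<in> S m" for m \<sigma>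
    using X.comp_assoc_hom[OF w(1) 1(3) rmap_hom(1)[OF M s]] 1(4)[OF s] w(4) rmap_hom(1)[OF M s]
    by (simp add: hom_arr hom_dom)
  ultimately show ?thesis unfolding cone_agree_def by blast
qed

text \<open>If all steps are isomorphisms, one object \<open>L\<close> represents every stage, with
  cones that extend each other. Their union then represents the union of the stages, so no inverse
  limit has to be formed.\<close>

lemma extends_chain_iso:
  assumes K: "stable_class C K"
    and sub: "\<And>d. subcomplex (S d)" "subcomplex T" "\<And>d m. S d m \<subseteq> T m" "\<And>d m. S d m \<subseteq> S (Suc d) m"
    and step: "\<And>d. extends {u. is_iso C u} T (S d) (S (Suc d))"
  shows "extends K T (S 0) (\<lambda>l. \<Union>d. S d l)"
  unfolding extends_def
proof (intro allI impI)
  let ?S = "\<lambda>l. \<Union>d. S d l"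
  fix L p q assume M: "rmap (S 0) T L p q"
  \<comment> \<open>Dependent choice is needed: the cone at stage \<open>Suc d\<close> must extend
    the one already chosen at stage \<open>d\<close>.\<close>
  have "\<exists>P. \<forall>d. rmap (S d) T L (P d) q \<and> (d = 0 \<longrightarrow> P d = p) \<and> cone_agree (S d) (P d) (P (Suc d))"
  proof (rule dependent_nat_choice[where P = "\<lambda>d p'. rmap (S d) T L p' q \<and> (d = 0 \<longrightarrow> p' = p)"
        and Q = "\<lambda>d p' p''. cone_agree (S d) p' p''", simplified conj_assoc])
    show "\<exists>p'. rmap (S 0) T L p' q \<and> (0 = 0 \<longrightarrow> p' = p)" using M by blast
    show "\<exists>y. rmap (S (Suc d)) T L y q \<and> (Suc d = 0 \<longrightarrow> y = p) \<and> cone_agree (S d) x y"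
      if "rmap (S d) T L x q \<and> (d = 0 \<longrightarrow> x = p)" for x d
      using extends_iso_same_object[OF step, of d L x q] sub that by auto
  qed
  then obtain P where P: "\<And>d. rmap (S d) T L (P d) q" "P 0 = p" "\<And>d. cone_agree (S d) (P d) (P (Suc d))"
    by blast
  have mono: "S d m \<subseteq> S (d + e) m" for d e m
    by (induction e) (use sub(4) in auto)
  have stable: "P (d + e) m \<sigma> = P d m \<sigma>" if "\<sigma> \<in> S d m" for d e m \<sigma>
  proof (induction e)
    case (Suc e)
    have "\<sigma> \<in> S (d + e) m" using that mono by blast
    then show ?case using Suc cone_agreeD[OF P(3), of \<sigma> "d + e" m] by simp
  qed simp
  define p' where "p' m \<sigma> = P (LEAST d. \<sigma> \<in> S d m) m \<sigma>" for m \<sigma>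
  have p': "p' m \<sigma> = P d m \<sigma>" if "\<sigma> \<in> S d m" for d m \<sigma>
  proof -
    have "\<sigma> \<in> S (LEAST d. \<sigma> \<in> S d m) m" using that by (rule LeastI)
    moreover have "(LEAST d. \<sigma> \<in> S d m) \<le> d" using that by (rule Least_le)
    ultimately show ?thesis using stable[of \<sigma> "LEAST d. \<sigma> \<in> S d m" m "d - (LEAST d. \<sigma> \<in> S d m)"]
      by (simp add: p'_def)
  qed
  have cones: "ss_cone C Xo Xa (S d) L (P d)" "\<And>m \<sigma>. \<sigma> \<in> S d m \<Longrightarrow> f m \<cdot> P d m \<sigma> = q m \<sigma>" for d
    using rel_coneD[OF rmap_cone[OF P(1)[of d]]] by blast+
  have "rmap ?S T L p' q"
  proof (rule rmapI)
    have "ss_cone C Xo Xa ?S L p'"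
      unfolding ss_cone_def
    proof (intro conjI allI ballI impI)
      show "L \<in> obj C" using ss_coneD(1)[OF cones(1)] .
      show "p' m \<sigma> \<in> hom C L (Xo m)" if "\<sigma> \<in> ?S m" for m \<sigma>
        using that p' ss_coneD(2)[OF cones(1)] by auto
      show "Xa m l \<theta> \<cdot> p' m \<sigma> = p' l (ocomp \<sigma> \<theta>)" if "\<sigma> \<in> ?S m" "\<theta> \<in> mono_maps l m" for m l \<sigma> \<theta>
      proof -
        obtain d where d: "\<sigma> \<in> S d m" using \<open>\<sigma> \<in> ?S m\<close> by blast
        show ?thesis
          using p'[OF d] p'[OF subcomplexD(2)[OF sub(1) d that(2)]] ss_coneD(3)[OF cones(1) d that(2)]
          by simp
      qed
    qed
    moreover have "f m \<cdot> p' m \<sigma> = q m \<sigma>" if "\<sigma> \<in> ?S m" for m \<sigma>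
      using that p' cones(2) by auto
    moreover have "ss_cone C Yo Ya T L q" using rel_coneD(2)[OF rmap_cone[OF M]] .
    ultimately show "rcone ?S T L p' q" unfolding rel_cone_def by blast
  next
    fix L' p'' q'' assume N: "rcone ?S T L' p'' q''"
    have Nd: "rcone (S d) T L' p'' q''" for d
      using N ss_cone_subset[OF rel_coneD(1)[OF N], of "S d"] unfolding rel_cone_def by blast
    obtain u where u: "u \<in> hom C L' L" "\<And>m \<sigma>. \<sigma> \<in> S 0 m \<Longrightarrow> p m \<sigma> \<cdot> u = p'' m \<sigma>"
      "\<And>m \<sigma>. \<sigma> \<in> T m \<Longrightarrow> q m \<sigma> \<cdot> u = q'' m \<sigma>"
      using rmap_lift[OF M Nd] by blast
    have "P d m \<sigma> \<cdot> u = p'' m \<sigma>" if s: "\<sigma> \<in> S d m" for d m \<sigma>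
    proof -
      obtain v where v: "v \<in> hom C L' L" "\<And>m \<sigma>. \<sigma> \<in> S d m \<Longrightarrow> P d m \<sigma> \<cdot> v = p'' m \<sigma>"
        "\<And>m \<sigma>. \<sigma> \<in> T m \<Longrightarrow> q m \<sigma> \<cdot> v = q'' m \<sigma>"
        using rmap_lift[OF P(1)[of d] Nd] by blast
      \<comment> \<open>The lift for stage \<open>d\<close> also solves the problem at stage 0,
        where lifts are unique; so a single \<open>u\<close> serves all stages.\<close>
      have "v = u"
      proof (rule rmap_eqI[OF M v(1) u(1)])
        show "p m \<sigma> \<cdot> v = p m \<sigma> \<cdot> u" if "\<sigma> \<in> S 0 m" for m \<sigma>
          using that mono[of 0 m d] stable[OF that, of d] P(2) v(2)[of \<sigma> m] u(2)[OF that] by auto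
        show "q m \<sigma> \<cdot> v = q m \<sigma> \<cdot> u" if "\<sigma> \<in> T m" for m \<sigma> using v(3)[OF that] u(3)[OF that] by simp
      qed
      then show ?thesis using v(2)[OF s] by simp
    qed
    then show "\<exists>u. u \<in> hom C L' L \<and> (\<forall>m. \<forall>\<sigma>\<in>?S m. p' m \<sigma> \<cdot> u = p'' m \<sigma>) \<and> (\<forall>m. \<forall>\<sigma>\<in>T m. q m \<sigma> \<cdot> u = q'' m \<sigma>)"
      using u p' by (intro exI[of _ u]) auto
  next
    fix L' u v assume u: "u \<in> hom C L' L" "v \<in> hom C L' L"
      and eq: "\<forall>m. \<forall>\<sigma>\<in>?S m. p' m \<sigma> \<cdot> u = p' m \<sigma> \<cdot> v" "\<forall>m. \<forall>\<sigma>\<in>T m. q m \<sigma> \<cdot> u = q m \<sigma> \<cdot> v"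
    show "u = v"
    proof (rule rmap_eqI[OF M u])
      show "p m \<sigma> \<cdot> u = p m \<sigma> \<cdot> v" if s: "\<sigma> \<in> S 0 m" for m \<sigma>
        using eq(1) s p'[OF s] P(2) by (metis UN_I UNIV_I)
    qed (use eq(2) in blast)
  qed
  moreover have L: "L \<in> obj C" using ss_coneD(1)[OF rel_coneD(1)[OF rmap_cone[OF M]]] .
  moreover have "idt C L \<in> K" using stable_classD(2)[OF K X.is_iso_idt[OF L]] .
  moreover have "p m \<sigma> \<cdot> idt C L = p' m \<sigma>" if s: "\<sigma> \<in> S 0 m" for m \<sigma>
    using rmap_hom(1)[OF M s] p'[OF s] P(2) by (simp add: hom_arr hom_dom)
  moreover have "q m \<sigma> \<cdot> idt C L = q m \<sigma>" if s: "\<sigma> \<in> T m" for m \<sigma>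
    using rmap_hom(2)[OF M s] by (simp add: hom_arr hom_dom)
  ultimately show "\<exists>L' p' q' u. rmap ?S T L' p' q' \<and> u \<in> K \<and> u \<in> hom C L' L \<and>
      (\<forall>m. \<forall>\<sigma>\<in>S 0 m. p m \<sigma> \<cdot> u = p' m \<sigma>) \<and> (\<forall>m. \<forall>\<tau>\<in>T m. q m \<tau> \<cdot> u = q' m \<tau>)"
    using X.idt_hom[OF L] by (intro exI[of _ L] exI[of _ p'] exI[of _ q] exI[of _ "idt C L"]) simp
qed

lemma extends_chain:
  assumes K: "stable_class C K"
    and sub: "\<And>d. subcomplex (S d)" "subcomplex T" "\<And>d m. S d m \<subseteq> T m" "\<And>d m. S d m \<subseteq> S (Suc d) m"
    and step: "\<And>d. d < N \<Longrightarrow> extends K T (S d) (S (Suc d))"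
    and isos: "\<And>d. N \<le> d \<Longrightarrow> extends {u. is_iso C u} T (S d) (S (Suc d))"
  shows "extends K T (S 0) (\<lambda>l. \<Union>d. S d l)"
proof -
  have mono: "S d m \<subseteq> S (d + e) m" for d e m
    by (induction e) (use sub(4) in auto)
  have "extends K T (S 0) (S d)" if "d \<le> N" for d
    using that
  proof (induction d)
    case (Suc d)
    then show ?case using extends_trans[OF K Suc.IH step[of d]] mono[of 0 _ d] by simp
  qed (simp add: extends_refl[OF K])
  then have 1: "extends K T (S 0) (S N)" by simp
  \<comment> \<open>Written as \<open>N + 0\<close> to match stage 0 of the shifted
    filtration.\<close>
  have "extends K T (S (N + 0)) (\<lambda>l. \<Union>d. S (N + d) l)"
    using sub isos by (intro extends_chain_iso[OF K, of "\<lambda>d. S (N + d)"]) auto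
  moreover have "(\<Union>d. S (N + d) l) = (\<Union>d. S d l)" for l
    using mono[of _ l N] by (force simp: add.commute)
  ultimately show ?thesis using extends_trans[OF K 1] mono[of 0 _ N] by simp
qed

end

section \<open>Words without repetitions\<close>

text \<open>The face operator that omits vertex number \<open>r\<close>; applied to
  \<open>[0..<Suc d]\<close> it yields the coface map into the standard simplex.\<close>

definition del :: "nat \<Rightarrow> nat list \<Rightarrow> nat list" where
  "del r w = take r w @ drop (Suc r) w"

lemma length_del [simp]: "r < length w \<Longrightarrow> length (del r w) = length w - 1"
  by (simp add: del_def)

lemma nth_del: "r < length w \<Longrightarrow> t < length w - 1 \<Longrightarrow> del r w ! t = (if t < r then w ! t else w ! Suc t)"
  by (auto simp: del_def nth_append)

lemma count_list_del: "r < length w \<Longrightarrow> count_list w i = count_list (del r w) i + (if w ! r = i then 1 else 0)"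
  by (subst (1) id_take_nth_drop[of r w]) (auto simp: del_def)

lemma set_del: "r < length w \<Longrightarrow> set (del r w) \<subseteq> set w" "r < length w \<Longrightarrow> set w \<subseteq> insert (w ! r) (set (del r w))"
proof -
  assume r: "r < length w"
  have "set w = set (take r w @ w ! r # drop (Suc r) w)" using id_take_nth_drop[OF r] by simp
  then show "set (del r w) \<subseteq> set w" "set w \<subseteq> insert (w ! r) (set (del r w))" by (auto simp: del_def)
qed

lemma del_upt_mono:
  assumes "r < Suc d" "0 < d"
  shows "del r [0..<Suc d] \<in> mono_maps (d - 1) d"
proof -
  have "sorted (del r [0..<Suc d])"
    using assms by (auto simp: sorted_iff_nth_mono nth_del simp del: upt_Suc)
  moreover have "set (del r [0..<Suc d]) \<subseteq> {0..<Suc d}"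
    using set_del(1)[of r "[0..<Suc d]"] assms by (simp del: upt_Suc)
  ultimately show ?thesis
    using assms by (auto simp: mono_maps_def all_maps_def simp del: upt_Suc)
qed

lemma set_del_upt:
  assumes "r < Suc d"
  shows "set (del r [0..<Suc d]) = {0..<Suc d} - {r}"
proof -
  have "distinct [0..<Suc d]" "[0..<Suc d] = take r [0..<Suc d] @ r # drop (Suc r) [0..<Suc d]"
    using id_take_nth_drop[of r "[0..<Suc d]"] assms by (simp_all del: upt_Suc)
  then show ?thesis
    unfolding del_def by (smt (verit) Diff_insert_absorb UnE Un_insert_right distinct_append
        distinct.simps(2) disjoint_iff insert_iff list.simps(15) set_append set_upt)
qed

lemma del_eq_ocomp: "r < length w \<Longrightarrow> del r w = ocomp w (del r [0..<length w])"
  by (rule nth_equalityI) (auto simp: nth_del)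

text \<open>Send each vertex to the first position at which \<open>\<theta>\<close> attains it;
  since \<open>\<theta>\<close> is sorted, this preserves order. In a standard simplex, therefore,
  the complex generated by \<open>\<theta>\<close> depends only on the vertices of
  \<open>\<theta>\<close>.\<close>

lemma mono_maps_section:
  assumes \<theta>: "\<theta> \<in> mono_maps l m" and \<chi>: "\<chi> \<in> mono_maps k m" and sub: "set \<chi> \<subseteq> set \<theta>"
  shows "\<exists>\<psi>\<in>mono_maps k l. ocomp \<theta> \<psi> = \<chi>"
proof -
  define \<psi> where "\<psi> = map (\<lambda>c. LEAST t. t < length \<theta> \<and> \<theta> ! t = c) \<chi>"
  have L: "(LEAST t. t < length \<theta> \<and> \<theta> ! t = c) < length \<theta> \<and> \<theta> ! (LEAST t. t < length \<theta> \<and> \<theta> ! t = c) = c"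
    if "c \<in> set \<chi>" for c
    by (rule LeastI_ex) (use that sub in \<open>auto simp: in_set_conv_nth subset_iff\<close>)
  have "(LEAST t. t < length \<theta> \<and> \<theta> ! t = c) \<le> (LEAST t. t < length \<theta> \<and> \<theta> ! t = c')"
    if "c \<in> set \<chi>" "c' \<in> set \<chi>" "c \<le> c'" for c c'
  proof (rule ccontr)
    assume "\<not> ?thesis"
    then have lt: "(LEAST t. t < length \<theta> \<and> \<theta> ! t = c') < (LEAST t. t < length \<theta> \<and> \<theta> ! t = c)" by simp
    then have "c' \<le> c"
      using L[OF that(1)] L[OF that(2)] sorted_nth_mono[OF mono_mapsD(3)[OF \<theta>]] by (metis less_imp_le)
    with that(3) lt show False by simp
  qed
  then have "sorted \<psi>"
    using mono_mapsD(3)[OF \<chi>] by (auto simp: \<psi>_def sorted_iff_nth_mono)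
  moreover have "ocomp \<theta> \<psi> = \<chi>"
    using L by (intro nth_equalityI) (auto simp: \<psi>_def)
  moreover have "\<psi> \<in> all_maps k l"
    using L mono_mapsD(1)[OF \<theta>] mono_mapsD(1)[OF \<chi>] by (fastforce simp: \<psi>_def all_maps_def)
  ultimately show ?thesis by (auto simp: mono_maps_def)
qed

text \<open>The factorization through the coface at \<open>r\<close> is an instance of
  \<open>mono_maps_section\<close>; \<open>d\<close> is positive because \<open>\<theta>\<close> is
  nonempty and so attains some value other than \<open>r\<close>.\<close>

lemma mono_maps_factor_del:
  assumes \<theta>: "\<theta> \<in> mono_maps l d" and r: "r \<le> d" "r \<notin> set \<theta>" and "length \<sigma> = Suc d"
  shows "0 < d" "ocomp \<sigma> \<theta> \<in> generated (d - 1) (del r \<sigma>) l"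
proof -
  have "hd \<theta> \<in> set \<theta>" using mono_mapsD(1)[OF \<theta>] by (cases \<theta>) auto
  then have "hd \<theta> \<le> d" "hd \<theta> \<noteq> r" using r mono_mapsD(2)[OF \<theta>, of "hd \<theta>"] by auto
  then show d: "0 < d" using r by linarith
  have "set \<theta> \<subseteq> set (del r [0..<Suc d])"
    using set_del_upt[of r d] r mono_mapsD(2)[OF \<theta>] by (auto simp del: upt_Suc)
  from mono_maps_section[OF del_upt_mono[of r d] \<theta> this] r d obtain \<psi> where
    \<psi>: "\<psi> \<in> mono_maps l (d - 1)" "ocomp (del r [0..<Suc d]) \<psi> = \<theta>" by (auto simp del: upt_Suc)
  have "ocomp (del r \<sigma>) \<psi> = ocomp \<sigma> \<theta>"
    using del_eq_ocomp[of r \<sigma>] r assms(4) \<psi>(2)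
      ocomp_assoc[OF mono_all[OF del_upt_mono[of r d]] mono_all[OF \<psi>(1)], of \<sigma>] d
    by (simp del: upt_Suc)
  then show "ocomp \<sigma> \<theta> \<in> generated (d - 1) (del r \<sigma>) l"
    using \<psi>(1) unfolding generated_def by (metis image_eqI)
qed

text \<open>One half of the Eilenberg-Zilber lemma: \<open>remdups_adj w\<close> is the
  nondegenerate simplex of which \<open>w\<close> is a degeneracy.\<close>

lemma remdups_adj_generates:
  assumes "length w = Suc l"
  shows "w \<in> cell (remdups_adj w) l"
proof -
  let ?y = "remdups_adj w"
  obtain g where g: "mono g" "g ` {0..<length w} = {0..<length ?y}" "\<forall>i<length w. w ! i = ?y ! g i"
    using remdups_adj_altdef[of w ?y] by auto
  have "length ?y > 0" using assms by (cases w) auto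
  then have gb: "g t \<le> length ?y - 1" if "t < Suc l" for t
    using g(2) that assms by (metis Suc_pred' atLeastLessThan_iff imageI less_Suc_eq_le zero_le)
  have "map g [0..<Suc l] \<in> mono_maps l (length ?y - 1)"
    using gb g(1) by (auto simp: mono_maps_def all_maps_def sorted_iff_nth_mono monoD simp del: upt_Suc)
  moreover have "w = ocomp ?y (map g [0..<Suc l])"
    using g(3) assms by (auto intro!: nth_equalityI simp del: upt_Suc)
  ultimately show ?thesis unfolding generated_def by blast
qed

text \<open>A repeated value of the sorted \<open>\<phi>\<close> would occur at adjacent positions
  and would show as equal neighbours in the word.\<close>

lemma mono_maps_strict:
  assumes "\<phi> \<in> mono_maps k m" "distinct_adj (ocomp \<tau> \<phi>)"
  shows "distinct \<phi>" "k \<le> m"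
proof -
  have "\<phi> ! t \<noteq> \<phi> ! Suc t" if "Suc t < length \<phi>" for t
    using distinct_adj_nth[OF assms(2), of t] that by auto
  then have "distinct_adj \<phi>" by (simp add: distinct_adj_conv_nth)
  with mono_mapsD(3)[OF assms(1)] have "sorted_wrt (<) \<phi>"
    by (auto simp: sorted_wrt_iff_nth_Suc_transp distinct_adj_nth le_neq_trans sorted_iff_nth_Suc)
  then show d: "distinct \<phi>" using strict_sorted_iff by blast
  have "set \<phi> \<subseteq> {0..<Suc m}" using mono_mapsD(2)[OF assms(1)] by auto
  then have "card (set \<phi>) \<le> Suc m" using card_mono[of "{0..<Suc m}" "set \<phi>"] by simp
  then show "k \<le> m" using distinct_card[OF d] mono_mapsD(1)[OF assms(1)] by simp
qed

lemma mono_maps_distinct_id: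
  assumes "\<phi> \<in> mono_maps m m" "distinct \<phi>"
  shows "\<phi> = [0..<Suc m]"
proof -
  have "set \<phi> \<subseteq> {0..<Suc m}" using mono_mapsD(2)[OF assms(1)] by auto
  moreover have "card (set \<phi>) = Suc m" using distinct_card[OF assms(2)] mono_mapsD(1)[OF assms(1)] by simp
  ultimately have "set \<phi> = set [0..<Suc m]" using card_subset_eq[of "{0..<Suc m}" "set \<phi>"] by (simp del: upt_Suc)
  then show ?thesis
    using mono_mapsD(3)[OF assms(1)] assms(2) by (intro sorted_distinct_set_unique) (auto simp del: upt_Suc)
qed

lemma mono_maps_distinct_del:
  assumes "\<phi> \<in> mono_maps (m - 1) m" "distinct \<phi>" "0 < m"
  shows "\<exists>r\<le>m. \<phi> = del r [0..<Suc m]"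
proof -
  have sub: "set \<phi> \<subseteq> {0..<Suc m}" using mono_mapsD(2)[OF assms(1)] by auto
  have card: "card (set \<phi>) = m" using distinct_card[OF assms(2)] mono_mapsD(1)[OF assms(1)] assms(3) by simp
  then have "card ({0..<Suc m} - set \<phi>) = 1" using card_Diff_subset[of "set \<phi>" "{0..<Suc m}"] sub by simp
  then obtain r where r: "{0..<Suc m} - set \<phi> = {r}" by (metis card_1_singletonE)
  then have rm: "r < Suc m" by auto
  have "set \<phi> = set (del r [0..<Suc m])" using r sub set_del_upt[OF rm] by blast
  moreover have "distinct (del r [0..<Suc m])" "sorted (del r [0..<Suc m])"
    using mono_mapsD(3)[OF del_upt_mono[OF rm assms(3)]]
    by (auto simp: del_def simp del: upt_Suc dest: in_set_takeD in_set_dropD)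
  ultimately have "\<phi> = del r [0..<Suc m]"
    using mono_mapsD(3)[OF assms(1)] assms(2) by (intro sorted_distinct_set_unique)
  then show ?thesis using rm by (intro exI[of _ r]) simp
qed

text \<open>A simplex without repetitions determines its degeneracies, and also the degeneracies of
  an inner face that has no repetitions either: the set \<open>J\<close> of vertices that may be skipped is
  empty or a singleton.\<close>

lemma degeneracy_unique:
  assumes "distinct_adj \<sigma>" "length \<sigma> = Suc m"
    and J: "J = {} \<or> (\<exists>j. J = {j} \<and> 0 < j \<and> j < m \<and> \<sigma> ! (j - 1) \<noteq> \<sigma> ! Suc j)"
    and \<theta>: "\<theta> \<in> mono_maps l m" "{0..m} - J \<subseteq> set \<theta>"
    and \<theta>': "\<theta>' \<in> mono_maps l m" "{0..m} - J \<subseteq> set \<theta>'"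
    and eq: "ocomp \<sigma> \<theta> = ocomp \<sigma> \<theta>'"
  shows "\<theta> = \<theta>'"
proof -
  have start: "\<phi> ! 0 = 0" if p: "\<phi> \<in> mono_maps l m" "{0..m} - J \<subseteq> set \<phi>" for \<phi>
  proof -
    have "0 \<in> set \<phi>" using p(2) J by auto
    then obtain t where "t < length \<phi>" "\<phi> ! t = 0" by (auto simp: in_set_conv_nth)
    then show ?thesis using sorted_nth_mono[OF mono_mapsD(3)[OF p(1)], of 0 t] by simp
  qed
  have gap: "r \<in> J" if p: "\<phi> \<in> mono_maps l m" "{0..m} - J \<subseteq> set \<phi>"
    and t: "Suc t < Suc l" "\<phi> ! t < r" "r < \<phi> ! Suc t" for \<phi> t r
  proof (rule ccontr)
    assume "r \<notin> J"
    moreover have "\<phi> ! Suc t \<in> set \<phi>" using t(1) mono_mapsD(1)[OF p(1)] by simp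
    then have "r \<le> m" using mono_mapsD(2)[OF p(1)] t(3) by fastforce
    ultimately have "r \<in> set \<phi>" using p(2) by auto
    then obtain s where s: "s < length \<phi>" "\<phi> ! s = r" by (auto simp: in_set_conv_nth)
    have "s \<le> t \<or> Suc t \<le> s" by auto
    then show False
      using s t mono_mapsD(1)[OF p(1)] sorted_nth_mono[OF mono_mapsD(3)[OF p(1)], of s t]
        sorted_nth_mono[OF mono_mapsD(3)[OF p(1)], of "Suc t" s] by auto
  qed
  \<comment> \<open>A vertex that is passed over must lie in \<open>J\<close>, which has at most one
    element; hence consecutive values differ by 0 or 1, or by 2 across the vertex in
    \<open>J\<close>.\<close>
  have step: "\<phi> ! Suc t = \<phi> ! t \<or> \<phi> ! Suc t = Suc (\<phi> ! t) \<or>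
      (Suc (\<phi> ! t) \<in> J \<and> \<phi> ! Suc t = Suc (Suc (\<phi> ! t)))"
    if p: "\<phi> \<in> mono_maps l m" "{0..m} - J \<subseteq> set \<phi>" and t: "Suc t < Suc l" for \<phi> t
  proof -
    have "\<phi> ! t \<le> \<phi> ! Suc t"
      using sorted_nth_mono[OF mono_mapsD(3)[OF p(1)], of t "Suc t"] t mono_mapsD(1)[OF p(1)] by simp
    moreover have "Suc (\<phi> ! t) \<in> J" if "Suc (\<phi> ! t) < \<phi> ! Suc t" using gap[OF p t _ that] by simp
    moreover have "Suc (Suc (\<phi> ! t)) \<in> J" if "Suc (Suc (\<phi> ! t)) < \<phi> ! Suc t" using gap[OF p t _ that] by simp
    ultimately show ?thesis using J by (metis Suc_lessD empty_iff le_less_Suc_eq less_antisym not_less_eq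
      n_not_Suc_n nat_neq_iff leD singletonD)
  qed
  have bound: "\<phi> ! t \<le> m" if "\<phi> \<in> mono_maps l m" "t < Suc l" for \<phi> t
    using mono_mapsD(2)[OF that(1), of "\<phi> ! t"] mono_mapsD(1)[OF that(1)] that(2) by simp
  have ne1: "\<sigma> ! a \<noteq> \<sigma> ! Suc a" if "Suc a \<le> m" for a
    using distinct_adj_nth[OF assms(1), of a] that assms(2) by simp
  have ne2: "\<sigma> ! a \<noteq> \<sigma> ! Suc (Suc a)" if "Suc a \<in> J" for a
    using J that by auto
  have nth_eq: "\<theta> ! t = \<theta>' ! t" if "t < Suc l" for t
    using that
  proof (induction t)
    case 0
    then show ?case using start[OF \<theta>] start[OF \<theta>'] by simp
  next
    case (Suc t)
    then have IH: "\<theta> ! t = \<theta>' ! t" by simp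
    have "\<sigma> ! (\<theta> ! Suc t) = \<sigma> ! (\<theta>' ! Suc t)"
      using arg_cong[OF eq, of "\<lambda>w. w ! Suc t"] Suc.prems mono_mapsD(1)[OF \<theta>(1)] mono_mapsD(1)[OF \<theta>'(1)] by simp
    \<comment> \<open>From a given vertex the possible next letters are pairwise different:
      neighbours by \<open>ne1\<close>, and the letters on both sides of the vertex in
      \<open>J\<close> by \<open>ne2\<close>. So the next letter decides the step.\<close>
    then show ?case
      using step[OF \<theta> Suc.prems] step[OF \<theta>' Suc.prems] IH ne1 ne2 bound[OF \<theta>(1) Suc.prems]
        bound[OF \<theta>'(1) Suc.prems] by metis
  qed
  then show ?thesis
    using mono_mapsD(1)[OF \<theta>(1)] mono_mapsD(1)[OF \<theta>'(1)] by (intro nth_equalityI) auto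
qed


section \<open>The second letter of a word: closed and open words\<close>

definition second_letter :: "nat \<Rightarrow> nat list \<Rightarrow> nat \<Rightarrow> bool" where
  "second_letter i w e \<longleftrightarrow> e < length w \<and> w ! e \<noteq> i \<and> (\<exists>s<e. w ! s \<noteq> i) \<and>
     (\<forall>s<e. w ! s \<noteq> i \<longrightarrow> w ! s \<noteq> w ! e) \<and>
     (\<forall>s<e. \<forall>t<e. w ! s \<noteq> i \<longrightarrow> w ! t \<noteq> i \<longrightarrow> w ! s = w ! t)"

text \<open>The index conventions differ: here \<open>j\<close> is the pivot, the place of the
  letter \<open>i\<close>, and the second letter follows at \<open>Suc j\<close>; in
  \<open>open_at\<close> the second letter itself is at \<open>j\<close>. With this, deleting at
  \<open>j\<close> turns a word closed at \<open>j\<close> into a word open at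
  \<open>j\<close>.\<close>

definition closed_at :: "nat \<Rightarrow> nat list \<Rightarrow> nat \<Rightarrow> bool" where
  "closed_at i w j \<longleftrightarrow> distinct_adj w \<and> second_letter i w (Suc j) \<and> w ! j = i"

definition open_at :: "nat \<Rightarrow> nat list \<Rightarrow> nat \<Rightarrow> bool" where
  "open_at i w j \<longleftrightarrow> distinct_adj w \<and> second_letter i w j \<and> w ! (j - 1) \<noteq> i"

lemma second_letter_cong:
  assumes "second_letter i w e" "\<And>s. s \<le> e \<Longrightarrow> v ! s = w ! s" "e < length v"
  shows "second_letter i v e"
proof -
  have "\<And>s. s < e \<Longrightarrow> v ! s = w ! s" "v ! e = w ! e" using assms(2) by simp_all
  then show ?thesis using assms(1,3) unfolding second_letter_def by (simp cong: conj_cong)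
qed

lemma second_letter_unique:
  assumes "second_letter i w e" "second_letter i w e'"
  shows "e = e'"
proof -
  have "\<not> e < e'" if e: "second_letter i w e" and e': "second_letter i w e'" for e e'
  proof
    assume lt: "e < e'"
    obtain s where s: "s < e" "w ! s \<noteq> i" "w ! s \<noteq> w ! e" using e unfolding second_letter_def by blast
    moreover have "w ! e \<noteq> i" using e unfolding second_letter_def by blast
    ultimately show False using e' lt unfolding second_letter_def by (meson less_trans)
  qed
  then show ?thesis using assms by (metis nat_neq_iff)
qed

text \<open>Take the least position of a letter other than \<open>i\<close> that has a different
  such letter before it; minimality makes all earlier letters other than \<open>i\<close>
  equal.\<close>

lemma second_letter_exists:
  assumes "x \<in> set w" "y \<in> set w" "x \<noteq> i" "y \<noteq> i" "x \<noteq> y"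
  shows "\<exists>e. second_letter i w e"
proof -
  let ?P = "\<lambda>e. e < length w \<and> w ! e \<noteq> i \<and> (\<exists>s<e. w ! s \<noteq> i \<and> w ! s \<noteq> w ! e)"
  obtain a b where ab: "a < length w" "w ! a = x" "b < length w" "w ! b = y"
    using assms(1,2) by (auto simp: in_set_conv_nth)
  have "?P (max a b)"
  proof (cases "a < b")
    case True
    then show ?thesis using ab assms(3-5) by (auto simp: max_def)
  next
    case False
    with ab assms(5) have "b < a" by (metis nat_neq_iff)
    then show ?thesis using ab assms(3-5) by (auto simp: max_def)
  qed
  then obtain e where e: "?P e" "\<forall>e'<e. \<not> ?P e'" using exists_least_iff[of ?P] by blast
  then obtain s0 where s0: "s0 < e" "w ! s0 \<noteq> i" "w ! s0 \<noteq> w ! e" by blast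
  have same: "w ! s = w ! t" if "s < e" "t < e" "w ! s \<noteq> i" "w ! t \<noteq> i" for s t
  proof (rule ccontr)
    assume ne: "w ! s \<noteq> w ! t"
    have "\<not> ?P s" "\<not> ?P t" "s < length w" "t < length w" using e that by auto
    then show False using that ne by (metis nat_neq_iff)
  qed
  have "w ! s \<noteq> w ! e" if "s < e" "w ! s \<noteq> i" for s
    using same[OF that(1) s0(1) that(2) s0(2)] s0(3) by simp
  then have "second_letter i w e"
    unfolding second_letter_def using e(1) s0 same by blast
  then show ?thesis by blast
qed

text \<open>Here it pays to delete at the second letter: the pivot is an interior vertex, so the
  horn at it is inner, and its neighbours are the different letters x and y, so the opposite face
  has no repetitions.\<close>

lemma closed_at_bounds:
  assumes "closed_at i w j"
  shows "0 < j" "Suc j < length w" "w ! (j - 1) \<noteq> i" "w ! Suc j \<noteq> i" "w ! (j - 1) \<noteq> w ! Suc j"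
proof -
  have c: "distinct_adj w" "second_letter i w (Suc j)" "w ! j = i" using assms by (auto simp: closed_at_def)
  obtain s where s: "s < Suc j" "w ! s \<noteq> i" using c(2) unfolding second_letter_def by blast
  then have "s < j" using c(3) by (metis less_SucE)
  then show j: "0 < j" by simp
  show "Suc j < length w" "w ! Suc j \<noteq> i" using c(2) by (auto simp: second_letter_def)
  show "w ! (j - 1) \<noteq> i" using distinct_adj_nth[OF c(1), of "j - 1"] j c(2,3) by (auto simp: second_letter_def)
  then show "w ! (j - 1) \<noteq> w ! Suc j" using c(2) j unfolding second_letter_def by (metis diff_less less_SucI less_numeral_extra(1))
qed

lemma closed_at_unique: "closed_at i w j \<Longrightarrow> closed_at i w j' \<Longrightarrow> j = j'"
  using second_letter_unique by (metis closed_at_def Suc_inject)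

lemma open_closed: "open_at i w j \<Longrightarrow> \<not> closed_at i w j'"
  using second_letter_unique by (metis closed_at_def open_at_def diff_Suc_1)

lemma open_at_unique: "open_at i w j \<Longrightarrow> open_at i w j' \<Longrightarrow> j = j'"
  using second_letter_unique by (metis open_at_def)

lemma closed_at_del:
  assumes "closed_at i w j"
  shows "open_at i (del j w) j"
proof -
  note b = closed_at_bounds[OF assms]
  have c: "distinct_adj w" "second_letter i w (Suc j)" "w ! j = i" using assms by (auto simp: closed_at_def)
  have n: "del j w ! t = (if t < j then w ! t else w ! Suc t)" if "t < length w - 1" for t
    using nth_del[of j w t] that b(2) by simp
  have "del j w ! t \<noteq> del j w ! Suc t" if t: "Suc t < length w - 1" for t
  proof -
    consider "Suc t < j" | "Suc t = j" | "j \<le> t" by linarith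
    then show ?thesis
      using n[of t] n[of "Suc t"] t b distinct_adj_nth[OF c(1), of t] distinct_adj_nth[OF c(1), of "Suc t"]
      by cases auto
  qed
  then have "distinct_adj (del j w)" using b(2) by (simp add: distinct_adj_conv_nth)
  moreover have "second_letter i (del j w) j"
    unfolding second_letter_def
  proof (intro conjI allI impI)
    show "j < length (del j w)" using b(2) by simp
    show "del j w ! j \<noteq> i" using n[of j] b by simp
    show "\<exists>s<j. del j w ! s \<noteq> i" using n[of "j - 1"] b by (intro exI[of _ "j - 1"]) auto
    show "del j w ! s \<noteq> del j w ! j" if "s < j" "del j w ! s \<noteq> i" for s
      using c(2) n[of s] n[of j] that b(2) unfolding second_letter_def by auto
    show "del j w ! s = del j w ! t" if "s < j" "t < j" "del j w ! s \<noteq> i" "del j w ! t \<noteq> i" for s t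
      using c(2) n[of s] n[of t] that b(2) unfolding second_letter_def by auto
  qed
  moreover have "del j w ! (j - 1) \<noteq> i" using n[of "j - 1"] b by auto
  ultimately show ?thesis by (simp add: open_at_def)
qed

text \<open>The letter \<open>i\<close> fits in front of the second letter without creating a
  repetition, since neither neighbour is \<open>i\<close>. Together with
  \<open>closed_at_del\<close> this is the pairing of closed and open words.\<close>

lemma open_at_insert:
  assumes "open_at i w j"
  obtains w' where "closed_at i w' j" "del j w' = w" "length w' = Suc (length w)" "set w' = insert i (set w)"
proof
  let ?w' = "take j w @ i # drop j w"
  have o: "distinct_adj w" "second_letter i w j" "w ! (j - 1) \<noteq> i" using assms by (auto simp: open_at_def)
  have j: "0 < j" "j < length w" using o(2) by (auto simp: second_letter_def)
  show "length ?w' = Suc (length w)" by simp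
  have "set w = set (take j w) \<union> set (drop j w)" by (metis append_take_drop_id set_append)
  then show "set ?w' = insert i (set w)" by auto
  show "del j ?w' = w" using j by (simp add: del_def)
  have n: "?w' ! t = (if t < j then w ! t else if t = j then i else w ! (t - 1))" if "t < Suc (length w)" for t
    using that j by (auto simp: nth_append nth_Cons')
  have "?w' ! t \<noteq> ?w' ! Suc t" if t: "Suc t < Suc (length w)" for t
  proof -
    consider "Suc t < j" | "Suc t = j" | "t = j" | "j < t" by linarith
    then show ?thesis
    proof cases
      case 1
      then show ?thesis using n[of t] n[of "Suc t"] t j distinct_adj_nth[OF o(1), of t] by simp
    next
      case 2
      then show ?thesis using n[of t] n[of j] t o(3) by auto
    next
      case 3
      then show ?thesis using n[of j] n[of "Suc j"] t o(2) by (simp add: second_letter_def)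
    next
      case 4
      then show ?thesis using n[of t] n[of "Suc t"] t distinct_adj_nth[OF o(1), of "t - 1"] by simp
    qed
  qed
  then have "distinct_adj ?w'" using j by (simp add: distinct_adj_conv_nth)
  moreover have "?w' ! j = i" using n[of j] j by simp
  moreover have "second_letter i ?w' (Suc j)"
    unfolding second_letter_def
  proof (intro conjI allI impI)
    show "Suc j < length ?w'" using j by simp
    show "?w' ! Suc j \<noteq> i" using n[of "Suc j"] j o(2) by (simp add: second_letter_def)
    show "\<exists>s<Suc j. ?w' ! s \<noteq> i" using n[of "j - 1"] j o(3) by (intro exI[of _ "j - 1"]) auto
    show "?w' ! s \<noteq> ?w' ! Suc j" if "s < Suc j" "?w' ! s \<noteq> i" for s
      using o(2) n[of s] n[of "Suc j"] that j unfolding second_letter_def by (auto split: if_splits)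
    show "?w' ! s = ?w' ! t" if "s < Suc j" "t < Suc j" "?w' ! s \<noteq> i" "?w' ! t \<noteq> i" for s t
      using o(2) n[of s] n[of t] that j unfolding second_letter_def by (auto split: if_splits)
  qed
  ultimately show "closed_at i ?w' j" by (simp add: closed_at_def)
qed

text \<open>By this, every open face of a closed word except the one opposite to its pivot arises by
  deleting a letter other than \<open>i\<close>, so its closed partner has one more \<open>i\<close>; this orders the
  attaching of the closed words of a given length.\<close>

lemma open_face:
  assumes c: "closed_at i w j" and r: "r < length w" and o: "open_at i (del r w) j'" and wr: "w ! r = i"
  shows "r = j" "j' = j"
proof -
  note b = closed_at_bounds[OF c]
  have cw: "distinct_adj w" "second_letter i w (Suc j)" "w ! j = i" using c by (auto simp: closed_at_def)
  have ov: "distinct_adj (del r w)" "second_letter i (del r w) j'" "del r w ! (j' - 1) \<noteq> i"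
    using o by (auto simp: open_at_def)
  have n: "del r w ! t = (if t < r then w ! t else w ! Suc t)" if "t < length w - 1" for t
    using nth_del[OF r that] .
  show rj: "r = j"
  proof (rule ccontr)
    assume "r \<noteq> j"
    moreover have "r \<noteq> Suc j" "r \<noteq> j - 1" using wr b by auto
    \<comment> \<open>Past the second letter a deletion leaves x i y in place, and so does the
      deletion of an initial \<open>i\<close>; in both cases the word stays closed. Any other
      \<open>i\<close> before the pivot stands between two copies of x, and its deletion creates a
      repetition.\<close>
    ultimately consider "Suc j < r" | "r = 0" "1 < j" | "0 < r" "Suc r < j" by linarith
    then show False
    proof cases
      case 1
      have "second_letter i (del r w) (Suc j)"
        using 1 r by (intro second_letter_cong[OF cw(2)]) (simp_all add: n)
      then have "j' = Suc j" using second_letter_unique ov(2) by blast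
      then show False using ov(3) n[of j] 1 r cw(3) by auto
    next
      case 2
      have m: "del r w ! t = w ! Suc t" if "t < length w - 1" for t using n[OF that] 2(1) by simp
      have "second_letter i (del r w) j"
        unfolding second_letter_def
      proof (intro conjI allI impI)
        show "j < length (del r w)" using b(2) r by simp
        show "del r w ! j \<noteq> i" using m[of j] b by simp
        show "\<exists>s<j. del r w ! s \<noteq> i" using m[of "j - 2"] b 2 by (intro exI[of _ "j - 2"]) (auto simp: Suc_diff_Suc numeral_2_eq_2)
        show "del r w ! s \<noteq> del r w ! j" if "s < j" "del r w ! s \<noteq> i" for s
          using cw(2) m[of s] m[of j] that b(2) unfolding second_letter_def by auto
        show "del r w ! s = del r w ! t" if "s < j" "t < j" "del r w ! s \<noteq> i" "del r w ! t \<noteq> i" for s t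
          using cw(2) m[of s] m[of t] that b(2) unfolding second_letter_def by auto
      qed
      then have "j' = j" using second_letter_unique ov(2) by blast
      moreover have "del r w ! (j - 1) = w ! j" using m[of "j - 1"] 2 b(1,2) by simp
      ultimately show False using ov(3) cw(3) by simp
    next
      case 3
      have "w ! (r - 1) \<noteq> i" "w ! Suc r \<noteq> i"
        using distinct_adj_nth[OF cw(1), of "r - 1"] distinct_adj_nth[OF cw(1), of r] 3 r b(2) wr by auto
      then have "w ! (r - 1) = w ! Suc r" using cw(2) 3 unfolding second_letter_def by auto
      moreover have "r - 1 < length w - 1" "r < length w - 1" "Suc (r - 1) < length (del r w)"
        using 3 r b(2) by auto
      ultimately show False using distinct_adj_nth[OF ov(1), of "r - 1"] n[of "r - 1"] n[of r] 3(1) by simp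
    qed
  qed
  show "j' = j" using open_at_unique[OF o] closed_at_del[OF c] rj by blast
qed

section \<open>Horns and boundaries of thick simplices\<close>

text \<open>Arbitrary families of vertex sets make these complexes closed under unions and
  intersections, on which \<open>Map_thick_exists\<close> rests.\<close>

definition thick :: "nat set set \<Rightarrow> nat \<Rightarrow> nat list set" where
  "thick F l = {w. length w = Suc l \<and> (\<exists>V\<in>F. set w \<subseteq> V)}"

text \<open>\<open>U\<close> lists the vertices whose opposite facets are taken:
  \<open>V - {i}\<close> gives the thick horn at \<open>i\<close>, and \<open>V\<close> the thick
  boundary.\<close>

definition facets :: "nat set \<Rightarrow> nat set \<Rightarrow> nat set set" where
  "facets V U = (\<lambda>j. V - {j}) ` U"

lemma subcomplex_thick: "subcomplex (thick F)"
  unfolding subcomplex_def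
proof (intro allI ballI conjI)
  fix m \<sigma> l \<theta> assume s: "\<sigma> \<in> thick F m" and t: "\<theta> \<in> mono_maps l m"
  have "length \<sigma> = Suc m" using s by (simp add: thick_def)
  then show "ocomp \<sigma> \<theta> \<in> thick F l"
    using s set_ocomp_subset[OF _ mono_all[OF t], of \<sigma>] mono_mapsD(1)[OF t] unfolding thick_def
    by (auto dest: subset_trans)
next
  fix m \<sigma> assume "\<sigma> \<in> thick F m"
  then show "length \<sigma> = Suc m" by (simp add: thick_def)
qed

lemma thick_singleton: "thick {V} l = {w. length w = Suc l \<and> set w \<subseteq> V}"
  by (auto simp: thick_def)

lemma thick_facets:
  "U \<subseteq> V \<Longrightarrow> thick (facets V U) l = {w. length w = Suc l \<and> set w \<subseteq> V \<and> \<not> U \<subseteq> set w}"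
  unfolding thick_def facets_def by blast

section \<open>The thick simplex built from its horn by closed words\<close>

lemma self_generated: "length \<tau> = Suc m \<Longrightarrow> \<tau> \<in> generated m \<tau> m"
  unfolding generated_def using ocomp_id id_mono by (metis image_eqI)

lemma set_generated: "w \<in> generated m \<tau> l \<Longrightarrow> length \<tau> = Suc m \<Longrightarrow> set w \<subseteq> set \<tau>"
  unfolding generated_def using set_ocomp_subset[OF _ mono_all] by blast

lemma length_generated: "w \<in> generated m \<tau> l \<Longrightarrow> length w = Suc l"
  unfolding generated_def using mono_mapsD(1) by auto

text \<open>A closed word contains \<open>i\<close>, so for a closed word on \<open>V\<close>, using
  all letters of \<open>V\<close> is the same as lying outside the thick horn.\<close>

definition closed_words :: "nat set \<Rightarrow> nat \<Rightarrow> nat list set" where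
  "closed_words V i = {w. set w = V \<and> (\<exists>j. closed_at i w j)}"

text \<open>The bound is on the length, which exceeds the dimension by one: the passage from
  \<open>d\<close> to \<open>Suc d\<close> attaches the cells of dimension \<open>d\<close>.\<close>

definition horn_stage :: "nat set \<Rightarrow> nat \<Rightarrow> nat \<Rightarrow> nat \<Rightarrow> nat list set" where
  "horn_stage V i d l = thick (facets V (V - {i})) l \<union> (\<Union>\<tau>\<in>{\<tau>\<in>closed_words V i. length \<tau> \<le> d}. cell \<tau> l)"

lemma closed_wordsD: "\<tau> \<in> closed_words V i \<Longrightarrow> set \<tau> = V" "\<tau> \<in> closed_words V i \<Longrightarrow> distinct_adj \<tau>"
  "\<tau> \<in> closed_words V i \<Longrightarrow> 3 \<le> length \<tau>"
  using closed_at_bounds by (force simp: closed_words_def closed_at_def)+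

lemma closed_wordsE:
  assumes "\<tau> \<in> closed_words V i"
  obtains j where "closed_at i \<tau> j" "(THE j. closed_at i \<tau> j) = j"
proof -
  obtain j where j: "closed_at i \<tau> j" using assms by (auto simp: closed_words_def)
  then have "(THE j. closed_at i \<tau> j) = j" using closed_at_unique by blast
  with j that show thesis by blast
qed

lemma subcomplex_horn_stage: "subcomplex (horn_stage V i d)"
  unfolding horn_stage_def by (intro subcomplex_Un subcomplex_UN subcomplex_thick subcomplex_generated)

lemma horn_stage_mono: "d \<le> d' \<Longrightarrow> horn_stage V i d l \<subseteq> horn_stage V i d' l"
  unfolding horn_stage_def by force

lemma horn_stage_cell:
  "\<tau> \<in> closed_words V i \<Longrightarrow> length \<tau> \<le> d \<Longrightarrow> w \<in> cell \<tau> l \<Longrightarrow> w \<in> horn_stage V i d l"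
  unfolding horn_stage_def by blast

lemma horn_stage_subset: "horn_stage V i d l \<subseteq> thick {V} l"
proof
  fix w assume "w \<in> horn_stage V i d l"
  then consider "w \<in> thick (facets V (V - {i})) l" | \<tau> where "\<tau> \<in> closed_words V i" "w \<in> cell \<tau> l"
    unfolding horn_stage_def by blast
  then show "w \<in> thick {V} l"
  proof cases
    case 1
    then show ?thesis by (simp add: thick_facets thick_singleton)
  next
    case 2
    then show ?thesis
      using set_generated[OF 2(2)] length_generated[OF 2(2)] closed_wordsD[OF 2(1)] by (simp add: thick_singleton)
  qed
qed

lemma open_word_face:
  assumes "open_at i v j" "V - {i} \<subseteq> set v" "set v \<subseteq> V" "i \<in> V"
  obtains \<tau> where "\<tau> \<in> closed_words V i" "length \<tau> = Suc (length v)" "closed_at i \<tau> j" "del j \<tau> = v"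
    "v \<in> cell \<tau> (length v - 1)"
proof -
  obtain \<tau> where t: "closed_at i \<tau> j" "del j \<tau> = v" "length \<tau> = Suc (length v)" "set \<tau> = insert i (set v)"
    using open_at_insert[OF assms(1)] .
  have j: "j < length \<tau>" "Suc j < length \<tau>" using closed_at_bounds[OF t(1)] by auto
  then obtain d where d: "length \<tau> = Suc d" "0 < d" by (cases "length \<tau>") auto
  have "v \<in> cell \<tau> (length v - 1)"
    using del_eq_ocomp[OF j(1)] t(2,3) del_upt_mono[of j d] j d unfolding generated_def
    by (metis diff_Suc_1 image_eqI)
  moreover have "\<tau> \<in> closed_words V i" using t assms by (auto simp: closed_words_def)
  ultimately show thesis using that t by blast
qed

text \<open>Three vertices leave two letters besides \<open>i\<close>, so a word with all of them
  has a second letter; the letter in front of it decides between closed and open.\<close>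

lemma reduced_word_cases:
  assumes "distinct_adj v" "length v = Suc l" "set v \<subseteq> V" "i \<in> V" "3 \<le> card V"
  shows "v \<in> thick (facets V (V - {i})) l \<or> v \<in> closed_words V i \<or>
    (\<exists>j. open_at i v j \<and> V - {i} \<subseteq> set v)"
proof (cases "V - {i} \<subseteq> set v")
  case True
  have "2 \<le> card (V - {i})" using assms(4,5) by (simp add: card_Diff_singleton_if)
  then obtain x y where "x \<in> V - {i}" "y \<in> V - {i}" "x \<noteq> y"
    using card_2_iff'[of "V - {i}"] obtain_subset_with_card_n[of 2 "V - {i}"] by (metis card_2_iff insert_subset)
  then obtain e where e: "second_letter i v e" using second_letter_exists[of x v y i] True by auto
  then have "0 < e" by (auto simp: second_letter_def)
  show ?thesis
  proof (cases "v ! (e - 1) = i")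
    case True
    then have c: "closed_at i v (e - 1)" using e \<open>0 < e\<close> assms(1) by (simp add: closed_at_def)
    have "i \<in> set v" using True closed_at_bounds(2)[OF c] by (metis Suc_lessD nth_mem)
    then show ?thesis using c \<open>V - {i} \<subseteq> set v\<close> assms(3) by (auto simp: closed_words_def)
  next
    case False
    then show ?thesis using e assms(1) True by (auto simp: open_at_def)
  qed
next
  case False
  then show ?thesis using assms by (simp add: thick_facets)
qed

text \<open>An open word enters only as a face of its closed partner, which is longer by one; this
  is the reason for \<open>Suc\<close>.\<close>

lemma word_in_horn_stage:
  assumes "length w = Suc l" "set w \<subseteq> V" "i \<in> V" "3 \<le> card V"
  shows "w \<in> horn_stage V i (Suc (length (remdups_adj w))) l"
proof -
  let ?v = "remdups_adj w"
  obtain m where m: "length ?v = Suc m" using assms(1) by (cases ?v) auto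
  have sv: "set ?v \<subseteq> V" using assms(2) by simp
  from reduced_word_cases[OF distinct_adj_remdups_adj m sv assms(3,4)]
  have v: "?v \<in> horn_stage V i (Suc (length ?v)) m"
  proof (elim disjE exE conjE)
    assume "?v \<in> closed_words V i"
    then show ?thesis using self_generated[OF m] m by (intro horn_stage_cell[of ?v]) auto
  next
    fix j assume j: "open_at i ?v j" "V - {i} \<subseteq> set ?v"
    obtain \<tau> where "\<tau> \<in> closed_words V i" "length \<tau> = Suc (length ?v)" "?v \<in> cell \<tau> (length ?v - 1)"
      using open_word_face[OF j sv assms(3)] by blast
    then show ?thesis using m by (intro horn_stage_cell[of \<tau>]) auto
  qed (use assms m in \<open>auto simp: horn_stage_def\<close>)
  have "w \<in> cell ?v l" using remdups_adj_generates[OF assms(1)] .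
  then show ?thesis using generated_subset[OF subcomplex_horn_stage v] m by auto
qed

text \<open>A face of \<open>\<tau>\<close> other than the free one may be degenerate or not open;
  then it is already present in stage \<open>d\<close>. If it is open, its closed partner has the
  length of \<open>\<tau>\<close> but one more \<open>i\<close>, so the partner must be attached
  earlier within the same stage.\<close>

lemma horn_face_attached:
  assumes \<tau>: "\<tau> \<in> closed_words V i" "length \<tau> = Suc d" and V: "i \<in> V" "3 \<le> card V"
    and j: "closed_at i \<tau> j" and \<theta>: "\<theta> \<in> horn d j l"
  shows "ocomp \<tau> \<theta> \<in> horn_stage V i d l \<or>
    (\<exists>\<tau>'\<in>closed_words V i. length \<tau>' = Suc d \<and> count_list \<tau> i < count_list \<tau>' i \<and> ocomp \<tau> \<theta> \<in> cell \<tau>' l)"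
proof -
  obtain r where r: "r \<le> d" "r \<noteq> j" "r \<notin> set \<theta>" and \<theta>m: "\<theta> \<in> mono_maps l d"
    using \<theta> by (auto simp: horn_def)
  let ?v = "del r \<tau>"
  have d: "0 < d" and gen: "ocomp \<tau> \<theta> \<in> generated (d - 1) ?v l"
    using mono_maps_factor_del[OF \<theta>m r(1,3) \<tau>(2)] by auto
  have len: "length ?v = Suc (d - 1)" "length ?v = d" using r \<tau>(2) d by auto
  have sv: "set ?v \<subseteq> V" using set_del(1)[of r \<tau>] r \<tau> closed_wordsD(1) by auto
  have via: "ocomp \<tau> \<theta> \<in> S l" if "subcomplex S" "?v \<in> S (d - 1)" for S
    using generated_subset[OF that] gen by blast
  show ?thesis
  proof (cases "distinct_adj ?v")
    case False
    \<comment> \<open>A repetition costs a letter, which makes up for the extra letter of a closed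
      partner.\<close>
    then have "length (remdups_adj ?v) < d"
      using distinct_adj_conv_length_remdups_adj[of ?v] remdups_adj_length[of ?v] len by linarith
    then have "?v \<in> horn_stage V i d (d - 1)"
      using word_in_horn_stage[OF len(1) sv V] horn_stage_mono[of "Suc (length (remdups_adj ?v))" d] by auto
    then show ?thesis using via[OF subcomplex_horn_stage] by blast
  next
    case True
    from reduced_word_cases[OF True len(1) sv V] show ?thesis
    proof (elim disjE exE conjE)
      assume "?v \<in> thick (facets V (V - {i})) (d - 1)"
      then show ?thesis using via[OF subcomplex_horn_stage, of V i d] by (auto simp: horn_stage_def)
    next
      assume c: "?v \<in> closed_words V i"
      have "?v \<in> cell ?v (d - 1)" using self_generated[OF len(1)] len(2) by simp
      then have "?v \<in> horn_stage V i d (d - 1)" using c len(2) by (intro horn_stage_cell[of ?v]) auto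
      then show ?thesis using via[OF subcomplex_horn_stage] by blast
    next
      fix j' assume o: "open_at i ?v j'" "V - {i} \<subseteq> set ?v"
      obtain \<tau>' where t': "\<tau>' \<in> closed_words V i" "length \<tau>' = Suc (length ?v)" "closed_at i \<tau>' j'"
        "del j' \<tau>' = ?v" "?v \<in> cell \<tau>' (length ?v - 1)"
        using open_word_face[OF o sv V(1)] .
      \<comment> \<open>By \<open>open_face\<close>, deleting an \<open>i\<close> other than the
        pivot never gives an open word.\<close>
      have "\<tau> ! r \<noteq> i" using open_face(1)[OF j _ o(1)] r \<tau>(2) by auto
      then have "count_list \<tau> i = count_list ?v i" using count_list_del[of r \<tau> i] r \<tau>(2) by simp
      moreover have "count_list \<tau>' i = Suc (count_list ?v i)"
        using count_list_del[of j' \<tau>' i] t'(3,4) closed_at_bounds(2)[OF t'(3)] by (simp add: closed_at_def)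
      moreover have "ocomp \<tau> \<theta> \<in> cell \<tau>' l" using via[OF subcomplex_generated] t'(5) len by simp
      ultimately show ?thesis using t'(1,2) len by auto
    qed
  qed
qed

text \<open>The free face is nondegenerate, so in the cell of \<open>\<tau>'\<close> it is either
  \<open>\<tau>'\<close> itself, which is impossible because an open word is not closed, or a face
  of codimension one. In the second case the count of \<open>i\<close> shows that the deleted letter
  is \<open>i\<close>, \<open>open_face\<close> that it is the pivot of \<open>\<tau>'\<close>, and
  reinserting it gives back \<open>\<tau>\<close>.\<close>

lemma free_face_unique:
  assumes \<tau>: "closed_at i \<tau> j" "length \<tau> = Suc d" and \<tau>': "closed_at i \<tau>' j'"
    and len: "length \<tau>' \<le> d \<or> length \<tau>' = Suc d \<and> count_list \<tau> i \<le> count_list \<tau>' i"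
    and face: "del j \<tau> \<in> cell \<tau>' (d - 1)"
  shows "\<tau>' = \<tau>"
proof -
  let ?c = "del j \<tau>"
  have o: "open_at i ?c j" using closed_at_del[OF \<tau>(1)] .
  have d: "0 < d" "j < Suc d" using closed_at_bounds[OF \<tau>(1)] \<tau>(2) by auto
  obtain \<phi> where \<phi>: "\<phi> \<in> mono_maps (d - 1) (length \<tau>' - 1)" "?c = ocomp \<tau>' \<phi>"
    using face unfolding generated_def by blast
  have dist: "distinct \<phi>" "d - 1 \<le> length \<tau>' - 1"
    using mono_maps_strict[OF \<phi>(1)] o \<phi>(2) by (auto simp: open_at_def)
  obtain m where m: "length \<tau>' = Suc m" "0 < m" using closed_at_bounds[OF \<tau>'] by (cases "length \<tau>'") auto
  consider "m = d - 1" | "m = d" "count_list \<tau> i \<le> count_list \<tau>' i" using len dist(2) m d by fastforce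
  then show ?thesis
  proof cases
    case 1
    then have "\<phi> = [0..<Suc m]" using mono_maps_distinct_id[of \<phi> m] \<phi>(1) dist(1) m by simp
    then have "?c = \<tau>'" using \<phi>(2) ocomp_id[OF m(1)] by simp
    then show ?thesis using open_closed[OF o] \<tau>' by simp
  next
    case 2
    obtain r where r: "r \<le> m" "\<phi> = del r [0..<Suc m]"
      using mono_maps_distinct_del[of \<phi> m] \<phi>(1) dist(1) m 2 by auto
    have c: "?c = del r \<tau>'" using \<phi>(2) r m del_eq_ocomp[of r \<tau>'] by simp
    have "count_list \<tau> i = Suc (count_list ?c i)"
      using count_list_del[of j \<tau> i] d \<tau> by (simp add: closed_at_def)
    moreover have "count_list \<tau>' i = count_list ?c i + (if \<tau>' ! r = i then 1 else 0)"
      using count_list_del[of r \<tau>' i] r m c by simp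
    ultimately have "\<tau>' ! r = i" using 2(2) by (auto split: if_splits)
    then have eq: "r = j'" "j = j'" using open_face[OF \<tau>' _ o[unfolded c]] r m by auto
    have rebuild: "w = take j (del j w) @ i # drop j (del j w)" if "w ! j = i" "j < length w" for w
      using id_take_nth_drop[OF that(2)] that by (simp add: del_def)
    have "\<tau>' ! j = i" "\<tau> ! j = i" using \<tau>(1) \<tau>' eq by (auto simp: closed_at_def)
    then show ?thesis using rebuild[of \<tau>] rebuild[of \<tau>'] c eq d \<tau>(2) m r(1) by (metis less_Suc_eq_le)
  qed
qed

text \<open>A simplex of \<open>\<tau>\<close> outside the horn meets every vertex other than
  \<open>j\<close>, so the free face can be recovered from it by an operator. A subcomplex
  containing the simplex thus contains the free face, and \<open>free_face_unique\<close>
  applies.\<close>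

lemma free_face_new:
  assumes \<tau>: "\<tau> \<in> closed_words V i" "length \<tau> = Suc d" and j: "closed_at i \<tau> j" and "i \<in> V"
    and \<theta>: "\<theta> \<in> mono_maps l d" "\<theta> \<notin> horn d j l"
  shows "ocomp \<tau> \<theta> \<notin> horn_stage V i d l"
    "\<tau>' \<in> closed_words V i \<Longrightarrow> length \<tau>' = Suc d \<Longrightarrow> count_list \<tau> i \<le> count_list \<tau>' i \<Longrightarrow> \<tau>' \<noteq> \<tau> \<Longrightarrow>
      ocomp \<tau> \<theta> \<notin> cell \<tau>' l"
proof -
  have d: "0 < d" "j < Suc d" using closed_at_bounds[OF j] \<tau>(2) by auto
  have "set (del j [0..<Suc d]) \<subseteq> set \<theta>"
    using \<theta> unfolding set_del_upt[OF d(2)] horn_def by (auto simp: less_Suc_eq_le)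
  from mono_maps_section[OF \<theta>(1) del_upt_mono[OF d(2,1)] this] obtain \<psi> where
    \<psi>: "\<psi> \<in> mono_maps (d - 1) l" "ocomp \<theta> \<psi> = del j [0..<Suc d]" by blast
  have c: "ocomp (ocomp \<tau> \<theta>) \<psi> = del j \<tau>"
    using ocomp_assoc[OF mono_all[OF \<theta>(1)] mono_all[OF \<psi>(1)], of \<tau>] \<psi>(2) del_eq_ocomp[of j \<tau>] \<tau>(2) d(2)
    by simp
  have into: "del j \<tau> \<in> S (d - 1)" if "subcomplex S" "ocomp \<tau> \<theta> \<in> S l" for S
    using subcomplexD(2)[OF that \<psi>(1)] c by simp
  have "set \<tau> \<subseteq> insert i (set (del j \<tau>))"
    using set_del(2)[of j \<tau>] d \<tau>(2) j by (simp add: closed_at_def)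
  then have "V - {i} \<subseteq> set (del j \<tau>)" using closed_wordsD(1)[OF \<tau>(1)] by auto
  then have "ocomp \<tau> \<theta> \<notin> thick (facets V (V - {i})) l"
    using into[OF subcomplex_thick, of "facets V (V - {i})"] by (auto simp: thick_facets)
  moreover have new: "\<tau>' = \<tau>" if "\<tau>' \<in> closed_words V i"
    "length \<tau>' \<le> d \<or> length \<tau>' = Suc d \<and> count_list \<tau> i \<le> count_list \<tau>' i" "ocomp \<tau> \<theta> \<in> cell \<tau>' l" for \<tau>'
    using closed_wordsE[OF that(1)] free_face_unique[OF j \<tau>(2) _ that(2) into[OF subcomplex_generated that(3)]]
    by metis
  ultimately show "ocomp \<tau> \<theta> \<notin> horn_stage V i d l"
    using \<tau>(2) unfolding horn_stage_def by fastforce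
  show "ocomp \<tau> \<theta> \<notin> cell \<tau>' l" if "\<tau>' \<in> closed_words V i" "length \<tau>' = Suc d"
    "count_list \<tau> i \<le> count_list \<tau>' i" "\<tau>' \<noteq> \<tau>"
    using new[of \<tau>'] that by blast
qed

lemma finite_words: "finite V \<Longrightarrow> finite {\<tau>. set \<tau> = V \<and> length \<tau> = d}"
  by (rule finite_subset[OF _ finite_lists_length_eq[of V d]]) auto

context simplicial_morphism
begin

lemma extends_horn_stage:
  assumes K: "stable_class C K" and V: "finite V" "3 \<le> card V" "i \<in> V"
    and T: "subcomplex T" "\<And>l. thick {V} l \<subseteq> T l"
    and cov: "\<And>j. 0 < j \<Longrightarrow> j < d \<Longrightarrow> card V \<le> Suc d \<Longrightarrow>
      rel_cover C K Xo Xa Yo Ya f (horn d j) (std_simplex d) (Xo d) (Xa d)"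
  shows "extends K T (horn_stage V i d) (horn_stage V i (Suc d))"
proof -
  let ?B = "{\<tau>\<in>closed_words V i. length \<tau> = Suc d}"
  let ?Q = "\<lambda>\<tau>. horn (length \<tau> - 1) (THE j. closed_at i \<tau> j)"
  have "extends K T (horn_stage V i d) (\<lambda>l. horn_stage V i d l \<union> (\<Union>\<tau>\<in>?B. cell \<tau> l))"
  \<comment> \<open>Many letters \<open>i\<close> mean a small rank. The truncated subtraction does
    reverse the order because a word of length \<open>Suc d\<close> has at most \<open>Suc d\<close>
    letters \<open>i\<close>.\<close>
  proof (rule extends_attach_finite[where Q = ?Q and r = "\<lambda>\<tau>. Suc d - count_list \<tau> i"])
    show "finite ?B"
      by (rule finite_subset[OF _ finite_words[OF V(1), of "Suc d"]]) (auto simp: closed_words_def)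
    show "horn_stage V i d l \<subseteq> T l" for l using horn_stage_subset T(2) by blast
    show "\<tau> \<in> T (length \<tau> - 1)" if "\<tau> \<in> ?B" for \<tau>
      using that T(2)[of d] closed_wordsD(1) by (auto simp: thick_singleton)
    show "?Q \<tau> l \<subseteq> mono_maps l (length \<tau> - 1)" for \<tau> l by (auto simp: horn_def)
  next
    fix \<tau> m assume t: "\<tau> \<in> ?B" "m = length \<tau> - 1"
    obtain j where j: "closed_at i \<tau> j" "(THE j. closed_at i \<tau> j) = j" using closed_wordsE t(1) by blast
    \<comment> \<open>The word uses all letters of \<open>V\<close>, which bounds its length from
      below; hence the restriction on the dimension in \<open>cov\<close>.\<close>
    have "card V \<le> Suc d" using closed_wordsD(1)[of \<tau> V i] card_length[of \<tau>] t(1) by simp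
    then show "rel_cover C K Xo Xa Yo Ya f (?Q \<tau>) (std_simplex m) (Xo m) (Xa m)"
      using cov[of j] closed_at_bounds(1,2)[OF j(1)] t j(2) by simp
  next
    fix \<tau> l \<theta> assume t: "\<tau> \<in> ?B" "\<theta> \<in> ?Q \<tau> l"
    obtain j where j: "closed_at i \<tau> j" "(THE j. closed_at i \<tau> j) = j" using closed_wordsE t(1) by blast
    have len: "\<tau> \<in> closed_words V i" "length \<tau> = Suc d" using t(1) by auto
    have less: "Suc d - count_list \<tau>' i < Suc d - count_list \<tau> i"
      if "count_list \<tau> i < count_list \<tau>' i" "length \<tau>' = Suc d" for \<tau>'
      using that count_le_length[of \<tau>' i] by linarith
    show "ocomp \<tau> \<theta> \<in> horn_stage V i d l \<or> (\<exists>\<tau>'\<in>?B. Suc d - count_list \<tau>' i < Suc d - count_list \<tau> i \<and> ocomp \<tau> \<theta> \<in> cell \<tau>' l)"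
      using horn_face_attached[OF len V(3,2) j(1), of \<theta> l] t(2) j(2) len(2) less by auto
  next
    fix \<tau> l \<theta> assume t: "\<tau> \<in> ?B" "\<theta> \<in> mono_maps l (length \<tau> - 1)" "\<theta> \<notin> ?Q \<tau> l"
    obtain j where j: "closed_at i \<tau> j" "(THE j. closed_at i \<tau> j) = j" using closed_wordsE t(1) by blast
    have len: "\<tau> \<in> closed_words V i" "length \<tau> = Suc d" using t(1) by auto
    have le: "count_list \<tau> i \<le> count_list \<tau>' i" if "Suc d - count_list \<tau>' i \<le> Suc d - count_list \<tau> i" for \<tau>'
      using that count_le_length[of \<tau> i] len(2) by linarith
    show "ocomp \<tau> \<theta> \<notin> horn_stage V i d l \<and> (\<forall>\<tau>'\<in>?B. \<tau>' \<noteq> \<tau> \<longrightarrow>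
        Suc d - count_list \<tau>' i \<le> Suc d - count_list \<tau> i \<longrightarrow> ocomp \<tau> \<theta> \<notin> cell \<tau>' l)"
      using free_face_new[OF len j(1) V(3), of \<theta> l] t(2,3) j(2) len(2) le by auto
  next
    fix \<tau> l \<theta> \<theta>' assume t: "\<tau> \<in> ?B" "\<theta> \<in> mono_maps l (length \<tau> - 1)" "\<theta> \<notin> ?Q \<tau> l"
      "\<theta>' \<in> mono_maps l (length \<tau> - 1)" "\<theta>' \<notin> ?Q \<tau> l" "ocomp \<tau> \<theta> = ocomp \<tau> \<theta>'"
    obtain j where j: "closed_at i \<tau> j" "(THE j. closed_at i \<tau> j) = j" using closed_wordsE t(1) by blast
    have len: "length \<tau> = Suc d" "distinct_adj \<tau>" using t(1) closed_wordsD(2) by auto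
    have "{0..d} - {j} \<subseteq> set \<theta>" "{0..d} - {j} \<subseteq> set \<theta>'"
      using t(2-5) j(2) len(1) unfolding horn_def by auto
    then show "\<theta> = \<theta>'"
      using degeneracy_unique[OF len(2,1), of "{j}" \<theta> l \<theta>'] t(2,4,6) len(1) closed_at_bounds[OF j(1)] by auto
  qed (fact K T(1) subcomplex_horn_stage)+
  moreover have "horn_stage V i d l \<union> (\<Union>\<tau>\<in>?B. cell \<tau> l) = horn_stage V i (Suc d) l" for l
    unfolding horn_stage_def by (auto simp: le_Suc_eq)
  ultimately show ?thesis by simp
qed

lemma extends_horn:
  assumes K: "stable_class C K" and V: "finite V" "3 \<le> card V" "i \<in> V"
    and T: "subcomplex T" "\<And>l. thick {V} l \<subseteq> T l"
    and cov: "\<And>m j. 0 < j \<Longrightarrow> j < m \<Longrightarrow> card V \<le> Suc m \<Longrightarrow>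
      rel_cover C K Xo Xa Yo Ya f (horn m j) (std_simplex m) (Xo m) (Xa m)"
    and iso: "\<And>m j. 0 < j \<Longrightarrow> j < m \<Longrightarrow> k < m \<Longrightarrow>
      rel_cover C {u. is_iso C u} Xo Xa Yo Ya f (horn m j) (std_simplex m) (Xo m) (Xa m)"
  shows "extends K T (thick (facets V (V - {i}))) (thick {V})"
proof -
  have "extends K T (horn_stage V i 0) (\<lambda>l. \<Union>d. horn_stage V i d l)"
  \<comment> \<open>The step from stage \<open>d\<close> attaches cells of dimension
    \<open>d\<close>, and inner horn maps are isomorphisms from dimension \<open>Suc k\<close>
    on.\<close>
  proof (rule extends_chain[where N = "Suc k"])
    show "horn_stage V i d l \<subseteq> T l" for d l using horn_stage_subset T(2) by blast
    show "horn_stage V i d l \<subseteq> horn_stage V i (Suc d) l" for d l by (rule horn_stage_mono) simp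
    show "extends K T (horn_stage V i d) (horn_stage V i (Suc d))" for d
      using cov by (intro extends_horn_stage[OF K V T]) auto
    show "extends {u. is_iso C u} T (horn_stage V i d) (horn_stage V i (Suc d))" if "Suc k \<le> d" for d
      using iso that by (intro extends_horn_stage[OF X.stable_class_isos V T]) auto
  qed (fact K T(1) subcomplex_horn_stage)+
  moreover have "horn_stage V i 0 = thick (facets V (V - {i}))"
    using closed_wordsD(3) unfolding horn_stage_def by fastforce
  moreover have "(\<Union>d. horn_stage V i d l) = thick {V} l" for l
  proof
    show "(\<Union>d. horn_stage V i d l) \<subseteq> thick {V} l" using horn_stage_subset by blast
    show "thick {V} l \<subseteq> (\<Union>d. horn_stage V i d l)"
      using word_in_horn_stage[OF _ _ V(3,2)] by (auto simp: thick_singleton)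
  qed
  ultimately show ?thesis by simp
qed

end

section \<open>The thick simplex built from its boundary\<close>

definition bdry_stage :: "nat set \<Rightarrow> nat \<Rightarrow> nat \<Rightarrow> nat list set" where
  "bdry_stage V d l = thick (facets V V) l \<union>
     (\<Union>\<tau>\<in>{\<tau>. distinct_adj \<tau> \<and> set \<tau> = V \<and> length \<tau> \<le> d}. cell \<tau> l)"

lemma subcomplex_bdry_stage: "subcomplex (bdry_stage V d)"
  unfolding bdry_stage_def by (intro subcomplex_Un subcomplex_UN subcomplex_thick subcomplex_generated)

lemma bdry_stage_subset:
  assumes "V \<noteq> {}"
  shows "bdry_stage V d l \<subseteq> thick {V} l"
proof
  fix w assume "w \<in> bdry_stage V d l"
  then consider "w \<in> thick (facets V V) l" | \<tau> where "set \<tau> = V" "w \<in> cell \<tau> l"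
    unfolding bdry_stage_def by blast
  then show "w \<in> thick {V} l"
  proof cases
    case 1
    then show ?thesis by (simp add: thick_facets thick_singleton)
  next
    case 2
    then have "length \<tau> = Suc (length \<tau> - 1)" using assms by (cases \<tau>) auto
    then show ?thesis
      using set_generated[OF 2(2)] length_generated[OF 2(2)] 2(1) by (simp add: thick_singleton)
  qed
qed

lemma word_in_bdry_stage:
  assumes "length w = Suc l" "set w \<subseteq> V"
  shows "w \<in> bdry_stage V (length (remdups_adj w)) l"
proof (cases "set w = V")
  case True
  then show ?thesis using remdups_adj_generates[OF assms(1)] unfolding bdry_stage_def by force
next
  case False
  then show ?thesis using assms by (auto simp: bdry_stage_def thick_facets)
qed

lemma bdry_stage_mono: "d \<le> d' \<Longrightarrow> bdry_stage V d l \<subseteq> bdry_stage V d' l"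
  unfolding bdry_stage_def by force

context simplicial_morphism
begin

text \<open>Nondegenerate words with all letters are attached along their full boundary, whose faces
  reduce to words of length at most \<open>d\<close>. Nothing has to be ordered within a stage,
  hence the constant rank.\<close>

lemma extends_bdry_stage:
  assumes K: "stable_class C K" and V: "finite V" "V \<noteq> {}"
    and T: "subcomplex T" "\<And>l. thick {V} l \<subseteq> T l"
    and cov: "rel_cover C K Xo Xa Yo Ya f (bdry_simplex d) (std_simplex d) (Xo d) (Xa d)"
  shows "extends K T (bdry_stage V d) (bdry_stage V (Suc d))"
proof -
  let ?B = "{\<tau>. distinct_adj \<tau> \<and> set \<tau> = V \<and> length \<tau> = Suc d}"
  let ?Q = "\<lambda>\<tau>::nat list. bdry_simplex (length \<tau> - 1)"
  have "extends K T (bdry_stage V d) (\<lambda>l. bdry_stage V d l \<union> (\<Union>\<tau>\<in>?B. cell \<tau> l))"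
  proof (rule extends_attach_finite[where Q = ?Q and r = "\<lambda>\<tau>. 0"])
    show "finite ?B"
      by (rule finite_subset[OF _ finite_words[OF V(1), of "Suc d"]]) auto
    show "bdry_stage V d l \<subseteq> T l" for l using bdry_stage_subset[OF V(2)] T(2) by blast
    show "\<tau> \<in> T (length \<tau> - 1)" if "\<tau> \<in> ?B" for \<tau>
      using that T(2)[of d] by (auto simp: thick_singleton)
    show "?Q \<tau> l \<subseteq> mono_maps l (length \<tau> - 1)" for \<tau> l by (auto simp: bdry_simplex_def)
    show "rel_cover C K Xo Xa Yo Ya f (?Q \<tau>) (std_simplex m) (Xo m) (Xa m)"
      if "\<tau> \<in> ?B" "m = length \<tau> - 1" for \<tau> m
      using that cov by simp
  next
    fix \<tau> l \<theta> assume t: "\<tau> \<in> ?B" "\<theta> \<in> ?Q \<tau> l"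
    then have \<theta>: "\<theta> \<in> mono_maps l d" "set \<theta> \<noteq> {0..d}" and len: "length \<tau> = Suc d"
      by (auto simp: bdry_simplex_def)
    have "set \<theta> \<subseteq> {0..d}" using mono_mapsD(2)[OF \<theta>(1)] by (auto simp: less_Suc_eq_le)
    then obtain r where r: "r \<le> d" "r \<notin> set \<theta>" using \<theta>(2) by (meson atLeastAtMost_iff subsetI subset_antisym)
    have d: "0 < d" and gen: "ocomp \<tau> \<theta> \<in> generated (d - 1) (del r \<tau>) l"
      using mono_maps_factor_del[OF \<theta>(1) r len] by auto
    have lv: "length (del r \<tau>) = Suc (d - 1)" using r(1) len d by simp
    have "set (del r \<tau>) \<subseteq> V" using set_del(1)[of r \<tau>] r(1) t(1) by auto
    then have "del r \<tau> \<in> bdry_stage V (length (remdups_adj (del r \<tau>))) (d - 1)"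
      by (rule word_in_bdry_stage[OF lv])
    moreover have "length (remdups_adj (del r \<tau>)) \<le> d"
      using remdups_adj_length[of "del r \<tau>"] lv d by linarith
    ultimately have "del r \<tau> \<in> bdry_stage V d (d - 1)" using bdry_stage_mono by blast
    then have "ocomp \<tau> \<theta> \<in> bdry_stage V d l"
      using generated_subset[OF subcomplex_bdry_stage] gen by blast
    then show "ocomp \<tau> \<theta> \<in> bdry_stage V d l \<or> (\<exists>\<tau>'\<in>?B. (0::nat) < 0 \<and> ocomp \<tau> \<theta> \<in> cell \<tau>' l)" ..
  next
    fix \<tau> l \<theta> assume t: "\<tau> \<in> ?B" "\<theta> \<in> mono_maps l (length \<tau> - 1)" "\<theta> \<notin> ?Q \<tau> l"
    then have \<theta>: "\<theta> \<in> mono_maps l d" "set \<theta> = {0..d}" and len: "length \<tau> = Suc d" "distinct_adj \<tau>" "set \<tau> = V"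
      by (auto simp: bdry_simplex_def)
    have "set [0..<Suc d] \<subseteq> set \<theta>" unfolding \<theta>(2) by auto
    from mono_maps_section[OF \<theta>(1) id_mono this] obtain \<psi> where
      \<psi>: "\<psi> \<in> mono_maps d l" "ocomp \<theta> \<psi> = [0..<Suc d]" by blast
    have "ocomp (ocomp \<tau> \<theta>) \<psi> = \<tau>"
      using ocomp_assoc[OF mono_all[OF \<theta>(1)] mono_all[OF \<psi>(1)], of \<tau>] \<psi>(2) ocomp_id[OF len(1)] by simp
    then have into: "\<tau> \<in> S d" if "subcomplex S" "ocomp \<tau> \<theta> \<in> S l" for S
      using subcomplexD(2)[OF that \<psi>(1)] by simp
    \<comment> \<open>A nondegenerate simplex in a cell of no larger dimension is the generator of
      that cell.\<close>
    have new: "\<tau>' = \<tau>" if "length \<tau>' \<le> Suc d" "\<tau>' \<noteq> []" "ocomp \<tau> \<theta> \<in> cell \<tau>' l" for \<tau>'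
    proof -
      have "\<tau> \<in> cell \<tau>' d" using into[OF subcomplex_generated that(3)] .
      then obtain \<phi> where \<phi>: "\<phi> \<in> mono_maps d (length \<tau>' - 1)" "\<tau> = ocomp \<tau>' \<phi>"
        unfolding generated_def by blast
      have "distinct \<phi>" "d \<le> length \<tau>' - 1"
        using mono_maps_strict[OF \<phi>(1)] \<phi>(2) len(2) by auto
      then have l': "length \<tau>' = Suc d" and "\<phi> = [0..<Suc d]"
        using that(1,2) mono_maps_distinct_id[of \<phi> d] \<phi>(1) by (cases \<tau>'; force)+
      then show ?thesis using \<phi>(2) ocomp_id[OF l'] by simp
    qed
    have "\<tau> \<notin> thick (facets V V) d" using len(3) by (simp add: thick_facets)
    then have "ocomp \<tau> \<theta> \<notin> thick (facets V V) l" using into[OF subcomplex_thick] by blast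
    moreover have "ocomp \<tau> \<theta> \<notin> cell \<tau>' l" if "set \<tau>' = V" "length \<tau>' \<le> d" for \<tau>'
      using new[of \<tau>'] that len(1) V(2) by fastforce
    ultimately have "ocomp \<tau> \<theta> \<notin> bdry_stage V d l"
      unfolding bdry_stage_def by blast
    moreover have "ocomp \<tau> \<theta> \<notin> cell \<tau>' l" if "\<tau>' \<in> ?B" "\<tau>' \<noteq> \<tau>" for \<tau>'
      using new[of \<tau>'] that by fastforce
    ultimately show "ocomp \<tau> \<theta> \<notin> bdry_stage V d l \<and> (\<forall>\<tau>'\<in>?B. \<tau>' \<noteq> \<tau> \<longrightarrow>
        (0::nat) \<le> 0 \<longrightarrow> ocomp \<tau> \<theta> \<notin> cell \<tau>' l)"
      by blast
  next
    fix \<tau> l \<theta> \<theta>' assume t: "\<tau> \<in> ?B" "\<theta> \<in> mono_maps l (length \<tau> - 1)" "\<theta> \<notin> ?Q \<tau> l"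
      "\<theta>' \<in> mono_maps l (length \<tau> - 1)" "\<theta>' \<notin> ?Q \<tau> l" "ocomp \<tau> \<theta> = ocomp \<tau> \<theta>'"
    then have "set \<theta> = {0..d}" "set \<theta>' = {0..d}" by (auto simp: bdry_simplex_def)
    then show "\<theta> = \<theta>'" using degeneracy_unique[of \<tau> d "{}" \<theta> l \<theta>'] t by auto
  qed (fact K T(1) subcomplex_bdry_stage)+
  moreover have "bdry_stage V d l \<union> (\<Union>\<tau>\<in>?B. cell \<tau> l) = bdry_stage V (Suc d) l" for l
    unfolding bdry_stage_def by (auto simp: le_Suc_eq)
  ultimately show ?thesis by simp
qed

lemma extends_bdry:
  assumes K: "stable_class C K" and V: "finite V" "V \<noteq> {}"
    and T: "subcomplex T" "\<And>l. thick {V} l \<subseteq> T l"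
    and cov: "\<And>m. rel_cover C K Xo Xa Yo Ya f (bdry_simplex m) (std_simplex m) (Xo m) (Xa m)"
    and iso: "\<And>m. N \<le> m \<Longrightarrow>
      rel_cover C {u. is_iso C u} Xo Xa Yo Ya f (bdry_simplex m) (std_simplex m) (Xo m) (Xa m)"
  shows "extends K T (thick (facets V V)) (thick {V})"
proof -
  have "extends K T (bdry_stage V 0) (\<lambda>l. \<Union>d. bdry_stage V d l)"
  proof (rule extends_chain[where N = N])
    show "bdry_stage V d l \<subseteq> T l" for d l using bdry_stage_subset[OF V(2)] T(2) by blast
    show "bdry_stage V d l \<subseteq> bdry_stage V (Suc d) l" for d l by (rule bdry_stage_mono) simp
    show "extends K T (bdry_stage V d) (bdry_stage V (Suc d))" for d
      by (rule extends_bdry_stage[OF K V T cov])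
    show "extends {u. is_iso C u} T (bdry_stage V d) (bdry_stage V (Suc d))" if "N \<le> d" for d
      by (rule extends_bdry_stage[OF X.stable_class_isos V T iso[OF that]])
  qed (fact K T(1) subcomplex_bdry_stage)+
  moreover have "bdry_stage V 0 = thick (facets V V)"
    using V(2) unfolding bdry_stage_def by fastforce
  moreover have "(\<Union>d. bdry_stage V d l) = thick {V} l" for l
  proof
    show "(\<Union>d. bdry_stage V d l) \<subseteq> thick {V} l" using bdry_stage_subset[OF V(2)] by blast
    show "thick {V} l \<subseteq> (\<Union>d. bdry_stage V d l)"
      using word_in_bdry_stage by (auto simp: thick_singleton)
  qed
  ultimately show ?thesis by simp
qed

text \<open>Renaming vertices acts on letters and simplicial operators act on positions, so the two
  commute, and a bijective renaming of the pair transports the universal property. This reduces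
  thick simplices on arbitrary one or two vertices to standard ones.\<close>

lemma rmap_relabel:
  assumes M: "rmap S T L p q"
    and sub: "subcomplex S" "subcomplex T" "subcomplex S'" "subcomplex T'"
    and \<phi>: "\<And>l w. w \<in> S' l \<Longrightarrow> map \<phi> w \<in> S l" "\<And>l w. w \<in> T' l \<Longrightarrow> map \<phi> w \<in> T l"
    and \<psi>: "\<And>l w. w \<in> S l \<Longrightarrow> map \<psi> w \<in> S' l" "\<And>l w. w \<in> T l \<Longrightarrow> map \<psi> w \<in> T' l"
    and \<phi>\<psi>: "\<And>l w. w \<in> S l \<union> T l \<Longrightarrow> map \<phi> (map \<psi> w) = w" "\<And>l w. w \<in> S' l \<union> T' l \<Longrightarrow> map \<psi> (map \<phi> w) = w"
  shows "rmap S' T' L (\<lambda>l w. p l (map \<phi> w)) (\<lambda>l w. q l (map \<phi> w))"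
proof -
  have map_ocomp: "ocomp (map g w) \<theta> = map g (ocomp w \<theta>)" if "length w = Suc m" "\<theta> \<in> mono_maps l m" for g w \<theta> m l
    using that mono_mapsD[OF that(2)] by (auto simp: ocomp_def)
  have cone: "ss_cone C Zo Za B L (\<lambda>l w. p l (map g w))"
    if "ss_cone C Zo Za A L p" "subcomplex B" "\<And>l w. w \<in> B l \<Longrightarrow> map g w \<in> A l" for Zo Za A B L p g
    unfolding ss_cone_def
  proof (intro conjI allI ballI impI)
    show "Za m l \<theta> \<cdot> p m (map g \<sigma>) = p l (map g (ocomp \<sigma> \<theta>))"
      if "\<sigma> \<in> B m" "\<theta> \<in> mono_maps l m" for m l \<sigma> \<theta>
      using ss_coneD(3)[OF \<open>ss_cone C Zo Za A L p\<close>, of "map g \<sigma>" m \<theta> l] that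
        \<open>\<And>l w. w \<in> B l \<Longrightarrow> map g w \<in> A l\<close> subcomplexD(1)[OF \<open>subcomplex B\<close>] map_ocomp by metis
  qed (use that ss_coneD(1,2)[OF that(1)] in blast)+
  have rc: "rcone S' T' L (\<lambda>l w. p l (map \<phi> w)) (\<lambda>l w. q l (map \<phi> w))"
    unfolding rel_cone_def
    using cone[OF rel_coneD(1)[OF rmap_cone[OF M]] sub(3) \<phi>(1)]
      cone[OF rel_coneD(2)[OF rmap_cone[OF M]] sub(4) \<phi>(2)] rel_coneD(3)[OF rmap_cone[OF M] \<phi>(1)]
    by blast
  show ?thesis
  proof (rule rmapI[OF rc])
    fix L' p' q' assume N: "rcone S' T' L' p' q'"
    have "rcone S T L' (\<lambda>l w. p' l (map \<psi> w)) (\<lambda>l w. q' l (map \<psi> w))"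
      unfolding rel_cone_def
      using cone[OF rel_coneD(1)[OF N] sub(1) \<psi>(1)] cone[OF rel_coneD(2)[OF N] sub(2) \<psi>(2)]
        rel_coneD(3)[OF N \<psi>(1)] by blast
    from rmap_lift[OF M this] obtain u where u: "u \<in> hom C L' L"
      "\<And>l w. w \<in> S l \<Longrightarrow> p l w \<cdot> u = p' l (map \<psi> w)" "\<And>l w. w \<in> T l \<Longrightarrow> q l w \<cdot> u = q' l (map \<psi> w)"
      by blast
    have "p l (map \<phi> w) \<cdot> u = p' l w" if "w \<in> S' l" for l w
      using u(2)[OF \<phi>(1)[OF that]] \<phi>\<psi>(2) that by (metis UnI1)
    moreover have "q l (map \<phi> w) \<cdot> u = q' l w" if "w \<in> T' l" for l w
      using u(3)[OF \<phi>(2)[OF that]] \<phi>\<psi>(2) that by (metis UnI2)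
    ultimately show "\<exists>u. u \<in> hom C L' L \<and> (\<forall>m. \<forall>\<sigma>\<in>S' m. p m (map \<phi> \<sigma>) \<cdot> u = p' m \<sigma>) \<and>
        (\<forall>m. \<forall>\<sigma>\<in>T' m. q m (map \<phi> \<sigma>) \<cdot> u = q' m \<sigma>)" using u(1) by blast
  next
    fix L' u v assume u: "u \<in> hom C L' L" "v \<in> hom C L' L"
      and eq: "\<forall>m. \<forall>\<sigma>\<in>S' m. p m (map \<phi> \<sigma>) \<cdot> u = p m (map \<phi> \<sigma>) \<cdot> v"
        "\<forall>m. \<forall>\<sigma>\<in>T' m. q m (map \<phi> \<sigma>) \<cdot> u = q m (map \<phi> \<sigma>) \<cdot> v"
    show "u = v"
    proof (rule rmap_eqI[OF M u])
      show "p m \<sigma> \<cdot> u = p m \<sigma> \<cdot> v" if "\<sigma> \<in> S m" for m \<sigma>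
        using eq(1) \<psi>(1)[OF that] \<phi>\<psi>(1)[of \<sigma> m] that by (metis UnI1)
      show "q m \<sigma> \<cdot> u = q m \<sigma> \<cdot> v" if "\<sigma> \<in> T m" for m \<sigma>
        using eq(2) \<psi>(2)[OF that] \<phi>\<psi>(1)[of \<sigma> m] that by (metis UnI2)
    qed
  qed
qed

lemma rel_coverI:
  assumes "rmap S T L p q" "u \<in> hom C A L" "u \<in> K"
    and "\<And>m \<sigma>. \<sigma> \<in> S m \<Longrightarrow> p m \<sigma> \<cdot> u = a m \<sigma>"
    and "\<And>m \<tau>. \<tau> \<in> T m \<Longrightarrow> q m \<tau> \<cdot> u = f m \<cdot> a m \<tau>"
  shows "rel_cover C K Xo Xa Yo Ya f S T A a"
  unfolding rel_cover_def using assms by blast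

text \<open>The X part of a relative cone comes from a unique map into \<open>Xo m\<close>. The Y
  part is given by its value at the top simplex, hence by its restriction to \<open>P\<close>, where
  it is the image of the X part. So \<open>Xo m\<close> itself is the relative mapping object and
  the canonical map can be taken to be the identity.\<close>

lemma rel_cover_iso_of_Map:
  assumes Q: "\<And>l. Q l \<subseteq> mono_maps l m" "\<And>l. P l \<subseteq> Q l"
    and MX: "is_Map C Xo Xa Q (Xo m) (Xa m)" and MY: "is_Map C Yo Ya P (Yo m) (Ya m)"
  shows "rel_cover C {u. is_iso C u} Xo Xa Yo Ya f Q (std_simplex m) (Xo m) (Xa m)"
proof -
  have fX: "f l \<cdot> Xa m l \<theta> \<cdot> b = Ya m l \<theta> \<cdot> f m \<cdot> b" if "\<theta> \<in> mono_maps l m" "b \<in> hom C L (Xo m)" for l \<theta> b L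
    using X.comp_assoc_hom[OF that(2) X.Xa_hom[OF that(1)] f_hom] f_natural[OF that(1)]
      X.comp_assoc_hom[OF that(2) f_hom Y.Xa_hom[OF that(1)]] by simp
  have fX': "(f l \<cdot> Xa m l \<theta>) \<cdot> b = Ya m l \<theta> \<cdot> f m \<cdot> b" if "\<theta> \<in> mono_maps l m" "b \<in> hom C L (Xo m)" for l \<theta> b L
    using X.comp_assoc_hom[OF that(2) X.Xa_hom[OF that(1)] f_hom] fX[OF that] by simp
  have id: "idt C (Xo m) \<in> hom C (Xo m) (Xo m)" using X.idt_hom[OF X.Xo_obj] .
  have "rmap Q (std_simplex m) (Xo m) (Xa m) (\<lambda>l \<theta>. f l \<cdot> Xa m l \<theta>)"
  proof (rule rmapI)
    have "ss_cone C Xo Xa (std_simplex m) (Xo m) (Xa m)"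
      unfolding ss_cone_def std_simplex_def using X.Xo_obj X.Xa_hom X.Xa_comp by blast
    then show "rcone Q (std_simplex m) (Xo m) (Xa m) (\<lambda>l \<theta>. f l \<cdot> Xa m l \<theta>)"
      using X.Map_cone[OF MX] f_cone unfolding rel_cone_def by blast
  next
    fix L' p' q' assume N: "rcone Q (std_simplex m) L' p' q'"
    obtain b where b: "b \<in> hom C L' (Xo m)" "\<And>l \<theta>. \<theta> \<in> Q l \<Longrightarrow> Xa m l \<theta> \<cdot> b = p' l \<theta>"
      using X.Map_lift[OF MX rel_coneD(1)[OF N]] by blast
    let ?e = "[0..<Suc m]"
    have e: "?e \<in> std_simplex m m" unfolding std_simplex_def by (rule id_mono)
    have q': "Ya m l \<theta> \<cdot> q' m ?e = q' l \<theta>" if "\<theta> \<in> mono_maps l m" for l \<theta>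
      using ss_coneD(3)[OF rel_coneD(2)[OF N] e that] id_ocomp[OF mono_all[OF that]] by simp
    have "f m \<cdot> b = q' m ?e"
    proof (rule Y.Map_eqI[OF MY X.comp_hom[OF b(1) f_hom] ss_coneD(2)[OF rel_coneD(2)[OF N] e]])
      fix l \<theta> assume "\<theta> \<in> P l"
      then have t: "\<theta> \<in> Q l" "\<theta> \<in> mono_maps l m" using Q by blast+
      show "Ya m l \<theta> \<cdot> f m \<cdot> b = Ya m l \<theta> \<cdot> q' m ?e"
        using fX[OF t(2) b(1)] b(2)[OF t(1)] rel_coneD(3)[OF N t(1)] q'[OF t(2)] by simp
    qed
    then have "(f l \<cdot> Xa m l \<theta>) \<cdot> b = q' l \<theta>" if "\<theta> \<in> std_simplex m l" for l \<theta>
      using fX'[OF _ b(1)] q' that by (simp add: std_simplex_def)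
    then show "\<exists>u. u \<in> hom C L' (Xo m) \<and> (\<forall>l. \<forall>\<sigma>\<in>Q l. Xa m l \<sigma> \<cdot> u = p' l \<sigma>) \<and>
        (\<forall>l. \<forall>\<sigma>\<in>std_simplex m l. (f l \<cdot> Xa m l \<sigma>) \<cdot> u = q' l \<sigma>)"
      using b by blast
  next
    fix L' u v assume u: "u \<in> hom C L' (Xo m)" "v \<in> hom C L' (Xo m)"
      and "\<forall>l. \<forall>\<sigma>\<in>Q l. Xa m l \<sigma> \<cdot> u = Xa m l \<sigma> \<cdot> v"
    then show "u = v" by (intro X.Map_eqI[OF MX u]) blast
  qed
  then show ?thesis
  proof (rule rel_coverI[OF _ id])
    show "idt C (Xo m) \<in> {u. is_iso C u}" using X.is_iso_idt[OF X.Xo_obj] by simp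
    show "Xa m l \<theta> \<cdot> idt C (Xo m) = Xa m l \<theta>" if "\<theta> \<in> Q l" for l \<theta>
      using X.Xa_hom[of \<theta> l m] Q(1)[of l] that by (auto simp: in_hom_iff)
    show "(f l \<cdot> Xa m l \<theta>) \<cdot> idt C (Xo m) = f l \<cdot> Xa m l \<theta>" if "\<theta> \<in> std_simplex m l" for l \<theta>
      using X.comp_hom[OF X.Xa_hom f_hom, of \<theta> l m] that by (simp add: in_hom_iff std_simplex_def)
  qed
qed

end

lemma subcomplex_horn: "subcomplex (horn n i)"
proof -
  have "set (ocomp \<sigma> \<theta>) \<subseteq> set \<sigma>" if "\<sigma> \<in> mono_maps m n" "\<theta> \<in> mono_maps l m" for \<sigma> \<theta> m l
    using set_ocomp_subset[OF mono_mapsD(1)[OF that(1)] mono_all[OF that(2)]] .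
  then show ?thesis
    unfolding subcomplex_def horn_def using mono_mapsD(1) ocomp_mono by (simp, blast)
qed

lemma horn_subset_bdry: "horn n i l \<subseteq> bdry_simplex n l"
  unfolding horn_def bdry_simplex_def by auto

lemma restr_iso_eq: "restr_iso C Xo Xa n T \<longleftrightarrow> restr_cover C {u. is_iso C u} Xo Xa n T"
  by (simp add: restr_iso_def restr_cover_def)

context simplicial_object
begin

lemma Map_of_restr_iso:
  assumes "restr_iso C Xo Xa n T" "subcomplex T"
  shows "is_Map C Xo Xa T (Xo n) (Xa n)"
proof -
  obtain L p u where u: "is_Map C Xo Xa T L p" "u \<in> hom C (Xo n) L"
      "\<forall>m. \<forall>\<sigma>\<in>T m. p m \<sigma> \<cdot> u = Xa n m \<sigma>" "is_iso C u"
    using assms(1) unfolding restr_iso_def by blast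
  show ?thesis using u(3) by (intro Map_transport[OF u(1,2,4) assms(2)]) blast
qed

text \<open>Only the face opposite to the vertex 1 is not contained in the horn, and it is determined
  by its own horn.\<close>

lemma Map_bdry_of_horn:
  assumes m: "3 \<le> m" and M: "is_Map C Xo Xa (horn m 1) (Xo m) (Xa m)"
    and M': "is_Map C Xo Xa (horn (m - 1) 1) (Xo (m - 1)) (Xa (m - 1))"
  shows "is_Map C Xo Xa (bdry_simplex m) (Xo m) (Xa m)"
proof (rule is_MapI)
  show "ss_cone C Xo Xa (bdry_simplex m) (Xo m) (Xa m)"
    unfolding ss_cone_def bdry_simplex_def using Xo_obj Xa_hom Xa_comp by blast
next
  fix L' p' assume c: "ss_cone C Xo Xa (bdry_simplex m) L' p'"
  obtain b where b: "b \<in> hom C L' (Xo m)" "\<And>l \<theta>. \<theta> \<in> horn m 1 l \<Longrightarrow> Xa m l \<theta> \<cdot> b = p' l \<theta>"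
    using Map_lift[OF M ss_cone_subset[OF c horn_subset_bdry]] by blast
  let ?d = "del 1 [0..<Suc m]"
  have d: "?d \<in> mono_maps (m - 1) m" "set ?d = {0..<Suc m} - {1}"
    using del_upt_mono[of 1 m] set_del_upt[of 1 m] m by (simp_all del: upt_Suc)
  have "1 \<notin> set ?d" "1 \<in> {0..m}" using d(2) m by auto
  then have "set ?d \<noteq> {0..m}" by metis
  then have db: "?d \<in> bdry_simplex m (m - 1)"
    using d(1) by (simp only: bdry_simplex_def mem_Collect_eq simp_thms)
  have dcomp: "Xa (m - 1) l \<phi> \<cdot> Xa m (m - 1) ?d \<cdot> b = Xa m l (ocomp ?d \<phi>) \<cdot> b"
    if "\<phi> \<in> mono_maps l (m - 1)" for l \<phi>
    using comp_assoc_hom[OF b(1) Xa_hom[OF d(1)] Xa_hom[OF that]] Xa_comp[OF d(1) that] by simp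
  \<comment> \<open>Both sides are compared on the horn at 1 of the face \<open>?d\<close>: its
    simplices omit a further vertex of the big simplex besides 1, so they lie in the big horn, where
    agreement is known.\<close>
  have face: "Xa m (m - 1) ?d \<cdot> b = p' (m - 1) ?d"
  proof (rule Map_eqI[OF M' comp_hom[OF b(1) Xa_hom[OF d(1)]] ss_coneD(2)[OF c db]])
    fix l \<phi> assume \<phi>: "\<phi> \<in> horn (m - 1) 1 l"
    then obtain r where r: "r \<le> m - 1" "r \<noteq> 1" "r \<notin> set \<phi>" and \<phi>m: "\<phi> \<in> mono_maps l (m - 1)"
      by (auto simp: horn_def)
    have nd: "?d ! t = (if t < 1 then t else Suc t)" if "t \<le> m - 1" for t
      using nth_del[of 1 "[0..<Suc m]" t] that m by (auto simp del: upt_Suc)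
    have "?d ! t \<noteq> ?d ! r" if "t \<in> set \<phi>" for t
    proof -
      have "t \<le> m - 1" "t \<noteq> r" using mono_mapsD(2)[OF \<phi>m that] that r(3) by auto
      then show ?thesis using nd[of t] nd[of r] r(1) by simp
    qed
    then have "?d ! r \<notin> set (ocomp ?d \<phi>)" unfolding set_ocomp by (metis imageE)
    moreover have "?d ! r \<noteq> 1" "?d ! r \<le> m" using nd[of r] r m by (auto split: if_splits)
    ultimately have "ocomp ?d \<phi> \<in> horn m 1 l" using ocomp_mono[OF d(1) \<phi>m] unfolding horn_def by blast
    then show "Xa (m - 1) l \<phi> \<cdot> Xa m (m - 1) ?d \<cdot> b = Xa (m - 1) l \<phi> \<cdot> p' (m - 1) ?d"
      using dcomp[OF \<phi>m] b(2) ss_coneD(3)[OF c db \<phi>m] by simp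
  qed
  have "Xa m l \<theta> \<cdot> b = p' l \<theta>" if t: "\<theta> \<in> bdry_simplex m l" for l \<theta>
  proof (cases "\<theta> \<in> horn m 1 l")
    case True
    then show ?thesis by (rule b(2))
  next
    case False
    have \<theta>: "\<theta> \<in> mono_maps l m" "set \<theta> \<noteq> {0..m}" using t by (auto simp: bdry_simplex_def)
    have "{0..m} - {1} \<subseteq> set \<theta>" using False \<theta>(1) by (auto simp: horn_def)
    moreover have "set \<theta> \<subseteq> {0..m}" using mono_mapsD(2)[OF \<theta>(1)] by (auto simp: less_Suc_eq_le)
    ultimately have "set \<theta> \<subseteq> set ?d" using \<theta>(2) d(2) by (auto simp: less_Suc_eq_le)
    then obtain \<psi> where \<psi>: "\<psi> \<in> mono_maps l (m - 1)" "ocomp ?d \<psi> = \<theta>"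
      using mono_maps_section[OF d(1) \<theta>(1)] by blast
    show ?thesis using dcomp[OF \<psi>(1)] face ss_coneD(3)[OF c db \<psi>(1)] \<psi>(2) by simp
  qed
  then show "\<exists>u. u \<in> hom C L' (Xo m) \<and> cone_agree (bdry_simplex m) (\<lambda>l \<sigma>. Xa m l \<sigma> \<cdot> u) p'"
    using b(1) unfolding cone_agree_def by blast
next
  fix L' u v assume u: "u \<in> hom C L' (Xo m)" "v \<in> hom C L' (Xo m)"
    and eq: "cone_agree (bdry_simplex m) (\<lambda>l \<sigma>. Xa m l \<sigma> \<cdot> u) (\<lambda>l \<sigma>. Xa m l \<sigma> \<cdot> v)"
  show "u = v"
  proof (rule Map_eqI[OF M u])
    show "Xa m l \<theta> \<cdot> u = Xa m l \<theta> \<cdot> v" if "\<theta> \<in> horn m 1 l" for l \<theta>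
      using cone_agreeD[OF eq subsetD[OF horn_subset_bdry that]] .
  qed
qed

end

section \<open>Simplicial objects over a point\<close>

lemma thick_simplex_eq: "thick_simplex n = thick {{0..n}}"
  by (auto simp: fun_eq_iff thick_simplex_def all_maps_def thick_singleton)

lemma thick_Un: "thick (insert V F) l = thick {V} l \<union> thick F l"
  by (auto simp: thick_def)

lemma thick_Int: "thick {V} l \<inter> thick F l = thick ((\<lambda>W. V \<inter> W) ` F) l"
  by (auto simp: thick_def)

lemma thick_absorb: "W \<in> F \<Longrightarrow> V \<subseteq> W \<Longrightarrow> thick (insert V F) = thick F"
  by (auto simp: fun_eq_iff thick_def)

text \<open>The Yoneda lemma: a cone over the standard simplex is given by its value at the identity
  \<open>[0..<Suc m]\<close>.\<close>

lemma (in simplicial_object) Map_std: "is_Map C Xo Xa (std_simplex m) (Xo m) (Xa m)"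
proof (rule is_MapI)
  show "ss_cone C Xo Xa (std_simplex m) (Xo m) (Xa m)"
    unfolding ss_cone_def std_simplex_def using Xo_obj Xa_hom Xa_comp by blast
next
  fix L' p' assume c: "ss_cone C Xo Xa (std_simplex m) L' p'"
  let ?e = "[0..<Suc m]"
  have e: "?e \<in> std_simplex m m" unfolding std_simplex_def by (rule id_mono)
  have "Xa m l \<theta> \<cdot> p' m ?e = p' l \<theta>" if "\<theta> \<in> mono_maps l m" for l \<theta>
    using ss_coneD(3)[OF c e that] id_ocomp[OF mono_all[OF that]] by simp
  then show "\<exists>u. u \<in> hom C L' (Xo m) \<and> cone_agree (std_simplex m) (\<lambda>l \<sigma>. Xa m l \<sigma> \<cdot> u) p'"
    using ss_coneD(2)[OF c e] unfolding cone_agree_def std_simplex_def by blast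
next
  fix L' u v assume u: "u \<in> hom C L' (Xo m)" "v \<in> hom C L' (Xo m)"
    and eq: "cone_agree (std_simplex m) (\<lambda>l \<sigma>. Xa m l \<sigma> \<cdot> u) (\<lambda>l \<sigma>. Xa m l \<sigma> \<cdot> v)"
  have "[0..<Suc m] \<in> std_simplex m m" unfolding std_simplex_def by (rule id_mono)
  from cone_agreeD[OF eq this] show "u = v"
    using u unfolding Xa_idt by (simp add: in_hom_iff)
qed

locale simplicial_over_point = simplicial_object C Xo Xa
  for C :: "('o,'a) cat" and Xo Xa +
  fixes t :: 'o and bang :: "'o \<Rightarrow> 'a"
  assumes t_obj: "t \<in> obj C"
    and bang_hom: "x \<in> obj C \<Longrightarrow> bang x \<in> hom C x t"
    and bang_unique: "u \<in> hom C x t \<Longrightarrow> v \<in> hom C x t \<Longrightarrow> u = v"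
begin

sublocale simplicial_morphism C Xo Xa "\<lambda>_. t" "\<lambda>_ _ _. idt C t" "\<lambda>n. bang (Xo n)"
proof
  show "simplicial_obj C (\<lambda>_. t) (\<lambda>_ _ _. idt C t)"
    unfolding simplicial_obj_def using t_obj idt_hom[OF t_obj] by simp
  show "bang (Xo n) \<in> hom C (Xo n) t" for n using bang_hom[OF Xo_obj] .
  show "idt C t \<cdot> bang (Xo n) = bang (Xo m) \<cdot> Xa n m \<theta>" if "\<theta> \<in> mono_maps m n" for n m \<theta>
    using comp_hom[OF bang_hom[OF Xo_obj] idt_hom[OF t_obj]]
      comp_hom[OF Xa_hom[OF that] bang_hom[OF Xo_obj]] by (rule bang_unique)
qed

lemma point_cone: "L \<in> obj C \<Longrightarrow> ss_cone C (\<lambda>_. t) (\<lambda>_ _ _. idt C t) T L (\<lambda>_ _. bang L)"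
  unfolding ss_cone_def using bang_hom[of L] by (simp add: in_hom_iff)

lemma point_cone_unique:
  assumes "ss_cone C (\<lambda>_. t) (\<lambda>_ _ _. idt C t) T L q" "\<sigma> \<in> T m"
  shows "q m \<sigma> = bang L"
  using ss_coneD(2)[OF assms] bang_hom[OF ss_coneD(1)[OF assms(1)]] by (rule bang_unique)

lemma rcone_of_cone:
  assumes "ss_cone C Xo Xa S L p"
  shows "rcone S T L p (\<lambda>_ _. bang L)"
  unfolding rel_cone_def
  using assms point_cone[OF ss_coneD(1)[OF assms]]
    bang_unique[OF comp_hom[OF ss_coneD(2)[OF assms] bang_hom[OF Xo_obj]] bang_hom[OF ss_coneD(1)[OF assms]]]
  by blast

text \<open>Cones into the point are unique, so over the point only the X part of a relative cone
  carries information.\<close>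

lemma rmap_of_Map:
  assumes "is_Map C Xo Xa S L p"
  shows "rmap S T L p (\<lambda>_ _. bang L)"
proof (rule rmapI)
  have L: "L \<in> obj C" using ss_coneD(1)[OF Map_cone[OF assms]] .
  show "rcone S T L p (\<lambda>_ _. bang L)" using rcone_of_cone[OF Map_cone[OF assms]] .
  fix L' p' q' assume N: "rcone S T L' p' q'"
  obtain u where u: "u \<in> hom C L' L" "\<And>m \<sigma>. \<sigma> \<in> S m \<Longrightarrow> p m \<sigma> \<cdot> u = p' m \<sigma>"
    using Map_lift[OF assms rel_coneD(1)[OF N]] by blast
  have "bang L \<cdot> u = q' m \<sigma>" if "\<sigma> \<in> T m" for m \<sigma>
    using comp_hom[OF u(1) bang_hom[OF L]] ss_coneD(2)[OF rel_coneD(2)[OF N] that] by (rule bang_unique)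
  then show "\<exists>u. u \<in> hom C L' L \<and> (\<forall>m. \<forall>\<sigma>\<in>S m. p m \<sigma> \<cdot> u = p' m \<sigma>) \<and>
      (\<forall>m. \<forall>\<sigma>\<in>T m. bang L \<cdot> u = q' m \<sigma>)" using u by blast
next
  fix L' u v assume u: "u \<in> hom C L' L" "v \<in> hom C L' L" "\<forall>m. \<forall>\<sigma>\<in>S m. p m \<sigma> \<cdot> u = p m \<sigma> \<cdot> v"
  then show "u = v" by (intro Map_eqI[OF assms u(1,2)]) blast
qed

lemma Map_of_rmap:
  assumes M: "rmap S T L p q"
  shows "is_Map C Xo Xa S L p"
proof (rule is_MapI)
  show "ss_cone C Xo Xa S L p" using rel_coneD(1)[OF rmap_cone[OF M]] .
  fix L' p' assume "ss_cone C Xo Xa S L' p'"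
  from rmap_lift[OF M rcone_of_cone[OF this]]
  show "\<exists>u. u \<in> hom C L' L \<and> cone_agree S (\<lambda>m \<sigma>. p m \<sigma> \<cdot> u) p'"
    unfolding cone_agree_def by metis
next
  fix L' u v assume u: "u \<in> hom C L' L" "v \<in> hom C L' L"
    and eq: "cone_agree S (\<lambda>m \<sigma>. p m \<sigma> \<cdot> u) (\<lambda>m \<sigma>. p m \<sigma> \<cdot> v)"
  show "u = v"
  proof (rule rmap_eqI[OF M u])
    show "p m \<sigma> \<cdot> u = p m \<sigma> \<cdot> v" if "\<sigma> \<in> S m" for m \<sigma> using cone_agreeD[OF eq that] .
    show "q m \<sigma> \<cdot> u = q m \<sigma> \<cdot> v" if "\<sigma> \<in> T m" for m \<sigma>
      using comp_hom[OF u(1) rmap_hom(2)[OF M that]] comp_hom[OF u(2) rmap_hom(2)[OF M that]]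
      by (rule bang_unique)
  qed
qed

lemma rel_cover_of_Map:
  assumes M: "is_Map C Xo Xa S L p" and u: "u \<in> hom C A L" "u \<in> K"
    and pu: "\<And>m \<sigma>. \<sigma> \<in> S m \<Longrightarrow> p m \<sigma> \<cdot> u = a m \<sigma>"
    and a: "\<And>m \<tau>. \<tau> \<in> T m \<Longrightarrow> a m \<tau> \<in> hom C A (Xo m)"
  shows "rel_cover C K Xo Xa (\<lambda>_. t) (\<lambda>_ _ _. idt C t) (\<lambda>n. bang (Xo n)) S T A a"
proof (rule rel_coverI[OF rmap_of_Map[OF M] u pu])
  show "bang L \<cdot> u = bang (Xo m) \<cdot> a m \<tau>" if "\<tau> \<in> T m" for m \<tau>
    using comp_hom[OF u(1) bang_hom[OF ss_coneD(1)[OF Map_cone[OF M]]]]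
      comp_hom[OF a[OF that] bang_hom[OF Xo_obj]] by (rule bang_unique)
qed

lemma rel_cover_of_restr_cover:
  assumes "restr_cover C K Xo Xa n S"
  shows "rel_cover C K Xo Xa (\<lambda>_. t) (\<lambda>_ _ _. idt C t) (\<lambda>n. bang (Xo n)) S (std_simplex n) (Xo n) (Xa n)"
proof -
  obtain L p u where "is_Map C Xo Xa S L p" "u \<in> hom C (Xo n) L" "u \<in> K"
    "\<forall>m. \<forall>\<sigma>\<in>S m. p m \<sigma> \<cdot> u = Xa n m \<sigma>" using assms unfolding restr_cover_def by blast
  then show ?thesis
    by (intro rel_cover_of_Map) (auto simp: std_simplex_def Xa_hom)
qed

lemma restr_cover_of_rel_cover:
  assumes "rel_cover C K Xo Xa (\<lambda>_. t) (\<lambda>_ _ _. idt C t) (\<lambda>n. bang (Xo n)) S T (Xo n) (Xa n)"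
  shows "restr_cover C K Xo Xa n S"
  using assms Map_of_rmap unfolding rel_cover_def restr_cover_def by blast

lemma Map_relabel:
  assumes "is_Map C Xo Xa S L p" "subcomplex S" "subcomplex S'"
    and "\<And>l w. w \<in> S' l \<Longrightarrow> map \<phi> w \<in> S l" "\<And>l w. w \<in> S l \<Longrightarrow> map \<psi> w \<in> S' l"
    and "\<And>l w. w \<in> S l \<Longrightarrow> map \<phi> (map \<psi> w) = w" "\<And>l w. w \<in> S' l \<Longrightarrow> map \<psi> (map \<phi> w) = w"
  shows "is_Map C Xo Xa S' L (\<lambda>l w. p l (map \<phi> w))"
  by (rule Map_of_rmap[OF rmap_relabel[OF rmap_of_Map[OF assms(1), of S] assms(2,2,3,3)]])
    (use assms in auto)

text \<open>Induction on a bound \<open>N\<close> for the sizes of the vertex sets, for all finite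
  families simultaneously. A single set of three or more vertices comes from its thick horn, a
  family of smaller sets, by \<open>extends_horn\<close>; one vertex gives \<open>Xo 0\<close>, two
  give the thick 1-simplex. Larger families are built up by \<open>Map_union\<close>.\<close>

lemma Map_thick_exists:
  assumes K: "stable_class C K"
    and cov: "\<And>m j. 0 < j \<Longrightarrow> j < m \<Longrightarrow> restr_cover C K Xo Xa m (horn m j)"
    and iso: "\<And>m j. 0 < j \<Longrightarrow> j < m \<Longrightarrow> k < m \<Longrightarrow> restr_iso C Xo Xa m (horn m j)"
    and M1: "is_Map C Xo Xa (thick_simplex 1) L1 p1"
    and F: "finite F" "\<And>V. V \<in> F \<Longrightarrow> finite V"
  shows "\<exists>L p. is_Map C Xo Xa (thick F) L p"
proof -
  \<comment> \<open>Without words the only condition on a representing object is to be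
    terminal.\<close>
  have no_words: "\<exists>L p. is_Map C Xo Xa (thick F) L p" if "\<And>l. thick F l = {}" for F
  proof -
    have "is_Map C Xo Xa (thick F) t (\<lambda>_ _. undefined)"
    proof (rule is_MapI)
      show "ss_cone C Xo Xa (thick F) t (\<lambda>_ _. undefined)"
        using t_obj that by (simp add: ss_cone_def)
      show "\<exists>u. u \<in> hom C L' t \<and> cone_agree (thick F) (\<lambda>m \<sigma>. undefined \<cdot> u) p'"
        if "ss_cone C Xo Xa (thick F) L' p'" for L' p'
        using bang_hom[OF ss_coneD(1)[OF that]] \<open>\<And>l. thick F l = {}\<close> by (auto simp: cone_agree_def)
    qed (rule bang_unique)
    then show ?thesis by blast
  qed
  have simplex: "\<exists>L p. is_Map C Xo Xa (thick {V}) L p"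
    if V: "finite V" "card V \<le> Suc N"
      and IH: "\<And>F. finite F \<Longrightarrow> (\<And>V. V \<in> F \<Longrightarrow> finite V \<and> card V \<le> N) \<Longrightarrow> \<exists>L p. is_Map C Xo Xa (thick F) L p"
    for V N
  proof -
    consider "card V \<le> N" | "card V = 0" | "card V = Suc 0" | "card V = 2" | "3 \<le> card V" "card V = Suc N"
      using V(2) by linarith
    then show ?thesis
    proof cases
      case 1
      then show ?thesis using IH[of "{V}"] V(1) by simp
    next
      case 2
      then show ?thesis using V(1) by (intro no_words) (simp add: thick_singleton)
    next
      case 3
      then obtain a where a: "V = {a}" by (metis One_nat_def card_1_singletonE)
      have std0: "w = replicate (Suc l) 0" if "w \<in> std_simplex 0 l" for w l
        by (rule replicate_eqI) (use that in \<open>auto simp: std_simplex_def mono_maps_def all_maps_def\<close>)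
      have "is_Map C Xo Xa (thick {V}) (Xo 0) (\<lambda>l w. Xa 0 l (map (\<lambda>_. 0) w))"
      proof (rule Map_relabel[OF Map_std subcomplex_std subcomplex_thick, where \<psi> = "\<lambda>_. a"])
        show "map (\<lambda>_. 0) w \<in> std_simplex 0 l" if "w \<in> thick {V} l" for l w
          using that by (auto simp: thick_singleton std_simplex_def mono_maps_def all_maps_def sorted_iff_nth_mono)
        show "map (\<lambda>_. a) w \<in> thick {V} l" if "w \<in> std_simplex 0 l" for l w
          using std0[OF that] a by (auto simp: thick_singleton)
        show "map (\<lambda>_. 0) (map (\<lambda>_. a) w) = w" if "w \<in> std_simplex 0 l" for l and w :: "nat list"
          using std0[OF that] by (auto simp: map_replicate_const)
        show "map (\<lambda>_. a) (map (\<lambda>_. 0) w) = w" if "w \<in> thick {V} l" for l and w :: "nat list"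
          using that a by (auto simp: thick_singleton intro!: map_idI)
      qed
      then show ?thesis by blast
    next
      case 4
      then obtain a b where ab: "V = {a, b}" "a \<noteq> b" by (metis card_2_iff)
      let ?\<phi> = "\<lambda>x::nat. if x = a then 0 else 1 :: nat" and ?\<psi> = "\<lambda>x::nat. if x = 0 then a else b"
      have "is_Map C Xo Xa (thick {V}) L1 (\<lambda>l w. p1 l (map ?\<phi> w))"
      proof (rule Map_relabel[OF M1[unfolded thick_simplex_eq] subcomplex_thick subcomplex_thick, where \<psi> = ?\<psi>])
        show "map ?\<phi> w \<in> thick {{0..1}} l" if "w \<in> thick {V} l" for l w
          using that by (auto simp: thick_singleton)
        show "map ?\<psi> w \<in> thick {V} l" if "w \<in> thick {{0..1}} l" for l w
          using that ab by (auto simp: thick_singleton)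
        show "map ?\<phi> (map ?\<psi> w) = w" if "w \<in> thick {{0..1}} l" for l w
          unfolding map_map using that ab by (intro map_idI) (force simp: thick_singleton)
        show "map ?\<psi> (map ?\<phi> w) = w" if "w \<in> thick {V} l" for l w
          unfolding map_map using that ab by (intro map_idI) (force simp: thick_singleton)
      qed
      then show ?thesis by blast
    next
      case 5
      then obtain i where i: "i \<in> V" by fastforce
      have "\<exists>L p. is_Map C Xo Xa (thick (facets V (V - {i}))) L p"
        using V(1) 5(2) by (intro IH) (auto simp: facets_def)
      then obtain L p where "is_Map C Xo Xa (thick (facets V (V - {i}))) L p" by blast
      from rmap_of_Map[OF this, of "thick {V}"]
      have M: "rmap (thick (facets V (V - {i}))) (thick {V}) L p (\<lambda>_ _. bang L)" .
      have "extends K (thick {V}) (thick (facets V (V - {i}))) (thick {V})"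
        using rel_cover_of_restr_cover[OF cov] rel_cover_of_restr_cover[OF iso[unfolded restr_iso_eq]]
        by (intro extends_horn[OF K V(1) 5(1) i subcomplex_thick, of _ k]) auto
      from extendsE[OF this M] show ?thesis using Map_of_rmap by metis
    qed
  qed
  have "\<exists>L p. is_Map C Xo Xa (thick F) L p"
    if "finite F" "\<And>V. V \<in> F \<Longrightarrow> finite V \<and> card V \<le> N" for F N
    using that
  proof (induction N arbitrary: F)
    case 0
    then have "V = {}" if "V \<in> F" for V using that by force
    then show ?case by (intro no_words) (fastforce simp: thick_def)
  next
    case (Suc N)
    show ?case using Suc.prems
    proof (induction F rule: finite_induct)
      case empty
      show ?case by (intro no_words) (simp add: thick_def)
    next
      case (insert V F)
      show ?case
      \<comment> \<open>If \<open>V\<close> is not absorbed, its intersections with the other sets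
        are proper subsets, hence have at most \<open>N\<close> elements and fall under the outer
        induction.\<close>
      proof (cases "\<exists>W\<in>F. V \<subseteq> W")
        case True
        then have "thick (insert V F) = thick F" using thick_absorb by blast
        then show ?thesis using insert.IH insert.prems by simp
      next
        case False
        obtain L p where M: "is_Map C Xo Xa (thick {V}) L p"
          using simplex[of V N] insert.prems[of V] Suc.IH by blast
        obtain L' p' where M': "is_Map C Xo Xa (thick F) L' p'"
          using insert.IH insert.prems by blast
        have "card (V \<inter> W) \<le> N" if "W \<in> F" for W
        proof -
          have "V \<inter> W \<subset> V" using False that by blast
          then have "card (V \<inter> W) < card V" using insert.prems[of V] psubset_card_mono by blast
          then show ?thesis using insert.prems[of V] by simp
        qed
        then have "\<exists>L p. is_Map C Xo Xa (thick ((\<lambda>W. V \<inter> W) ` F)) L p"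
          using insert.hyps(1) insert.prems by (intro Suc.IH) auto
        then obtain L'' p'' where M'': "is_Map C Xo Xa (\<lambda>l. thick {V} l \<inter> thick F l) L'' p''"
          unfolding thick_Int by blast
        show ?thesis
          using Map_union[OF subcomplex_thick subcomplex_thick M M' M''] by (simp add: thick_Un[of V F, symmetric])
      qed
    qed
  qed
  moreover have "V \<in> F \<Longrightarrow> finite V \<and> card V \<le> Max (card ` F)" for V
    using F by simp
  ultimately show ?thesis using F(1) by blast
qed

text \<open>The subcomplex \<open>vertex0\<close> is the standard 0-simplex, represented by
  \<open>Xo 0\<close>; over the point, the canonical map is therefore the value at the vertex
  \<open>[0]\<close>.\<close>

lemma rel_cover_vertex:
  assumes M: "is_Map C Xo Xa (thick_simplex 1) L p" and K: "p 0 [0] \<in> K"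
  shows "rel_cover C K Xo Xa (\<lambda>_. t) (\<lambda>_ _ _. idt C t) (\<lambda>n. bang (Xo n)) vertex0 (thick_simplex 1) L p"
proof -
  have v: "[0] \<in> thick_simplex 1 0" by (simp add: thick_simplex_def all_maps_def)
  have std: "std_simplex 0 = vertex0"
    by (auto simp: fun_eq_iff std_simplex_def mono_maps_def all_maps_def vertex0_def sorted_replicate
        simp del: replicate_Suc intro!: replicate_eqI)
  have V: "is_Map C Xo Xa vertex0 (Xo 0) (Xa 0)" using Map_std[of 0] unfolding std .
  show ?thesis
  proof (rule rel_cover_of_Map[OF V ss_coneD(2)[OF Map_cone[OF M] v] K])
    fix m \<sigma> assume s: "\<sigma> \<in> vertex0 m"
    then have "\<sigma> \<in> mono_maps m 0" using std by (metis std_simplex_def)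
    moreover have "ocomp [0] \<sigma> = \<sigma>"
      using id_ocomp[OF mono_all[OF calculation]] by simp
    ultimately show "Xa 0 m \<sigma> \<cdot> p 0 [0] = p m \<sigma>" using ss_coneD(3)[OF Map_cone[OF M] v] by metis
  qed (rule ss_coneD(2)[OF Map_cone[OF M]])
qed

lemma point_Map: "is_Map C (\<lambda>_. t) (\<lambda>_ _ _. idt C t) T t (\<lambda>_ _. idt C t)"
proof (rule Y.is_MapI)
  show "ss_cone C (\<lambda>_. t) (\<lambda>_ _ _. idt C t) T t (\<lambda>_ _. idt C t)"
    unfolding ss_cone_def using t_obj idt_hom[OF t_obj] by simp
  fix L' p' assume c: "ss_cone C (\<lambda>_. t) (\<lambda>_ _ _. idt C t) T L' p'"
  have b: "bang L' \<in> hom C L' t" using bang_hom[OF ss_coneD(1)[OF c]] .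
  then show "\<exists>u. u \<in> hom C L' t \<and> cone_agree T (\<lambda>m \<sigma>. idt C t \<cdot> u) p'"
    using point_cone_unique[OF c] unfolding cone_agree_def in_hom_iff by (metis idt_comp)
qed (rule bang_unique)

lemma point_k_category:
  assumes "stable_class C K"
  shows "k_category C K k (\<lambda>_. t) (\<lambda>_ _ _. idt C t)"
proof -
  have i: "is_iso C (idt C t)" "idt C t \<in> hom C t t" "idt C t \<cdot> idt C t = idt C t"
    using is_iso_idt idt_hom t_obj by auto
  then have "idt C t \<in> K" using stable_classD(2)[OF assms] by blast
  then show ?thesis
    unfolding k_category_def restr_cover_def restr_iso_def using Y.simplicial point_Map i by metis
qed

end

section \<open>Comparison of cones into \<open>G(X)\<close> and into \<open>X\<close>\<close>

text \<open>The ordinary simplices on the same vertex sets: standard simplices, horns and boundaries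
  all have this form. The aim is to identify maps from \<open>flat F\<close> to G(X) with maps from
  \<open>thick F\<close> to X.\<close>

definition flat :: "nat set set \<Rightarrow> nat \<Rightarrow> nat list set" where
  "flat F l = {w \<in> thick F l. sorted w}"

lemma sorted_sub_mono: "sorted w \<Longrightarrow> length w = Suc l \<Longrightarrow> set w \<subseteq> {0..n} \<Longrightarrow> w \<in> mono_maps l n"
  by (auto simp: mono_maps_def all_maps_def)

lemma sorted_ocomp:
  assumes "sorted w" "length w = Suc m" "\<theta> \<in> mono_maps l m"
  shows "sorted (ocomp w \<theta>)"
  using assms mono_mapsD[OF assms(3)] by (auto simp: sorted_iff_nth_mono)

lemma subcomplex_flat: "subcomplex (flat F)"
  unfolding subcomplex_def flat_def
  using subcomplexD[OF subcomplex_thick] sorted_ocomp by simp blast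

lemma flat_thick: "flat F l \<subseteq> thick F l"
  by (auto simp: flat_def)

lemma thick_ocomp:
  assumes "\<sigma> \<in> thick F m" "w \<in> thick_simplex m l"
  shows "ocomp \<sigma> w \<in> thick F l"
  using assms set_ocomp_subset[of \<sigma> m w l] all_mapsD(1)[of w l m] unfolding thick_def thick_simplex_def
  by (auto dest: subset_trans)

lemma all_maps_section:
  assumes "length \<iota> = Suc m" "length w = Suc l" "set w \<subseteq> set \<iota>"
  shows "\<exists>u\<in>all_maps l m. ocomp \<iota> u = w"
proof -
  have "\<exists>t<Suc m. \<iota> ! t = c" if "c \<in> set w" for c
    using that assms by (metis in_set_conv_nth subsetD)
  then obtain g where g: "\<And>c. c \<in> set w \<Longrightarrow> g c < Suc m \<and> \<iota> ! g c = c" by metis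
  have "ocomp \<iota> (map g w) = w" using g by (intro nth_equalityI) auto
  moreover have "map g w \<in> all_maps l m" using g assms(2) by (fastforce simp: all_maps_def)
  ultimately show ?thesis by blast
qed

lemma ocomp_inj:
  assumes "distinct \<iota>" "length \<iota> = Suc m" "u \<in> all_maps l m" "v \<in> all_maps l m" "ocomp \<iota> u = ocomp \<iota> v"
  shows "u = v"
proof (rule nth_equalityI)
  show "length u = length v" using all_mapsD(1)[OF assms(3)] all_mapsD(1)[OF assms(4)] by simp
  fix t assume t: "t < length u"
  have "t < length v" using t all_mapsD(1)[OF assms(3)] all_mapsD(1)[OF assms(4)] by simp
  then have "\<iota> ! (u ! t) = \<iota> ! (v ! t)" "u ! t < Suc m" "v ! t < Suc m"
    using arg_cong[OF assms(5), of "\<lambda>w. w ! t"] t all_mapsD(2)[OF assms(3)] all_mapsD(2)[OF assms(4)] by auto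
  then show "u ! t = v ! t" using nth_eq_iff_index_eq[OF assms(1)] assms(2) by metis
qed

lemma image_word:
  assumes "w \<in> thick F l"
  obtains m where "length (sorted_list_of_set (set w)) = Suc m" "sorted_list_of_set (set w) \<in> flat F m"
proof -
  have "card (set w) \<noteq> 0" using assms by (auto simp: thick_def)
  then obtain m where "card (set w) = Suc m" using not0_implies_Suc by blast
  moreover from this have "sorted_list_of_set (set w) \<in> flat F m" using assms by (auto simp: flat_def thick_def)
  ultimately show thesis using that by simp
qed

lemma factorization_exists:
  assumes "w \<in> thick F l"
  obtains m \<sigma> u where "\<sigma> \<in> flat F m" "u \<in> thick_simplex m l" "ocomp \<sigma> u = w"
proof -
  obtain k where k: "length (sorted_list_of_set (set w)) = Suc k" "sorted_list_of_set (set w) \<in> flat F k"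
    using image_word[OF assms] .
  have "length w = Suc l" using assms by (simp add: thick_def)
  then show thesis
    using all_maps_section[OF k(1), of w l] k(2) that unfolding thick_simplex_def by auto
qed

locale thick_object = simplicial_object C Xo Xa
  for C :: "('o,'a) cat" and Xo Xa +
  fixes Go :: "nat \<Rightarrow> 'o" and Ga :: "nat \<Rightarrow> nat \<Rightarrow> nat list \<Rightarrow> 'a" and pG :: "nat \<Rightarrow> nat \<Rightarrow> nat list \<Rightarrow> 'a"
  assumes is_G: "is_G C Xo Xa Go Ga pG"
begin

sublocale G: simplicial_object C Go Ga
  using is_G by unfold_locales (simp add: is_G_def)

lemma pG_Map: "is_Map C Xo Xa (thick_simplex n) (Go n) (pG n)"
  using is_G by (simp add: is_G_def)

lemma pG_cone: "ss_cone C Xo Xa (thick_simplex n) (Go n) (pG n)"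
  using Map_cone[OF pG_Map] .

lemma pG_hom: "w \<in> thick_simplex n l \<Longrightarrow> pG n l w \<in> hom C (Go n) (Xo l)"
  using ss_coneD(2)[OF pG_cone] .

lemma pG_Ga: "\<theta> \<in> mono_maps m n \<Longrightarrow> w \<in> thick_simplex m l \<Longrightarrow> pG m l w \<cdot> Ga n m \<theta> = pG n l (ocomp \<theta> w)"
  using is_G unfolding is_G_def by blast

lemma pG_Ga_comp:
  assumes "\<theta> \<in> mono_maps m n" "w \<in> thick_simplex m l" "b \<in> hom C L (Go n)"
  shows "pG m l w \<cdot> Ga n m \<theta> \<cdot> b = pG n l (ocomp \<theta> w) \<cdot> b"
  using comp_assoc_hom[OF assms(3) G.Xa_hom[OF assms(1)] pG_hom[OF assms(2)]] pG_Ga[OF assms(1,2)] by simp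

text \<open>For \<open>\<sigma>\<close> of dimension \<open>m\<close>, the cone pulled back along
  the thick version of \<open>\<sigma>\<close> is a map into the mapping object of the thick
  simplex, which is \<open>Go m\<close>.\<close>

lemma lift_cone:
  assumes "ss_cone C Xo Xa (thick F) L p"
  obtains P where "ss_cone C Go Ga (flat F) L P"
    "\<And>m l \<sigma> w. \<sigma> \<in> flat F m \<Longrightarrow> w \<in> thick_simplex m l \<Longrightarrow> pG m l w \<cdot> P m \<sigma> = p l (ocomp \<sigma> w)"
proof -
  have ex: "\<exists>u. u \<in> hom C L (Go m) \<and> (\<forall>l. \<forall>w\<in>thick_simplex m l. pG m l w \<cdot> u = p l (ocomp \<sigma> w))"
    if "\<sigma> \<in> flat F m" for m \<sigma>
  proof -
    have "ss_cone C Xo Xa (thick_simplex m) L (\<lambda>l w. p l (ocomp \<sigma> w))"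
      using thick_ocomp[OF subsetD[OF flat_thick that]]
      by (intro ss_cone_pull[OF assms]) (auto simp: thick_simplex_def)
    then show ?thesis using Map_lift[OF pG_Map] by metis
  qed
  define P where "P m \<sigma> = (SOME u. u \<in> hom C L (Go m) \<and>
    (\<forall>l. \<forall>w\<in>thick_simplex m l. pG m l w \<cdot> u = p l (ocomp \<sigma> w)))" for m \<sigma>
  have P: "P m \<sigma> \<in> hom C L (Go m)" "w \<in> thick_simplex m l \<Longrightarrow> pG m l w \<cdot> P m \<sigma> = p l (ocomp \<sigma> w)"
    if "\<sigma> \<in> flat F m" for m l \<sigma> w
    using someI_ex[OF ex[OF that], folded P_def] by blast+
  have "ss_cone C Go Ga (flat F) L P"
    unfolding ss_cone_def
  proof (intro conjI allI ballI impI)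
    show "L \<in> obj C" using ss_coneD(1)[OF assms] .
    show "Ga m k \<theta> \<cdot> P m \<sigma> = P k (ocomp \<sigma> \<theta>)" if s: "\<sigma> \<in> flat F m" and t: "\<theta> \<in> mono_maps k m" for m k \<sigma> \<theta>
    proof -
      have st: "ocomp \<sigma> \<theta> \<in> flat F k" using subcomplexD(2)[OF subcomplex_flat s t] .
      show ?thesis
      proof (rule Map_eqI[OF pG_Map comp_hom[OF P(1)[OF s] G.Xa_hom[OF t]] P(1)[OF st]])
        fix l w assume w: "w \<in> thick_simplex k l"
        have "ocomp \<theta> w \<in> thick_simplex m l"
          using ocomp_all[OF mono_all[OF t]] w by (simp add: thick_simplex_def)
        then show "pG k l w \<cdot> Ga m k \<theta> \<cdot> P m \<sigma> = pG k l w \<cdot> P k (ocomp \<sigma> \<theta>)"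
          using pG_Ga_comp[OF t w P(1)[OF s]] P(2)[OF s] P(2)[OF st w]
            ocomp_assoc[OF mono_all[OF t], of w l \<sigma>] w by (simp add: thick_simplex_def)
      qed
    qed
  qed (fact P(1))
  with P(2) that show thesis by blast
qed

text \<open>A word factors through the increasing list of its letters; any two factorizations through
  monotone words give the same value, because both can be compared with the factorization through
  an injective monotone word.\<close>

lemma factorization_unique:
  assumes P: "ss_cone C Go Ga (flat F) L P"
    and \<sigma>: "\<sigma> \<in> flat F m" "u \<in> thick_simplex m l" "ocomp \<sigma> u = w"
    and \<iota>: "\<iota> = sorted_list_of_set (set w)" "length \<iota> = Suc k" "v \<in> thick_simplex k l" "ocomp \<iota> v = w"
  shows "pG m l u \<cdot> P m \<sigma> = pG k l v \<cdot> P k \<iota>"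
proof -
  have \<sigma>': "length \<sigma> = Suc m" "sorted \<sigma>" "\<sigma> \<in> thick F m" using \<sigma>(1) by (auto simp: flat_def thick_def)
  \<comment> \<open>\<open>\<kappa>\<close> lists the letters of \<open>\<sigma>\<close> without
    repetition. Both \<open>\<sigma>\<close> and \<open>\<iota>\<close> arise from it by operators
    \<open>s\<close> and \<open>t\<close>, and injectivity of \<open>\<kappa>\<close> forces
    \<open>ocomp s u = ocomp t v\<close>; naturality of \<open>P\<close> then equates the two
    values.\<close>
  define \<kappa> where "\<kappa> = sorted_list_of_set (set \<sigma>)"
  obtain r where r: "length \<kappa> = Suc r" "\<kappa> \<in> flat F r" using image_word[OF \<sigma>'(3)] unfolding \<kappa>_def .
  have \<kappa>: "distinct \<kappa>" "sorted \<kappa>" "set \<kappa> = set \<sigma>" by (simp_all add: \<kappa>_def)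
  \<comment> \<open>Only a bound for the letters, so that all three sorted words are monotone maps
    into one standard simplex.\<close>
  define B where "B = Max (set \<sigma>)"
  have B: "set \<sigma> \<subseteq> {0..B}" by (auto simp: B_def)
  have w\<sigma>: "set w \<subseteq> set \<sigma>"
    using set_ocomp_subset[OF \<sigma>'(1), of u l] \<sigma>(2,3) by (simp add: thick_simplex_def)
  have \<iota>': "set \<iota> = set w" "sorted \<iota>" using \<iota>(1) by simp_all
  have m\<kappa>: "\<kappa> \<in> mono_maps r B" using sorted_sub_mono[of \<kappa> r B] \<kappa> r(1) B by simp
  have m\<sigma>: "\<sigma> \<in> mono_maps m B" using sorted_sub_mono[of \<sigma> m B] \<sigma>' B by simp
  have m\<iota>: "\<iota> \<in> mono_maps k B" using sorted_sub_mono[of \<iota> k B] \<iota>' \<iota>(2) w\<sigma> B by auto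
  obtain s where s: "s \<in> mono_maps m r" "ocomp \<kappa> s = \<sigma>"
    using mono_maps_section[OF m\<kappa> m\<sigma>] \<kappa>(3) by auto
  obtain t where t: "t \<in> mono_maps k r" "ocomp \<kappa> t = \<iota>"
    using mono_maps_section[OF m\<kappa> m\<iota>] \<kappa>(3) \<iota>'(1) w\<sigma> by auto
  have P\<kappa>: "P r \<kappa> \<in> hom C L (Go r)" using ss_coneD(2)[OF P r(2)] .
  have ua: "u \<in> all_maps l m" "v \<in> all_maps l k" using \<sigma>(2) \<iota>(3) by (simp_all add: thick_simplex_def)
  have "ocomp \<kappa> (ocomp s u) = ocomp \<kappa> (ocomp t v)"
    using ocomp_assoc[OF mono_all[OF s(1)] ua(1), of \<kappa>] ocomp_assoc[OF mono_all[OF t(1)] ua(2), of \<kappa>]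
      s(2) t(2) \<sigma>(3) \<iota>(4) by simp
  then have "ocomp s u = ocomp t v"
    by (rule ocomp_inj[OF \<kappa>(1) r(1) ocomp_all[OF mono_all[OF s(1)] ua(1)] ocomp_all[OF mono_all[OF t(1)] ua(2)]])
  moreover have "P m \<sigma> = Ga r m s \<cdot> P r \<kappa>" "P k \<iota> = Ga r k t \<cdot> P r \<kappa>"
    using ss_coneD(3)[OF P r(2)] s t by simp_all
  ultimately show ?thesis
    using pG_Ga_comp[OF s(1) \<sigma>(2) P\<kappa>] pG_Ga_comp[OF t(1) \<iota>(3) P\<kappa>] by simp
qed

text \<open>The value at a word is read off from any factorization through a sorted word;
  \<open>factorization_unique\<close> makes it independent of the choice.\<close>

lemma lower_cone:
  assumes P: "ss_cone C Go Ga (flat F) L P"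
  obtains p where "ss_cone C Xo Xa (thick F) L p"
    "\<And>m l \<sigma> w. \<sigma> \<in> flat F m \<Longrightarrow> w \<in> thick_simplex m l \<Longrightarrow> pG m l w \<cdot> P m \<sigma> = p l (ocomp \<sigma> w)"
proof -
  have ex: "\<exists>a. \<forall>m \<sigma> u. \<sigma> \<in> flat F m \<and> u \<in> thick_simplex m l \<and> ocomp \<sigma> u = w \<longrightarrow> pG m l u \<cdot> P m \<sigma> = a"
    if w: "w \<in> thick F l" for l w
  proof -
    obtain k where k: "length (sorted_list_of_set (set w)) = Suc k" using image_word[OF w] by blast
    have "length w = Suc l" using w by (simp add: thick_def)
    then obtain v where "v \<in> thick_simplex k l" "ocomp (sorted_list_of_set (set w)) v = w"
      using all_maps_section[OF k, of w l] unfolding thick_simplex_def by auto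
    then show ?thesis using factorization_unique[OF P _ _ _ refl k] by blast
  qed
  define p where "p l w = (SOME a. \<forall>m \<sigma> u. \<sigma> \<in> flat F m \<and> u \<in> thick_simplex m l \<and> ocomp \<sigma> u = w \<longrightarrow>
    pG m l u \<cdot> P m \<sigma> = a)" for l w
  have p: "pG m l u \<cdot> P m \<sigma> = p l w"
    if "w \<in> thick F l" "\<sigma> \<in> flat F m" "u \<in> thick_simplex m l" "ocomp \<sigma> u = w" for l w m \<sigma> u
    using someI_ex[OF ex[OF that(1)], folded p_def] that(2-4) by blast
  have p': "pG m l u \<cdot> P m \<sigma> = p l (ocomp \<sigma> u)" if "\<sigma> \<in> flat F m" "u \<in> thick_simplex m l" for m l \<sigma> u
    using p[OF thick_ocomp[OF subsetD[OF flat_thick that(1)] that(2)] that refl] .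
  have "ss_cone C Xo Xa (thick F) L p"
    unfolding ss_cone_def
  proof (intro conjI allI ballI impI)
    show "L \<in> obj C" using ss_coneD(1)[OF P] .
    show "p l w \<in> hom C L (Xo l)" if "w \<in> thick F l" for l w
      using factorization_exists[OF that] p' ss_coneD(2)[OF P] pG_hom comp_hom by metis
    show "Xa l k \<theta> \<cdot> p l w = p k (ocomp w \<theta>)" if w: "w \<in> thick F l" and t: "\<theta> \<in> mono_maps k l" for l k w \<theta>
    proof -
      obtain m \<sigma> u where u: "\<sigma> \<in> flat F m" "u \<in> thick_simplex m l" "ocomp \<sigma> u = w"
        using factorization_exists[OF w] .
      have ut: "ocomp u \<theta> \<in> thick_simplex m k"
        using ocomp_all[of u l m \<theta> k] u(2) mono_all[OF t] by (simp add: thick_simplex_def)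
      have "Xa l k \<theta> \<cdot> pG m l u \<cdot> P m \<sigma> = pG m k (ocomp u \<theta>) \<cdot> P m \<sigma>"
        using comp_assoc_hom[OF ss_coneD(2)[OF P u(1)] pG_hom[OF u(2)] Xa_hom[OF t]]
          ss_coneD(3)[OF pG_cone u(2) t] by simp
      then show ?thesis
        using p'[OF u(1,2)] p'[OF u(1) ut] u(2,3) ocomp_assoc[OF _ mono_all[OF t], of u m \<sigma>]
        by (simp add: thick_simplex_def)
    qed
  qed
  with p' that show thesis by blast
qed

end

lemma (in simplicial_object) is_G_exists:
  assumes "\<And>n. \<exists>L p. is_Map C Xo Xa (thick_simplex n) L p"
  shows "\<exists>Go Ga pG. is_G C Xo Xa Go Ga pG"
proof -
  obtain Go pG where M: "\<And>n. is_Map C Xo Xa (thick_simplex n) (Go n) (pG n)"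
    using assms by metis
  have ex: "\<exists>u. u \<in> hom C (Go n) (Go m) \<and> (\<forall>l. \<forall>w\<in>thick_simplex m l. pG m l w \<cdot> u = pG n l (ocomp \<theta> w))"
    if "\<theta> \<in> mono_maps m n" for n m \<theta>
  proof -
    have "ss_cone C Xo Xa (thick_simplex m) (Go n) (\<lambda>l w. pG n l (ocomp \<theta> w))"
      using ocomp_all[OF mono_all[OF that]]
      by (intro ss_cone_pull[OF Map_cone[OF M]]) (auto simp: thick_simplex_def)
    then show ?thesis using Map_lift[OF M] by metis
  qed
  define Ga where "Ga n m \<theta> = (SOME u. u \<in> hom C (Go n) (Go m) \<and>
    (\<forall>l. \<forall>w\<in>thick_simplex m l. pG m l w \<cdot> u = pG n l (ocomp \<theta> w)))" for n m \<theta>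
  have Ga: "Ga n m \<theta> \<in> hom C (Go n) (Go m)" "w \<in> thick_simplex m l \<Longrightarrow> pG m l w \<cdot> Ga n m \<theta> = pG n l (ocomp \<theta> w)"
    if "\<theta> \<in> mono_maps m n" for n m \<theta> l w
    using someI_ex[OF ex[OF that], folded Ga_def] by blast+
  have ob: "Go n \<in> obj C" for n using ss_coneD(1)[OF Map_cone[OF M]] .
  have h: "pG n l w \<in> hom C (Go n) (Xo l)" if "w \<in> thick_simplex n l" for n l w
    using ss_coneD(2)[OF Map_cone[OF M] that] .
  have "simplicial_obj C Go Ga"
    unfolding simplicial_obj_def
  proof (intro conjI allI impI)
    show "Ga n n [0..<Suc n] = idt C (Go n)" for n
    proof (rule Map_eqI[OF M Ga(1)[OF id_mono] idt_hom[OF ob]])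
      show "pG n l w \<cdot> Ga n n [0..<Suc n] = pG n l w \<cdot> idt C (Go n)" if "w \<in> thick_simplex n l" for l w
        using Ga(2)[OF id_mono that] id_ocomp[of w l n] that h[OF that]
        by (simp add: thick_simplex_def in_hom_iff del: upt_Suc)
    qed
    show "Ga n l (ocomp \<theta> \<phi>) = Ga m l \<phi> \<cdot> Ga n m \<theta>"
      if t: "\<theta> \<in> mono_maps m n" and p: "\<phi> \<in> mono_maps l m" for n m l \<theta> \<phi>
    proof (rule Map_eqI[OF M Ga(1)[OF ocomp_mono[OF t p]] comp_hom[OF Ga(1)[OF t] Ga(1)[OF p]]])
      fix k w assume w: "w \<in> thick_simplex l k"
      have "ocomp \<phi> w \<in> thick_simplex m k"
        using ocomp_all[OF mono_all[OF p]] w by (simp add: thick_simplex_def)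
      then show "pG l k w \<cdot> Ga n l (ocomp \<theta> \<phi>) = pG l k w \<cdot> Ga m l \<phi> \<cdot> Ga n m \<theta>"
        using comp_assoc_hom[OF Ga(1)[OF t] Ga(1)[OF p] h[OF w]] Ga(2)[OF p w] Ga(2)[OF t]
          Ga(2)[OF ocomp_mono[OF t p] w] ocomp_assoc[OF mono_all[OF p], of w k \<theta>] w
        by (simp add: thick_simplex_def)
    qed
  qed (use ob Ga(1) in blast)+
  then have "is_G C Xo Xa Go Ga pG" using M Ga(2) by (simp add: is_G_def)
  then show ?thesis by blast
qed

section \<open>Relative mapping objects of the induced map G(f)\<close>

locale thick_morphism = simplicial_morphism C Xo Xa Yo Ya f + GX: thick_object C Xo Xa GXo GXa pGX +
    GY: thick_object C Yo Ya GYo GYa pGY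
  for C :: "('o,'a) cat" and Xo Xa Yo Ya f GXo GXa pGX GYo GYa pGY +
  fixes Gf :: "nat \<Rightarrow> 'a"
  assumes is_Gmap: "is_Gmap C f GXo pGX GYo pGY Gf"
begin

lemma Gf_hom: "Gf n \<in> hom C (GXo n) (GYo n)"
  using is_Gmap by (simp add: is_Gmap_def)

lemma pGY_Gf: "w \<in> thick_simplex n l \<Longrightarrow> pGY n l w \<cdot> Gf n = f l \<cdot> pGX n l w"
  using is_Gmap by (simp add: is_Gmap_def)

lemma pGY_Gf_comp:
  assumes "w \<in> thick_simplex n l" "b \<in> hom C L (GXo n)"
  shows "pGY n l w \<cdot> Gf n \<cdot> b = f l \<cdot> pGX n l w \<cdot> b"
  using X.comp_assoc_hom[OF assms(2) Gf_hom GY.pG_hom[OF assms(1)]] pGY_Gf[OF assms(1)]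
    X.comp_assoc_hom[OF assms(2) GX.pG_hom[OF assms(1)] f_hom] by simp

sublocale G: simplicial_morphism C GXo GXa GYo GYa Gf
proof
  show "Gf n \<in> hom C (GXo n) (GYo n)" for n by (rule Gf_hom)
  show "GYa n m \<theta> \<cdot> Gf n = Gf m \<cdot> GXa n m \<theta>" if t: "\<theta> \<in> mono_maps m n" for n m \<theta>
  proof (rule Y.Map_eqI[OF GY.pG_Map X.comp_hom[OF Gf_hom GY.G.Xa_hom[OF t]] X.comp_hom[OF GX.G.Xa_hom[OF t] Gf_hom]])
    fix l w assume w: "w \<in> thick_simplex m l"
    then have "ocomp \<theta> w \<in> thick_simplex n l"
      using ocomp_all[OF mono_all[OF t]] by (simp add: thick_simplex_def)
    then show "pGY m l w \<cdot> GYa n m \<theta> \<cdot> Gf n = pGY m l w \<cdot> Gf m \<cdot> GXa n m \<theta>"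
      using GY.pG_Ga_comp[OF t w Gf_hom] pGY_Gf pGY_Gf_comp[OF w GX.G.Xa_hom[OF t]] GX.pG_Ga[OF t w] by simp
  qed
qed

text \<open>\<open>lift_cone\<close> and \<open>lower_cone\<close> turn cones of the two kinds into
  each other over any object, so the object representing the thick problem for \<open>f\<close> also
  represents the flat problem for \<open>Gf\<close>.\<close>

lemma G_rmap:
  assumes M: "rmap (thick F) (thick H) L p q" and FH: "\<And>l. thick F l \<subseteq> thick H l"
  obtains P Q where "G.rmap (flat F) (flat H) L P Q"
    "\<And>m l \<sigma> w. \<sigma> \<in> flat F m \<Longrightarrow> w \<in> thick_simplex m l \<Longrightarrow> pGX m l w \<cdot> P m \<sigma> = p l (ocomp \<sigma> w)"
    "\<And>m l \<sigma> w. \<sigma> \<in> flat H m \<Longrightarrow> w \<in> thick_simplex m l \<Longrightarrow> pGY m l w \<cdot> Q m \<sigma> = q l (ocomp \<sigma> w)"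
proof -
  have fFH: "flat F m \<subseteq> flat H m" for m using FH by (auto simp: flat_def)
  obtain P where P: "ss_cone C GXo GXa (flat F) L P"
    "\<And>m l \<sigma> w. \<sigma> \<in> flat F m \<Longrightarrow> w \<in> thick_simplex m l \<Longrightarrow> pGX m l w \<cdot> P m \<sigma> = p l (ocomp \<sigma> w)"
    using GX.lift_cone[OF rel_coneD(1)[OF rmap_cone[OF M]]] by blast
  obtain Q where Q: "ss_cone C GYo GYa (flat H) L Q"
    "\<And>m l \<sigma> w. \<sigma> \<in> flat H m \<Longrightarrow> w \<in> thick_simplex m l \<Longrightarrow> pGY m l w \<cdot> Q m \<sigma> = q l (ocomp \<sigma> w)"
    using GY.lift_cone[OF rel_coneD(2)[OF rmap_cone[OF M]]] by blast
  have Ph: "P m \<sigma> \<in> hom C L (GXo m)" if "\<sigma> \<in> flat F m" for m \<sigma> using ss_coneD(2)[OF P(1) that] .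
  have Qh: "Q m \<sigma> \<in> hom C L (GYo m)" if "\<sigma> \<in> flat H m" for m \<sigma> using ss_coneD(2)[OF Q(1) that] .
  have compat: "Gf m \<cdot> P m \<sigma> = Q m \<sigma>" if s: "\<sigma> \<in> flat F m" for m \<sigma>
  proof (rule Y.Map_eqI[OF GY.pG_Map X.comp_hom[OF Ph[OF s] Gf_hom] Qh[OF subsetD[OF fFH s]]])
    fix l w assume w: "w \<in> thick_simplex m l"
    show "pGY m l w \<cdot> Gf m \<cdot> P m \<sigma> = pGY m l w \<cdot> Q m \<sigma>"
      using pGY_Gf_comp[OF w Ph[OF s]] P(2)[OF s w] Q(2)[OF subsetD[OF fFH s] w]
        rel_coneD(3)[OF rmap_cone[OF M] thick_ocomp[OF subsetD[OF flat_thick s] w]] by simp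
  qed
  have Pu: "pGX m l w \<cdot> P m \<sigma> \<cdot> u = p l (ocomp \<sigma> w) \<cdot> u"
    if "\<sigma> \<in> flat F m" "w \<in> thick_simplex m l" "u \<in> hom C L' L" for m l \<sigma> w u L'
    using X.comp_assoc_hom[OF that(3) Ph[OF that(1)] GX.pG_hom[OF that(2)]] P(2)[OF that(1,2)] by simp
  have Qu: "pGY m l w \<cdot> Q m \<sigma> \<cdot> u = q l (ocomp \<sigma> w) \<cdot> u"
    if "\<sigma> \<in> flat H m" "w \<in> thick_simplex m l" "u \<in> hom C L' L" for m l \<sigma> w u L'
    using X.comp_assoc_hom[OF that(3) Qh[OF that(1)] GY.pG_hom[OF that(2)]] Q(2)[OF that(1,2)] by simp
  have "G.rmap (flat F) (flat H) L P Q"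
  proof (rule G.rmapI)
    show "G.rcone (flat F) (flat H) L P Q" unfolding rel_cone_def using P(1) Q(1) compat by blast
  next
    fix L' P' Q' assume N: "G.rcone (flat F) (flat H) L' P' Q'"
    obtain p' where p': "ss_cone C Xo Xa (thick F) L' p'"
      "\<And>m l \<sigma> w. \<sigma> \<in> flat F m \<Longrightarrow> w \<in> thick_simplex m l \<Longrightarrow> pGX m l w \<cdot> P' m \<sigma> = p' l (ocomp \<sigma> w)"
      using GX.lower_cone[OF rel_coneD(1)[OF N]] by blast
    obtain q' where q': "ss_cone C Yo Ya (thick H) L' q'"
      "\<And>m l \<sigma> w. \<sigma> \<in> flat H m \<Longrightarrow> w \<in> thick_simplex m l \<Longrightarrow> pGY m l w \<cdot> Q' m \<sigma> = q' l (ocomp \<sigma> w)"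
      using GY.lower_cone[OF rel_coneD(2)[OF N]] by blast
    have P'h: "P' m \<sigma> \<in> hom C L' (GXo m)" if "\<sigma> \<in> flat F m" for m \<sigma> using ss_coneD(2)[OF rel_coneD(1)[OF N] that] .
    have Q'h: "Q' m \<sigma> \<in> hom C L' (GYo m)" if "\<sigma> \<in> flat H m" for m \<sigma> using ss_coneD(2)[OF rel_coneD(2)[OF N] that] .
    have "f l \<cdot> p' l w = q' l w" if w: "w \<in> thick F l" for l w
    proof -
      obtain m \<sigma> v where v: "\<sigma> \<in> flat F m" "v \<in> thick_simplex m l" "ocomp \<sigma> v = w"
        using factorization_exists[OF w] .
      show ?thesis
        using p'(2)[OF v(1,2)] q'(2)[OF subsetD[OF fFH v(1)] v(2)] v(3) rel_coneD(3)[OF N v(1)]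
          pGY_Gf_comp[OF v(2) P'h[OF v(1)]] by simp
    qed
    then have "rcone (thick F) (thick H) L' p' q'" unfolding rel_cone_def using p'(1) q'(1) by blast
    from rmap_lift[OF M this] obtain u where u: "u \<in> hom C L' L"
      "\<And>m \<sigma>. \<sigma> \<in> thick F m \<Longrightarrow> p m \<sigma> \<cdot> u = p' m \<sigma>" "\<And>m \<sigma>. \<sigma> \<in> thick H m \<Longrightarrow> q m \<sigma> \<cdot> u = q' m \<sigma>"
      by blast
    have "P m \<sigma> \<cdot> u = P' m \<sigma>" if s: "\<sigma> \<in> flat F m" for m \<sigma>
    proof (rule X.Map_eqI[OF GX.pG_Map X.comp_hom[OF u(1) Ph[OF s]] P'h[OF s]])
      show "pGX m l w \<cdot> P m \<sigma> \<cdot> u = pGX m l w \<cdot> P' m \<sigma>" if w: "w \<in> thick_simplex m l" for l w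
        using Pu[OF s w u(1)] p'(2)[OF s w] u(2)[OF thick_ocomp[OF subsetD[OF flat_thick s] w]] by simp
    qed
    moreover have "Q m \<sigma> \<cdot> u = Q' m \<sigma>" if s: "\<sigma> \<in> flat H m" for m \<sigma>
    proof (rule Y.Map_eqI[OF GY.pG_Map X.comp_hom[OF u(1) Qh[OF s]] Q'h[OF s]])
      show "pGY m l w \<cdot> Q m \<sigma> \<cdot> u = pGY m l w \<cdot> Q' m \<sigma>" if w: "w \<in> thick_simplex m l" for l w
        using Qu[OF s w u(1)] q'(2)[OF s w] u(3)[OF thick_ocomp[OF subsetD[OF flat_thick s] w]] by simp
    qed
    ultimately show "\<exists>u. u \<in> hom C L' L \<and> (\<forall>m. \<forall>\<sigma>\<in>flat F m. P m \<sigma> \<cdot> u = P' m \<sigma>) \<and>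
        (\<forall>m. \<forall>\<sigma>\<in>flat H m. Q m \<sigma> \<cdot> u = Q' m \<sigma>)" using u(1) by blast
  next
    fix L' u v assume u: "u \<in> hom C L' L" and v: "v \<in> hom C L' L"
      and eq: "\<forall>m. \<forall>\<sigma>\<in>flat F m. P m \<sigma> \<cdot> u = P m \<sigma> \<cdot> v" "\<forall>m. \<forall>\<sigma>\<in>flat H m. Q m \<sigma> \<cdot> u = Q m \<sigma> \<cdot> v"
    show "u = v"
    proof (rule rmap_eqI[OF M u v])
      show "p l w \<cdot> u = p l w \<cdot> v" if "w \<in> thick F l" for l w
        using factorization_exists[OF that] Pu[OF _ _ u] Pu[OF _ _ v] eq(1) by metis
      show "q l w \<cdot> u = q l w \<cdot> v" if "w \<in> thick H l" for l w
        using factorization_exists[OF that] Qu[OF _ _ u] Qu[OF _ _ v] eq(2) by metis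
    qed
  qed
  with P(2) Q(2) that show thesis by blast
qed

lemma std_eq_flat: "std_simplex n = flat {{0..n}}"
  by (auto simp: fun_eq_iff std_simplex_def flat_def thick_singleton mono_maps_def all_maps_def)

text \<open>Both problems have the same representing object, and the same arrow \<open>u\<close> is
  the canonical map for both; only its characterization changes.\<close>

lemma G_rel_cover:
  assumes cov: "rel_cover C K Xo Xa Yo Ya f (thick F) (thick_simplex n) (GXo n) (pGX n)"
    and F: "\<And>l. thick F l \<subseteq> thick_simplex n l"
  shows "rel_cover C K GXo GXa GYo GYa Gf (flat F) (std_simplex n) (GXo n) (GXa n)"
proof -
  obtain L p q u where M: "rmap (thick F) (thick {{0..n}}) L p q" and u: "u \<in> hom C (GXo n) L" "u \<in> K"
    and pu: "\<And>m \<sigma>. \<sigma> \<in> thick F m \<Longrightarrow> p m \<sigma> \<cdot> u = pGX n m \<sigma>"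
    and qu: "\<And>m \<sigma>. \<sigma> \<in> thick {{0..n}} m \<Longrightarrow> q m \<sigma> \<cdot> u = f m \<cdot> pGX n m \<sigma>"
    using cov unfolding rel_cover_def thick_simplex_eq by blast
  have F': "thick F l \<subseteq> thick {{0..n}} l" for l using F unfolding thick_simplex_eq .
  obtain P Q where PQ: "G.rmap (flat F) (flat {{0..n}}) L P Q"
    "\<And>m l \<sigma> w. \<sigma> \<in> flat F m \<Longrightarrow> w \<in> thick_simplex m l \<Longrightarrow> pGX m l w \<cdot> P m \<sigma> = p l (ocomp \<sigma> w)"
    "\<And>m l \<sigma> w. \<sigma> \<in> flat {{0..n}} m \<Longrightarrow> w \<in> thick_simplex m l \<Longrightarrow> pGY m l w \<cdot> Q m \<sigma> = q l (ocomp \<sigma> w)"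
    using G_rmap[OF M F'] by blast
  have mono: "\<sigma> \<in> mono_maps m n" if "\<sigma> \<in> flat {{0..n}} m" for m \<sigma>
    using that std_eq_flat[of n] by (metis std_simplex_def)
  have fF: "flat F m \<subseteq> flat {{0..n}} m" for m using F' by (auto simp: flat_def)
  show ?thesis
    unfolding std_eq_flat
  proof (rule G.rel_coverI[OF PQ(1) u])
    fix m \<sigma> assume s: "\<sigma> \<in> flat F m"
    have sm: "\<sigma> \<in> mono_maps m n" using mono fF s by blast
    have Ph: "P m \<sigma> \<in> hom C L (GXo m)" using G.rmap_hom(1)[OF PQ(1) s] .
    show "P m \<sigma> \<cdot> u = GXa n m \<sigma>"
    proof (rule X.Map_eqI[OF GX.pG_Map X.comp_hom[OF u(1) Ph] GX.G.Xa_hom[OF sm]])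
      show "pGX m l w \<cdot> P m \<sigma> \<cdot> u = pGX m l w \<cdot> GXa n m \<sigma>" if w: "w \<in> thick_simplex m l" for l w
        using X.comp_assoc_hom[OF u(1) Ph GX.pG_hom[OF w]] PQ(2)[OF s w]
          pu[OF thick_ocomp[OF subsetD[OF flat_thick s] w]] GX.pG_Ga[OF sm w] by simp
    qed
  next
    fix m \<sigma> assume s: "\<sigma> \<in> flat {{0..n}} m"
    have sm: "\<sigma> \<in> mono_maps m n" using mono[OF s] .
    have Qh: "Q m \<sigma> \<in> hom C L (GYo m)" using G.rmap_hom(2)[OF PQ(1) s] .
    show "Q m \<sigma> \<cdot> u = Gf m \<cdot> GXa n m \<sigma>"
    proof (rule Y.Map_eqI[OF GY.pG_Map X.comp_hom[OF u(1) Qh] X.comp_hom[OF GX.G.Xa_hom[OF sm] Gf_hom]])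
      show "pGY m l w \<cdot> Q m \<sigma> \<cdot> u = pGY m l w \<cdot> Gf m \<cdot> GXa n m \<sigma>" if w: "w \<in> thick_simplex m l" for l w
        using X.comp_assoc_hom[OF u(1) Qh GY.pG_hom[OF w]] PQ(3)[OF s w]
          qu[OF thick_ocomp[OF subsetD[OF flat_thick s] w]] GX.pG_Ga[OF sm w]
          pGY_Gf_comp[OF w GX.G.Xa_hom[OF sm]] by simp
    qed
  qed
qed

end

lemma horn_eq_flat: "horn n i = flat (facets {0..n} ({0..n} - {i}))"
proof -
  have "w \<in> horn n i l \<longleftrightarrow> w \<in> flat (facets {0..n} ({0..n} - {i})) l" for w l
    by (auto simp: horn_def flat_def thick_facets mono_maps_def all_maps_def)
  then show ?thesis by blast
qed

lemma bdry_eq_flat: "bdry_simplex n = flat (facets {0..n} {0..n})"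
proof -
  have "w \<in> bdry_simplex n l \<longleftrightarrow> w \<in> flat (facets {0..n} {0..n}) l" for w l
    by (auto simp: bdry_simplex_def flat_def thick_facets mono_maps_def all_maps_def)
  then show ?thesis by blast
qed

lemma thick_facets_subset: "thick (facets V U) l \<subseteq> thick {V} l"
  by (auto simp: thick_def facets_def)

lemma vertex0_eq: "vertex0 = thick {{0}}"
proof -
  have "w \<in> vertex0 l \<longleftrightarrow> w \<in> thick {{0}} l" for w l
    using replicate_eqI[of w "Suc l" 0] by (auto simp: vertex0_def thick_singleton simp del: replicate_Suc)
  then show ?thesis by blast
qed

context simplicial_morphism
begin

text \<open>When the X part is given on all of \<open>T\<close>, the Y part is forced. This
  identifies \<open>Map(T,X)\<close> with the top of a filtration that ends in
  \<open>T\<close>.\<close>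

lemma rmap_full:
  assumes "is_Map C Xo Xa T L p"
  shows "rmap T T L p (\<lambda>m \<sigma>. f m \<cdot> p m \<sigma>)"
proof (rule rmapI)
  have c: "ss_cone C Xo Xa T L p" using X.Map_cone[OF assms] .
  show "rcone T T L p (\<lambda>m \<sigma>. f m \<cdot> p m \<sigma>)" unfolding rel_cone_def using c f_cone[OF c] by blast
  fix L' p' q' assume N: "rcone T T L' p' q'"
  obtain u where u: "u \<in> hom C L' L" "\<And>m \<sigma>. \<sigma> \<in> T m \<Longrightarrow> p m \<sigma> \<cdot> u = p' m \<sigma>"
    using X.Map_lift[OF assms rel_coneD(1)[OF N]] by blast
  have "(f m \<cdot> p m \<sigma>) \<cdot> u = q' m \<sigma>" if s: "\<sigma> \<in> T m" for m \<sigma>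
    using X.comp_assoc_hom[OF u(1) ss_coneD(2)[OF c s] f_hom] u(2)[OF s] rel_coneD(3)[OF N s] by simp
  then show "\<exists>u. u \<in> hom C L' L \<and> (\<forall>m. \<forall>\<sigma>\<in>T m. p m \<sigma> \<cdot> u = p' m \<sigma>) \<and>
      (\<forall>m. \<forall>\<sigma>\<in>T m. (f m \<cdot> p m \<sigma>) \<cdot> u = q' m \<sigma>)" using u by blast
next
  fix L' u v assume u: "u \<in> hom C L' L" "v \<in> hom C L' L" "\<forall>m. \<forall>\<sigma>\<in>T m. p m \<sigma> \<cdot> u = p m \<sigma> \<cdot> v"
  then show "u = v" by (intro X.Map_eqI[OF assms u(1,2)]) blast
qed

text \<open>The filtration produces some representing object over \<open>T\<close>; its comparison
  with the given \<open>A\<close> is an isomorphism, hence in \<open>K\<close>.\<close>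

lemma rel_cover_of_extends:
  assumes K: "stable_class C K" and ext: "extends K T S T" and M0: "rmap S T L0 p0 q0"
    and MA: "rmap T T A a (\<lambda>m \<sigma>. f m \<cdot> a m \<sigma>)" and ST: "\<And>m. S m \<subseteq> T m"
  shows "rel_cover C K Xo Xa Yo Ya f S T A a"
proof -
  obtain L p q u where 1: "rmap T T L p q" "u \<in> K" "u \<in> hom C L L0"
    "\<And>m \<sigma>. \<sigma> \<in> S m \<Longrightarrow> p0 m \<sigma> \<cdot> u = p m \<sigma>" "\<And>m \<tau>. \<tau> \<in> T m \<Longrightarrow> q0 m \<tau> \<cdot> u = q m \<tau>"
    using extendsE[OF ext M0] by blast
  obtain v where v: "v \<in> hom C A L" "is_iso C v" "\<And>m \<sigma>. \<sigma> \<in> T m \<Longrightarrow> p m \<sigma> \<cdot> v = a m \<sigma>"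
    "\<And>m \<sigma>. \<sigma> \<in> T m \<Longrightarrow> q m \<sigma> \<cdot> v = f m \<cdot> a m \<sigma>"
    using rmap_unique[OF 1(1) MA] by blast
  have "u \<cdot> v \<in> K"
    using stable_classD(3)[OF K stable_classD(2)[OF K v(2)] 1(2)] v(1) 1(3) by (simp add: hom_dom hom_cod)
  then show ?thesis
  proof (rule rel_coverI[OF M0 X.comp_hom[OF v(1) 1(3)]])
    show "p0 m \<sigma> \<cdot> u \<cdot> v = a m \<sigma>" if s: "\<sigma> \<in> S m" for m \<sigma>
      using X.comp_assoc_hom[OF v(1) 1(3) rmap_hom(1)[OF M0 s]] 1(4)[OF s] v(3)[OF subsetD[OF ST s]] by simp
    show "q0 m \<sigma> \<cdot> u \<cdot> v = f m \<cdot> a m \<sigma>" if s: "\<sigma> \<in> T m" for m \<sigma>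
      using X.comp_assoc_hom[OF v(1) 1(3) rmap_hom(2)[OF M0 s]] 1(5)[OF s] v(4)[OF s] by simp
  qed
qed

text \<open>The condition on the thick 1-simplex is stated for some representing object, while G(X)
  comes with an object of its own.\<close>

lemma rel_cover_change_object:
  assumes K: "stable_class C K" and cov: "rel_cover C K Xo Xa Yo Ya f S T A a"
    and MA: "rmap T T A a (\<lambda>m \<sigma>. f m \<cdot> a m \<sigma>)" and MB: "rmap T T B b (\<lambda>m \<sigma>. f m \<cdot> b m \<sigma>)"
    and ST: "\<And>m. S m \<subseteq> T m"
  shows "rel_cover C K Xo Xa Yo Ya f S T B b"
proof -
  obtain L p q u where M: "rmap S T L p q" and u: "u \<in> hom C A L" "u \<in> K"
    "\<And>m \<sigma>. \<sigma> \<in> S m \<Longrightarrow> p m \<sigma> \<cdot> u = a m \<sigma>" "\<And>m \<tau>. \<tau> \<in> T m \<Longrightarrow> q m \<tau> \<cdot> u = f m \<cdot> a m \<tau>"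
    using cov unfolding rel_cover_def by blast
  obtain v where v: "v \<in> hom C B A" "is_iso C v" "\<And>m \<sigma>. \<sigma> \<in> T m \<Longrightarrow> a m \<sigma> \<cdot> v = b m \<sigma>"
    "\<And>m \<sigma>. \<sigma> \<in> T m \<Longrightarrow> (f m \<cdot> a m \<sigma>) \<cdot> v = f m \<cdot> b m \<sigma>"
    using rmap_unique[OF MA MB] by blast
  have "u \<cdot> v \<in> K"
    using stable_classD(3)[OF K stable_classD(2)[OF K v(2)] u(2)] v(1) u(1) by (simp add: hom_dom hom_cod)
  then show ?thesis
  proof (rule rel_coverI[OF M X.comp_hom[OF v(1) u(1)]])
    show "p m \<sigma> \<cdot> u \<cdot> v = b m \<sigma>" if s: "\<sigma> \<in> S m" for m \<sigma>
      using X.comp_assoc_hom[OF v(1) u(1) rmap_hom(1)[OF M s]] u(3)[OF s] v(3)[OF subsetD[OF ST s]] by simp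
    show "q m \<sigma> \<cdot> u \<cdot> v = f m \<cdot> b m \<sigma>" if s: "\<sigma> \<in> T m" for m \<sigma>
      using X.comp_assoc_hom[OF v(1) u(1) rmap_hom(2)[OF M s]] u(4)[OF s] v(4)[OF s] by simp
  qed
qed

text \<open>The automorphism of the thick 1-simplex that exchanges its vertices reduces the vertex 1
  to the vertex 0.\<close>

lemma rel_cover_vertex1:
  assumes cov: "rel_cover C K Xo Xa Yo Ya f vertex0 (thick_simplex 1) L p"
    and M: "is_Map C Xo Xa (thick_simplex 1) L p"
  obtains p' where "rel_cover C K Xo Xa Yo Ya f (thick {{1}}) (thick_simplex 1) L p'"
    "rmap (thick_simplex 1) (thick_simplex 1) L p' (\<lambda>m \<sigma>. f m \<cdot> p' m \<sigma>)"
proof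
  define s where "s = (\<lambda>x::nat. 1 - x)"
  have ss: "map s (map s w) = w" if "w \<in> thick {{0..1}} l" for w l
    unfolding map_map using that by (intro map_idI) (auto simp: thick_singleton s_def)
  have sT: "map s w \<in> thick {{0..1}} l" if "w \<in> thick {{0..1}} l" for w l
    using that by (auto simp: thick_singleton s_def)
  have s01: "map s w \<in> thick {{1}} l" if "w \<in> thick {{0}} l" for w l
    using that by (auto simp: thick_singleton s_def)
  have s10: "map s w \<in> thick {{0}} l" if "w \<in> thick {{1}} l" for w l
    using that by (auto simp: thick_singleton s_def)
  have sub: "thick {{0}} l \<subseteq> thick {{0..1}} l" "thick {{1}} l \<subseteq> thick {{0..1}} l" for l
    by (auto simp: thick_singleton)
  obtain L0 p0 q0 u where M0: "rmap (thick {{0}}) (thick {{0..1}}) L0 p0 q0" and u: "u \<in> hom C L L0" "u \<in> K"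
    and pu: "\<And>m \<sigma>. \<sigma> \<in> thick {{0}} m \<Longrightarrow> p0 m \<sigma> \<cdot> u = p m \<sigma>"
    and qu: "\<And>m \<tau>. \<tau> \<in> thick {{0..1}} m \<Longrightarrow> q0 m \<tau> \<cdot> u = f m \<cdot> p m \<tau>"
    using cov unfolding rel_cover_def vertex0_eq thick_simplex_eq by blast
  have "rmap (thick {{1}}) (thick {{0..1}}) L0 (\<lambda>l w. p0 l (map s w)) (\<lambda>l w. q0 l (map s w))"
    by (rule rmap_relabel[OF M0, where \<psi> = s])
      (use subcomplex_thick s10 s01 sT ss sub in blast)+
  then show "rel_cover C K Xo Xa Yo Ya f (thick {{1}}) (thick_simplex 1) L (\<lambda>l w. p l (map s w))"
    unfolding thick_simplex_eq using u pu s10 qu sT by (intro rel_coverI) auto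
  have "rmap (thick {{0..1}}) (thick {{0..1}}) L p (\<lambda>m \<sigma>. f m \<cdot> p m \<sigma>)"
    using rmap_full[OF M] unfolding thick_simplex_eq .
  then show "rmap (thick_simplex 1) (thick_simplex 1) L (\<lambda>l w. p l (map s w)) (\<lambda>m \<sigma>. f m \<cdot> p m (map s \<sigma>))"
    unfolding thick_simplex_eq
    by (rule rmap_relabel[where \<psi> = s]) (use subcomplex_thick sT ss in blast)+
qed

end

context thick_morphism
begin

lemma pGX_rmap: "rmap (thick_simplex n) (thick_simplex n) (GXo n) (pGX n) (\<lambda>m \<sigma>. f m \<cdot> pGX n m \<sigma>)"
  by (rule rmap_full[OF GX.pG_Map])

lemma G_rel_cover_of_extends:
  assumes K: "stable_class C K"
    and ext: "extends K (thick_simplex n) (thick (facets {0..n} U)) (thick_simplex n)" and U: "U \<subseteq> {0..n}"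
    and MX: "\<And>F. finite F \<Longrightarrow> (\<And>V. V \<in> F \<Longrightarrow> finite V) \<Longrightarrow> \<exists>L p. is_Map C Xo Xa (thick F) L p"
    and MY: "\<And>F. finite F \<Longrightarrow> (\<And>V. V \<in> F \<Longrightarrow> finite V) \<Longrightarrow> \<exists>L p. is_Map C Yo Ya (thick F) L p"
  shows "rel_cover C K GXo GXa GYo GYa Gf (flat (facets {0..n} U)) (std_simplex n) (GXo n) (GXa n)"
proof -
  let ?F = "facets {0..n} U"
  have sub: "thick ?F l \<subseteq> thick_simplex n l" for l
    unfolding thick_simplex_eq by (rule thick_facets_subset)
  have F: "finite ?F" "\<And>V. V \<in> ?F \<Longrightarrow> finite V"
    using finite_subset[OF U] by (auto simp: facets_def)
  obtain L1 p1 L2 p2 where "is_Map C Xo Xa (thick ?F) L1 p1" "is_Map C Yo Ya (thick ?F) L2 p2"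
    using MX[OF F] MY[OF F] by blast
  from rmap_exists[OF sub this GY.pG_Map[of n]]
  obtain L p q where "rmap (thick ?F) (thick_simplex n) L p q" by blast
  from rel_cover_of_extends[OF K ext this pGX_rmap sub] show ?thesis
    by (rule G_rel_cover[OF _ sub])
qed

text \<open>From \<open>2 \<le> n\<close> on there are the three vertices that the pairing of words
  requires; dimension 1 is treated in \<open>G_horn_1\<close>.\<close>

lemma G_horn:
  assumes K: "stable_class C K" and n: "2 \<le> n" "i \<le> n"
    and cov: "\<And>m j. 0 < j \<Longrightarrow> j < m \<Longrightarrow> n \<le> m \<Longrightarrow>
      rel_cover C K Xo Xa Yo Ya f (horn m j) (std_simplex m) (Xo m) (Xa m)"
    and iso: "\<And>m j. 0 < j \<Longrightarrow> j < m \<Longrightarrow> k < m \<Longrightarrow>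
      rel_cover C {u. is_iso C u} Xo Xa Yo Ya f (horn m j) (std_simplex m) (Xo m) (Xa m)"
    and MX: "\<And>F. finite F \<Longrightarrow> (\<And>V. V \<in> F \<Longrightarrow> finite V) \<Longrightarrow> \<exists>L p. is_Map C Xo Xa (thick F) L p"
    and MY: "\<And>F. finite F \<Longrightarrow> (\<And>V. V \<in> F \<Longrightarrow> finite V) \<Longrightarrow> \<exists>L p. is_Map C Yo Ya (thick F) L p"
  shows "rel_cover C K GXo GXa GYo GYa Gf (horn n i) (std_simplex n) (GXo n) (GXa n)"
proof -
  have "extends K (thick {{0..n}}) (thick (facets {0..n} ({0..n} - {i}))) (thick {{0..n}})"
    by (rule extends_horn[OF K _ _ _ subcomplex_thick _ _ iso]) (use n cov in auto)
  then show ?thesis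
    unfolding horn_eq_flat thick_simplex_eq[symmetric]
    by (rule G_rel_cover_of_extends[OF K _ _ MX MY]) auto
qed

lemma G_horn_1:
  assumes K: "stable_class C K" and i: "i \<le> 1"
    and cov: "rel_cover C K Xo Xa Yo Ya f vertex0 (thick_simplex 1) L p"
    and M: "is_Map C Xo Xa (thick_simplex 1) L p"
  shows "rel_cover C K GXo GXa GYo GYa Gf (horn 1 i) (std_simplex 1) (GXo 1) (GXa 1)"
proof -
  have sub: "thick {{i}} l \<subseteq> thick_simplex 1 l" for l
    using i unfolding thick_simplex_eq by (auto simp: thick_singleton)
  have "\<exists>p'. rel_cover C K Xo Xa Yo Ya f (thick {{i}}) (thick_simplex 1) L p' \<and>
      rmap (thick_simplex 1) (thick_simplex 1) L p' (\<lambda>m \<sigma>. f m \<cdot> p' m \<sigma>)"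
  proof (cases "i = 0")
    case True
    then show ?thesis using cov rmap_full[OF M] unfolding vertex0_eq by blast
  next
    case False
    with i have "i = 1" by simp
    then show ?thesis using rel_cover_vertex1[OF cov M] by metis
  qed
  then obtain p' where "rel_cover C K Xo Xa Yo Ya f (thick {{i}}) (thick_simplex 1) L p'"
    "rmap (thick_simplex 1) (thick_simplex 1) L p' (\<lambda>m \<sigma>. f m \<cdot> p' m \<sigma>)" by blast
  from rel_cover_change_object[OF K this pGX_rmap sub]
  have "rel_cover C K GXo GXa GYo GYa Gf (flat {{i}}) (std_simplex 1) (GXo 1) (GXa 1)"
    by (rule G_rel_cover[OF _ sub])
  \<comment> \<open>The horn of the 1-simplex at \<open>i\<close> is the vertex
    \<open>i\<close>.\<close>
  moreover have "facets {0..1} ({0..1} - {i}) = {{i}}"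
  proof -
    have "i = 0 \<or> i = 1" using i by auto
    moreover have "{0..1} = {0, 1::nat}" by auto
    ultimately show ?thesis by (auto simp: facets_def)
  qed
  ultimately show ?thesis unfolding horn_eq_flat by simp
qed

lemma G_bdry:
  assumes K: "stable_class C K"
    and cov: "\<And>m. rel_cover C K Xo Xa Yo Ya f (bdry_simplex m) (std_simplex m) (Xo m) (Xa m)"
    and iso: "\<And>m. N \<le> m \<Longrightarrow>
      rel_cover C {u. is_iso C u} Xo Xa Yo Ya f (bdry_simplex m) (std_simplex m) (Xo m) (Xa m)"
    and MX: "\<And>F. finite F \<Longrightarrow> (\<And>V. V \<in> F \<Longrightarrow> finite V) \<Longrightarrow> \<exists>L p. is_Map C Xo Xa (thick F) L p"
    and MY: "\<And>F. finite F \<Longrightarrow> (\<And>V. V \<in> F \<Longrightarrow> finite V) \<Longrightarrow> \<exists>L p. is_Map C Yo Ya (thick F) L p"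
  shows "rel_cover C K GXo GXa GYo GYa Gf (bdry_simplex n) (std_simplex n) (GXo n) (GXa n)"
proof -
  have "extends K (thick {{0..n}}) (thick (facets {0..n} {0..n})) (thick {{0..n}})"
    by (rule extends_bdry[OF K _ _ subcomplex_thick _ cov iso]) auto
  then show ?thesis
    unfolding bdry_eq_flat thick_simplex_eq[symmetric]
    by (rule G_rel_cover_of_extends[OF K _ _ MX MY]) auto
qed

end

section \<open>The three assertions for k-categories in a descent category\<close>

lemma k_categoryD:
  assumes "k_category C Cov k Xo Xa"
  shows "simplicial_obj C Xo Xa" "0 < i \<Longrightarrow> i < n \<Longrightarrow> restr_cover C Cov Xo Xa n (horn n i)"
    "0 < i \<Longrightarrow> i < n \<Longrightarrow> k < n \<Longrightarrow> restr_iso C Xo Xa n (horn n i)"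
    "\<exists>L p. is_Map C Xo Xa (thick_simplex 1) L p \<and> p 0 [0] \<in> Cov"
  using assms unfolding k_category_def by blast+

locale descent =
  fixes C :: "('o,'a) cat" and Cov :: "'a set" and k :: nat
  assumes descent: "descent_category C Cov" and k: "0 < k"
begin

sublocale finite_limit_category C
  using descent_category_finite_limits[OF descent] .

lemma stable: "stable_class C Cov"
  using descent_category_stable[OF descent] .

lemma over_pointI:
  assumes "simplicial_obj C Xo Xa" "t \<in> obj C" "\<And>x. x \<in> obj C \<Longrightarrow> bang x \<in> hom C x t"
    "\<And>x u v. u \<in> hom C x t \<Longrightarrow> v \<in> hom C x t \<Longrightarrow> u = v"
  shows "simplicial_over_point C Xo Xa t bang"
  using assms by unfold_locales

lemma Map_exists:
  assumes "k_category C Cov k Xo Xa" "finite F" "\<And>V. V \<in> F \<Longrightarrow> finite V"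
  shows "\<exists>L p. is_Map C Xo Xa (thick F) L p"
proof -
  obtain t bang where t: "t \<in> obj C" "\<And>x. x \<in> obj C \<Longrightarrow> bang x \<in> hom C x t"
    "\<And>x u v. u \<in> hom C x t \<Longrightarrow> v \<in> hom C x t \<Longrightarrow> u = v"
    using terminal_exists by blast
  interpret simplicial_over_point C Xo Xa t bang
    using over_pointI[OF k_categoryD(1)[OF assms(1)] t] .
  obtain L p where "is_Map C Xo Xa (thick_simplex 1) L p" using k_categoryD(4)[OF assms(1)] by blast
  from Map_thick_exists[OF stable k_categoryD(2,3)[OF assms(1)] this assms(2,3)] show ?thesis .
qed

lemma Map_horn:
  assumes "k_category C Cov k Xo Xa" "0 < i" "i < n" "k < n"
  shows "is_Map C Xo Xa (horn n i) (Xo n) (Xa n)"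
proof -
  interpret simplicial_object C Xo Xa using k_categoryD(1)[OF assms(1)] by unfold_locales
  show ?thesis using Map_of_restr_iso[OF k_categoryD(3)[OF assms] subcomplex_horn] .
qed

text \<open>The boundary is treated through the horns at 1 in dimensions \<open>n\<close> and
  \<open>n - 1\<close>. Both dimensions must exceed \<open>k\<close>, whence \<open>k + 2\<close>;
  both horns must be inner, which follows from positivity of \<open>k\<close>.\<close>

lemma Map_bdry:
  assumes "k_category C Cov k Xo Xa" "k + 2 \<le> n"
  shows "is_Map C Xo Xa (bdry_simplex n) (Xo n) (Xa n)"
proof -
  interpret simplicial_object C Xo Xa using k_categoryD(1)[OF assms(1)] by unfold_locales
  show ?thesis
    using assms(2) k by (intro Map_bdry_of_horn Map_horn[OF assms(1)]) auto
qed

lemma thick_morphismI: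
  assumes "simplicial_map C Xo Xa Yo Ya f" "is_G C Xo Xa GXo GXa pGX" "is_G C Yo Ya GYo GYa pGY"
    "is_Gmap C f GXo pGX GYo pGY Gf"
  shows "thick_morphism C Xo Xa Yo Ya f GXo GXa pGX GYo GYa pGY Gf"
  using assms by unfold_locales (auto simp: simplicial_map_def)

lemma G_horn_covers:
  assumes X: "k_category C Cov k Xo Xa" and Y: "k_category C Cov k Yo Ya"
    and f: "quasi_fibration C Cov Xo Xa Yo Ya f"
    and G: "is_G C Xo Xa GXo GXa pGX" "is_G C Yo Ya GYo GYa pGY" "is_Gmap C f GXo pGX GYo pGY Gf"
    and n: "0 < n" "i \<le> n"
  shows "rel_cover C Cov GXo GXa GYo GYa Gf (horn n i) (std_simplex n) (GXo n) (GXa n)"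
    "k < n \<Longrightarrow> rel_cover C {u. is_iso C u} GXo GXa GYo GYa Gf (horn n i) (std_simplex n) (GXo n) (GXa n)"
proof -
  have f': "simplicial_map C Xo Xa Yo Ya f"
    "\<And>m j. 0 < j \<Longrightarrow> j < m \<Longrightarrow> rel_cover C Cov Xo Xa Yo Ya f (horn m j) (std_simplex m) (Xo m) (Xa m)"
    "\<exists>L p. is_Map C Xo Xa (thick_simplex 1) L p \<and> rel_cover C Cov Xo Xa Yo Ya f vertex0 (thick_simplex 1) L p"
    using f unfolding quasi_fibration_def by blast+
  interpret thick_morphism C Xo Xa Yo Ya f GXo GXa pGX GYo GYa pGY Gf
    using thick_morphismI[OF f'(1) G] .
  have iso: "rel_cover C {u. is_iso C u} Xo Xa Yo Ya f (horn m j) (std_simplex m) (Xo m) (Xa m)"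
    if "0 < j" "j < m" "k < m" for m j
    by (rule rel_cover_iso_of_Map[OF _ _ Map_horn[OF X that] Map_horn[OF Y that]]) (auto simp: horn_def)
  show "rel_cover C Cov GXo GXa GYo GYa Gf (horn n i) (std_simplex n) (GXo n) (GXa n)"
  proof (cases "n = 1")
    case True
    then show ?thesis using f'(3) G_horn_1[OF stable] n(2) by metis
  next
    case False
    then have "2 \<le> n" using n(1) by simp
    then show ?thesis
      by (rule G_horn[OF stable _ n(2) f'(2) iso Map_exists[OF X] Map_exists[OF Y]])
  qed
  show "rel_cover C {u. is_iso C u} GXo GXa GYo GYa Gf (horn n i) (std_simplex n) (GXo n) (GXa n)" if "k < n"
  proof -
    \<comment> \<open>Positivity of \<open>k\<close> keeps this case away from dimension 1, where
      the hypotheses provide only a cover.\<close>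
    have "2 \<le> n" using that k by simp
    then show ?thesis
    proof (rule G_horn[OF stable_class_isos _ n(2) _ iso Map_exists[OF X] Map_exists[OF Y]])
      show "rel_cover C {u. is_iso C u} Xo Xa Yo Ya f (horn m j) (std_simplex m) (Xo m) (Xa m)"
        if "0 < j" "j < m" "n \<le> m" for m j
        using iso[OF that(1,2)] that(3) \<open>k < n\<close> by simp
    qed
  qed
qed

text \<open>For the map from X to the point, the conditions of a quasi-fibration follow from those
  of a k-category, and the relative horn maps obtained for \<open>Go\<close> over the point are the
  absolute ones.\<close>

lemma k_groupoid_G:
  assumes X: "k_category C Cov k Xo Xa" and G: "is_G C Xo Xa Go Ga pG"
  shows "k_groupoid C Cov k Go Ga"
proof -
  obtain t bang where t: "t \<in> obj C" "\<And>x. x \<in> obj C \<Longrightarrow> bang x \<in> hom C x t"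
    "\<And>x u v. u \<in> hom C x t \<Longrightarrow> v \<in> hom C x t \<Longrightarrow> u = v"
    using terminal_exists by blast
  let ?t = "\<lambda>_. t" and ?i = "\<lambda>_ _ _. idt C t"
  interpret X: simplicial_over_point C Xo Xa t bang
    using over_pointI[OF k_categoryD(1)[OF X] t] .
  have GX: "simplicial_obj C Go Ga" using G by (simp add: is_G_def)
  interpret GX: simplicial_over_point C Go Ga t bang
    using over_pointI[OF GX t] .
  have q: "quasi_fibration C Cov Xo Xa ?t ?i (\<lambda>n. bang (Xo n))"
  proof -
    obtain L p where "is_Map C Xo Xa (thick_simplex 1) L p" "p 0 [0] \<in> Cov"
      using k_categoryD(4)[OF X] by blast
    then show ?thesis
      unfolding quasi_fibration_def
      using X.simplicial_map X.rel_cover_of_restr_cover[OF k_categoryD(2)[OF X]] X.rel_cover_vertex by blast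
  qed
  \<comment> \<open>The constant object at the point is its own G, with identities as limit
    cones.\<close>
  have Gt: "is_G C ?t ?i ?t ?i ?i"
    unfolding is_G_def using X.Y.simplicial X.point_Map idt_hom[OF t(1)] by (simp add: in_hom_iff)
  have Gb: "is_Gmap C (\<lambda>n. bang (Xo n)) Go pG ?t ?i (\<lambda>n. bang (Go n))"
    unfolding is_Gmap_def
  proof (intro allI conjI ballI)
    fix n l \<sigma> assume s: "\<sigma> \<in> thick_simplex n l"
    show "idt C t \<cdot> bang (Go n) = bang (Xo l) \<cdot> pG n l \<sigma>"
    proof (rule t(3))
      show "idt C t \<cdot> bang (Go n) \<in> hom C (Go n) t"
        using comp_hom[OF t(2)[OF GX.Xo_obj] idt_hom[OF t(1)]] .
      have "pG n l \<sigma> \<in> hom C (Go n) (Xo l)"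
        using G s unfolding is_G_def is_Map_def ss_cone_def by blast
      then show "bang (Xo l) \<cdot> pG n l \<sigma> \<in> hom C (Go n) t"
        using t(2)[OF X.Xo_obj] by (rule comp_hom)
    qed
  qed (rule t(2)[OF GX.Xo_obj])
  note covers = G_horn_covers[OF X X.point_k_category[OF stable] q G Gt Gb]
  show ?thesis
    unfolding k_groupoid_def restr_iso_eq
    using GX.simplicial GX.restr_cover_of_rel_cover[OF covers(1)] GX.restr_cover_of_rel_cover[OF covers(2)]
    by blast
qed

lemma fibration_G:
  assumes X: "k_category C Cov k Xo Xa" and Y: "k_category C Cov k Yo Ya"
    and f: "quasi_fibration C Cov Xo Xa Yo Ya f"
    and G: "is_G C Xo Xa GXo GXa pGX" "is_G C Yo Ya GYo GYa pGY" "is_Gmap C f GXo pGX GYo pGY Gf"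
  shows "fibration C Cov GXo GXa GYo GYa Gf"
proof -
  have "simplicial_map C Xo Xa Yo Ya f" using f unfolding quasi_fibration_def by blast
  then interpret thick_morphism C Xo Xa Yo Ya f GXo GXa pGX GYo GYa pGY Gf
    using thick_morphismI G by blast
  show ?thesis
    unfolding fibration_def using G.simplicial_map G_horn_covers(1)[OF X Y f G] by blast
qed

lemma hypercover_G:
  assumes X: "k_category C Cov k Xo Xa" and Y: "k_category C Cov k Yo Ya"
    and f: "hypercover C Cov Xo Xa Yo Ya f"
    and G: "is_G C Xo Xa GXo GXa pGX" "is_G C Yo Ya GYo GYa pGY" "is_Gmap C f GXo pGX GYo pGY Gf"
  shows "hypercover C Cov GXo GXa GYo GYa Gf"
proof -
  have f': "simplicial_map C Xo Xa Yo Ya f"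
    "\<And>m. rel_cover C Cov Xo Xa Yo Ya f (bdry_simplex m) (std_simplex m) (Xo m) (Xa m)"
    using f unfolding hypercover_def by blast+
  interpret thick_morphism C Xo Xa Yo Ya f GXo GXa pGX GYo GYa pGY Gf
    using thick_morphismI[OF f'(1) G] .
  have iso: "rel_cover C {u. is_iso C u} Xo Xa Yo Ya f (bdry_simplex m) (std_simplex m) (Xo m) (Xa m)"
    if "k + 2 \<le> m" for m
    by (rule rel_cover_iso_of_Map[OF _ _ Map_bdry[OF X that] Map_bdry[OF Y that]]) (auto simp: bdry_simplex_def)
  show ?thesis
    unfolding hypercover_def
    using G.simplicial_map G_bdry[OF stable f'(2) iso Map_exists[OF X] Map_exists[OF Y]] by blast
qed

lemma G_exists:
  assumes X: "k_category C Cov k Xo Xa"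
  shows "\<exists>Go Ga pG. is_G C Xo Xa Go Ga pG"
proof -
  interpret simplicial_object C Xo Xa using k_categoryD(1)[OF X] by unfold_locales
  show ?thesis
    by (rule is_G_exists) (use Map_exists[OF X, of "{{0.._}}"] in \<open>simp add: thick_simplex_eq\<close>)
qed

end

theorem theorem6p12:
  fixes C :: "('o, 'a) cat" and Cov :: "'a set" and k :: nat
  assumes "descent_category C Cov" and "0 < k"
  shows
    \<comment> \<open>(i)\<close>
    "(\<forall>Xo Xa. k_category C Cov k Xo Xa \<longrightarrow>
        (\<exists>Go Ga pG. is_G C Xo Xa Go Ga pG) \<and>
        (\<forall>Go Ga pG. is_G C Xo Xa Go Ga pG \<longrightarrow> k_groupoid C Cov k Go Ga))
   \<and>
    \<comment> \<open>(ii)\<close>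
    (\<forall>Xo Xa Yo Ya f GXo GXa pGX GYo GYa pGY Gf.
        k_category C Cov k Xo Xa \<and> k_category C Cov k Yo Ya \<and>
        quasi_fibration C Cov Xo Xa Yo Ya f \<and>
        is_G C Xo Xa GXo GXa pGX \<and> is_G C Yo Ya GYo GYa pGY \<and>
        is_Gmap C f GXo pGX GYo pGY Gf \<longrightarrow>
        k_groupoid C Cov k GXo GXa \<and> k_groupoid C Cov k GYo GYa \<and>
        fibration C Cov GXo GXa GYo GYa Gf)
   \<and>
    \<comment> \<open>(iii)\<close>
    (\<forall>Xo Xa Yo Ya f GXo GXa pGX GYo GYa pGY Gf.
        k_category C Cov k Xo Xa \<and> k_category C Cov k Yo Ya \<and>
        hypercover C Cov Xo Xa Yo Ya f \<and>
        is_G C Xo Xa GXo GXa pGX \<and> is_G C Yo Ya GYo GYa pGY \<and>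
        is_Gmap C f GXo pGX GYo pGY Gf \<longrightarrow>
        k_groupoid C Cov k GXo GXa \<and> k_groupoid C Cov k GYo GYa \<and>
        hypercover C Cov GXo GXa GYo GYa Gf)"
proof -
  interpret descent C Cov k using assms by unfold_locales
  show ?thesis
  proof (intro conjI allI impI; (elim conjE)?)
    fix Xo Xa assume X: "k_category C Cov k Xo Xa"
    show "\<exists>Go Ga pG. is_G C Xo Xa Go Ga pG" by (rule G_exists[OF X])
    show "k_groupoid C Cov k Go Ga" if "is_G C Xo Xa Go Ga pG" for Go Ga pG
      by (rule k_groupoid_G[OF X that])
  next
    fix Xo Xa Yo Ya f GXo GXa pGX GYo GYa pGY Gf
    assume X: "k_category C Cov k Xo Xa" and Y: "k_category C Cov k Yo Ya"
      and G: "is_G C Xo Xa GXo GXa pGX" "is_G C Yo Ya GYo GYa pGY" "is_Gmap C f GXo pGX GYo pGY Gf"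
    \<comment> \<open>The two claims are listed twice because they are goals of both (ii) and (iii),
      which are discharged together.\<close>
    show "k_groupoid C Cov k GXo GXa" "k_groupoid C Cov k GYo GYa"
      "k_groupoid C Cov k GXo GXa" "k_groupoid C Cov k GYo GYa"
      using k_groupoid_G[OF X G(1)] k_groupoid_G[OF Y G(2)] by blast+
    show "fibration C Cov GXo GXa GYo GYa Gf" if "quasi_fibration C Cov Xo Xa Yo Ya f"
      by (rule fibration_G[OF X Y that G])
    show "hypercover C Cov GXo GXa GYo GYa Gf" if "hypercover C Cov Xo Xa Yo Ya f"
      by (rule hypercover_G[OF X Y that G])
  qed
qed

end
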